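(* Let $R$ be a commutative Noetherian ring with identity, $\mathfrak{a}$ an ideal of $R$, $M$ a finitely generated $R$-module of finite projective dimension $\operatorname{pd}(M)<\infty$, and $X$ an arbitrary $R$-module. Then $H^{i}_{\mathfrak{a}}(M,X)=0$ for all $i>\operatorname{pd}(M)+\operatorname{cd}(\mathfrak{a},X)$, and $$H^{\operatorname{pd}(M)+\operatorname{cd}(\mathfrak{a},X)}_{\mathfrak{a}}(M,X)\cong \operatorname{Ext}^{\operatorname{pd}(M)}_{R}\bigl(M,H^{\operatorname{cd}(\mathfrak{a},X)}_{\mathfrak{a}}(X)\bigr).$$
   Context: $H^{i}_{\mathfrak{a}}(X)$ is the $i$-th ordinary local cohomology module of $X$ with respect to $\mathfrak{a}$. The generalized local cohomology modules are $H^{i}_{\mathfrak{a}}(M,X)=\varinjlim_{n}\operatorname{Ext}^{i}_{R}(M/\mathfrak{a}^{n}M,X)$. The cohomological dimension $\operatorname{cd}(\mathfrak{a},X)$ of $X$ at $\mathfrak{a}$ is the largest integer $i$ for which $H^{i}_{\mathfrak{a}}(X)$ is non-zero. *)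

theory Defs
  imports
    "HOL-Library.Extended_Real"
    "HOL-Algebra.Module"
    "HOL-Algebra.Ideal_Product"
    "HOL-Algebra.Ring_Divisibility"
begin

section \<open>Modules and homomorphisms\<close>

text \<open>
  Records of type \<^typ>\<open>('a, 'b) module\<close> extend ring records; the fields \<^const>\<open>monoid.mult\<close> and
  \<^const>\<open>one\<close> play no role for modules and are left \<^const>\<open>undefined\<close> in the constructions below.
\<close>

definition mod_hom ::
    "('a, 'r) ring_scheme \<Rightarrow> ('a, 'm) module \<Rightarrow> ('a, 'n) module \<Rightarrow> ('m \<Rightarrow> 'n) set"
  where "mod_hom R M N =
    {f \<in> carrier M \<rightarrow>\<^sub>E carrier N.
       (\<forall>x\<in>carrier M. \<forall>y\<in>carrier M. f (x \<oplus>\<^bsub>M\<^esub> y) = f x \<oplus>\<^bsub>N\<^esub> f y) \<and>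
       (\<forall>r\<in>carrier R. \<forall>x\<in>carrier M. f (r \<odot>\<^bsub>M\<^esub> x) = r \<odot>\<^bsub>N\<^esub> f x)}"

definition mod_isomorphic ::
    "('a, 'r) ring_scheme \<Rightarrow> ('a, 'm) module \<Rightarrow> ('a, 'n) module \<Rightarrow> bool"
  where "mod_isomorphic R M N \<longleftrightarrow>
    (\<exists>f\<in>mod_hom R M N. bij_betw f (carrier M) (carrier N))"

definition zero_mod :: "('a, 'm) module \<Rightarrow> bool"
  where "zero_mod M \<longleftrightarrow> carrier M = {\<zero>\<^bsub>M\<^esub>}"

definition gen_submodule :: "('a, 'r) ring_scheme \<Rightarrow> ('a, 'm) module \<Rightarrow> 'm set \<Rightarrow> 'm set"
  where "gen_submodule R M S = \<Inter>{N. submodule N R M \<and> S \<subseteq> N}"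

definition fin_gen :: "('a, 'r) ring_scheme \<Rightarrow> ('a, 'm) module \<Rightarrow> bool"
  where "fin_gen R M \<longleftrightarrow>
    (\<exists>S \<subseteq> carrier M. finite S \<and> gen_submodule R M S = carrier M)"

definition Hom_mod ::
    "('a, 'r) ring_scheme \<Rightarrow> ('a, 'm) module \<Rightarrow> ('a, 'n) module \<Rightarrow> ('a, 'm \<Rightarrow> 'n) module"
  where "Hom_mod R M N =
    \<lparr>carrier = mod_hom R M N, monoid.mult = undefined, monoid.one = undefined,
     ring.zero = (\<lambda>x\<in>carrier M. \<zero>\<^bsub>N\<^esub>),
     ring.add = (\<lambda>f g. \<lambda>x\<in>carrier M. f x \<oplus>\<^bsub>N\<^esub> g x),
     module.smult = (\<lambda>r f. \<lambda>x\<in>carrier M. r \<odot>\<^bsub>N\<^esub> f x)\<rparr>"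

definition quot_mod :: "('a, 'm) module \<Rightarrow> 'm set \<Rightarrow> ('a, 'm set) module"
  where "quot_mod M H =
    \<lparr>carrier = a_rcosets\<^bsub>M\<^esub> H, monoid.mult = undefined, monoid.one = undefined,
     ring.zero = H,
     ring.add = set_add M,
     module.smult = (\<lambda>r C. \<Union>x\<in>C. H +>\<^bsub>M\<^esub> (r \<odot>\<^bsub>M\<^esub> x))\<rparr>"


section \<open>Injective and projective modules\<close>

text \<open>
  A definition cannot quantify over types, so modules that have to be quantified over are taken
  with elements in the following type, of cardinality \<open>2\<^sup>\<lambda>\<close> for the infinite cardinal
  \<open>\<lambda> = \<aleph>\<^sub>0 + |'a| + |'b|\<close>. This is no restriction:
  \<^item> By Baer's criterion, injectivity needs to be tested on ideals of \<open>R\<close> only, and projectivity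
    of \<open>P\<close> on the epimorphism from the free module on \<open>P\<close> onto \<open>P\<close> only; isomorphic copies of
    these modules exist in the type.
  \<^item> A module \<open>N\<close> of cardinality at most \<open>2\<^sup>\<lambda>\<close> embeds into the injective module of additive maps
    from \<open>R\<close> to a divisible hull of \<open>N\<close>, again of cardinality at most \<open>2\<^sup>\<lambda>\<close>. So every module
    over \<open>'b\<close> has an injective resolution in the type.
  \<^item> Every module over \<open>'b\<close> has a free resolution with modules of cardinality at most \<open>\<lambda>\<close>, and
    projective dimension can be read off from its syzygies.
\<close>

type_synonym ('a, 'b) large = "(nat + 'a + 'b) set"

definition injective_module :: "('a, 'r) ring_scheme \<Rightarrow> ('a, 'e) module \<Rightarrow> bool"
  where "injective_module R E \<longleftrightarrow> module R E \<and>
    (\<forall>(A :: ('a, ('a, 'e) large) module) (B :: ('a, ('a, 'e) large) module) f g.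
       module R A \<and> module R B \<and> f \<in> mod_hom R A B \<and> inj_on f (carrier A) \<and> g \<in> mod_hom R A E \<longrightarrow>
       (\<exists>h\<in>mod_hom R B E. \<forall>x\<in>carrier A. h (f x) = g x))"

definition projective_module :: "('a, 'r) ring_scheme \<Rightarrow> ('a, 'p) module \<Rightarrow> bool"
  where "projective_module R P \<longleftrightarrow> module R P \<and>
    (\<forall>(A :: ('a, ('a, 'p) large) module) (B :: ('a, ('a, 'p) large) module) f g.
       module R A \<and> module R B \<and> f \<in> mod_hom R A B \<and> f ` carrier A = carrier B \<and>
       g \<in> mod_hom R P B \<longrightarrow>
       (\<exists>h\<in>mod_hom R P A. \<forall>x\<in>carrier P. f (h x) = g x))"

text \<open>\<open>0 \<rightarrow> Y \<rightarrow> E 0 \<rightarrow> E 1 \<rightarrow> \<dots>\<close> with augmentation \<open>aug\<close> and differentials \<open>d\<close>\<close>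

definition injective_resolution ::
    "('a, 'r) ring_scheme \<Rightarrow> ('a, 'x) module \<Rightarrow>
     (nat \<Rightarrow> ('a, 'e) module) \<Rightarrow> (nat \<Rightarrow> 'e \<Rightarrow> 'e) \<Rightarrow> ('x \<Rightarrow> 'e) \<Rightarrow> bool"
  where "injective_resolution R Y E d aug \<longleftrightarrow>
    (\<forall>n. injective_module R (E n)) \<and>
    (\<forall>n. d n \<in> mod_hom R (E n) (E (Suc n))) \<and>
    aug \<in> mod_hom R Y (E 0) \<and> inj_on aug (carrier Y) \<and>
    aug ` carrier Y = a_kernel (E 0) (E 1) (d 0) \<and>
    (\<forall>n. d n ` carrier (E n) = a_kernel (E (Suc n)) (E (Suc (Suc n))) (d (Suc n)))"

text \<open>\<open>\<dots> \<rightarrow> P 1 \<rightarrow> P 0 \<rightarrow> M \<rightarrow> 0\<close> with augmentation \<open>aug\<close> and \<open>d n : P (n + 1) \<rightarrow> P n\<close>\<close>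

definition projective_resolution ::
    "('a, 'r) ring_scheme \<Rightarrow> ('a, 'm) module \<Rightarrow>
     (nat \<Rightarrow> ('a, 'p) module) \<Rightarrow> (nat \<Rightarrow> 'p \<Rightarrow> 'p) \<Rightarrow> ('p \<Rightarrow> 'm) \<Rightarrow> bool"
  where "projective_resolution R M P d aug \<longleftrightarrow>
    (\<forall>n. projective_module R (P n)) \<and>
    (\<forall>n. d n \<in> mod_hom R (P (Suc n)) (P n)) \<and>
    aug \<in> mod_hom R (P 0) M \<and> aug ` carrier (P 0) = carrier M \<and>
    d 0 ` carrier (P 1) = a_kernel (P 0) M aug \<and>
    (\<forall>n. d (Suc n) ` carrier (P (Suc (Suc n))) = a_kernel (P (Suc n)) (P n) (d n))"

text \<open>
  The infimum of the lengths of projective resolutions, \<open>\<infinity>\<close> if there is none of finite length.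
  The zero module gets projective dimension \<open>0\<close>.
\<close>

definition proj_dim :: "('a, 'r) ring_scheme \<Rightarrow> ('a, 'm) module \<Rightarrow> enat"
  where "proj_dim R M = Inf {enat n | n.
    \<exists>(P :: nat \<Rightarrow> ('a, ('a, 'm) large) module) d aug.
      projective_resolution R M P d aug \<and> (\<forall>k>n. zero_mod (P k))}"


section \<open>Ext as a right derived functor\<close>

definition coboundaries :: "(nat \<Rightarrow> ('a, 'c) module) \<Rightarrow> (nat \<Rightarrow> 'c \<Rightarrow> 'c) \<Rightarrow> nat \<Rightarrow> 'c set"
  where "coboundaries C d i =
    (case i of 0 \<Rightarrow> {\<zero>\<^bsub>C 0\<^esub>} | Suc j \<Rightarrow> d j ` carrier (C j))"

definition cohomology ::
    "(nat \<Rightarrow> ('a, 'c) module) \<Rightarrow> (nat \<Rightarrow> 'c \<Rightarrow> 'c) \<Rightarrow> nat \<Rightarrow> ('a, 'c set) module"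
  where "cohomology C d i =
    quot_mod ((C i)\<lparr>carrier := a_kernel (C i) (C (Suc i)) (d i)\<rparr>) (coboundaries C d i)"

text \<open>One injective resolution is chosen for each module; derived functors are computed with it.\<close>

definition inj_res ::
    "('a, 'r) ring_scheme \<Rightarrow> ('a, 'x) module \<Rightarrow>
     (nat \<Rightarrow> ('a, ('a, 'x) large) module) \<times> (nat \<Rightarrow> ('a, 'x) large \<Rightarrow> ('a, 'x) large)"
  where "inj_res R Y = (SOME (E, d). \<exists>aug. injective_resolution R Y E d aug)"

definition inj_obj ::
    "('a, 'r) ring_scheme \<Rightarrow> ('a, 'x) module \<Rightarrow> nat \<Rightarrow> ('a, ('a, 'x) large) module"
  where "inj_obj R Y = fst (inj_res R Y)"

definition inj_diff ::
    "('a, 'r) ring_scheme \<Rightarrow> ('a, 'x) module \<Rightarrow> nat \<Rightarrow> ('a, 'x) large \<Rightarrow> ('a, 'x) large"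
  where "inj_diff R Y = snd (inj_res R Y)"

definition Hom_obj ::
    "('a, 'r) ring_scheme \<Rightarrow> ('a, 'm) module \<Rightarrow> ('a, 'x) module \<Rightarrow>
     nat \<Rightarrow> ('a, 'm \<Rightarrow> ('a, 'x) large) module"
  where "Hom_obj R M Y n = Hom_mod R M (inj_obj R Y n)"

definition Hom_diff ::
    "('a, 'r) ring_scheme \<Rightarrow> ('a, 'm) module \<Rightarrow> ('a, 'x) module \<Rightarrow>
     nat \<Rightarrow> ('m \<Rightarrow> ('a, 'x) large) \<Rightarrow> ('m \<Rightarrow> ('a, 'x) large)"
  where "Hom_diff R M Y n g = compose (carrier M) (inj_diff R Y n) g"

definition Ext ::
    "('a, 'r) ring_scheme \<Rightarrow> nat \<Rightarrow> ('a, 'm) module \<Rightarrow> ('a, 'x) module \<Rightarrow>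
     ('a, ('m \<Rightarrow> ('a, 'x) large) set) module"
  where "Ext R i M Y = cohomology (Hom_obj R M Y) (Hom_diff R M Y) i"

text \<open>The map from \<open>Ext R i M Y\<close> to \<open>Ext R i N Y\<close> induced by \<open>f : N \<rightarrow> M\<close>: \<open>[g] \<mapsto> [g \<circ> f]\<close>\<close>

definition Ext_map ::
    "('a, 'r) ring_scheme \<Rightarrow> nat \<Rightarrow> ('a, 'n) module \<Rightarrow> ('n \<Rightarrow> 'm) \<Rightarrow> ('a, 'x) module \<Rightarrow>
     ('m \<Rightarrow> ('a, 'x) large) set \<Rightarrow> ('n \<Rightarrow> ('a, 'x) large) set"
  where "Ext_map R i N f Y C =
    coboundaries (Hom_obj R N Y) (Hom_diff R N Y) i
      <+>\<^bsub>Hom_obj R N Y i\<^esub> (\<lambda>g. compose (carrier N) g f) ` C"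


section \<open>Direct limits of sequences of modules\<close>

text \<open>\<open>dl_trans \<phi> n k\<close> is the composite \<open>\<phi> (n + k - 1) \<circ> \<dots> \<circ> \<phi> n : G n \<rightarrow> G (n + k)\<close>\<close>

primrec dl_trans :: "(nat \<Rightarrow> 'g \<Rightarrow> 'g) \<Rightarrow> nat \<Rightarrow> nat \<Rightarrow> 'g \<Rightarrow> 'g"
  where
    "dl_trans \<phi> n 0 x = x"
  | "dl_trans \<phi> n (Suc k) x = \<phi> (n + k) (dl_trans \<phi> n k x)"

definition dl_rel ::
    "(nat \<Rightarrow> ('a, 'g) module) \<Rightarrow> (nat \<Rightarrow> 'g \<Rightarrow> 'g) \<Rightarrow> ((nat \<times> 'g) \<times> (nat \<times> 'g)) set"
  where "dl_rel G \<phi> = {((n, x), (m, y)). x \<in> carrier (G n) \<and> y \<in> carrier (G m) \<and>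
    (\<exists>k l. n + k = m + l \<and> dl_trans \<phi> n k x = dl_trans \<phi> m l y)}"

definition direct_limit ::
    "(nat \<Rightarrow> ('a, 'g) module) \<Rightarrow> (nat \<Rightarrow> 'g \<Rightarrow> 'g) \<Rightarrow> ('a, (nat \<times> 'g) set) module"
  where "direct_limit G \<phi> =
    \<lparr>carrier = (SIGMA n:UNIV. carrier (G n)) // dl_rel G \<phi>, monoid.mult = undefined, monoid.one = undefined,
     ring.zero = dl_rel G \<phi> `` {(0, \<zero>\<^bsub>G 0\<^esub>)},
     ring.add = (\<lambda>P Q. \<Union>(n, x)\<in>P. \<Union>(m, y)\<in>Q.
              dl_rel G \<phi> `` {(n + m, dl_trans \<phi> n m x \<oplus>\<^bsub>G (n + m)\<^esub> dl_trans \<phi> m n y)}),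
     module.smult = (\<lambda>r P. \<Union>(n, x)\<in>P. dl_rel G \<phi> `` {(n, r \<odot>\<^bsub>G n\<^esub> x)})\<rparr>"


section \<open>Local cohomology\<close>

abbreviation ideal_pow :: "('a, 'r) ring_scheme \<Rightarrow> 'a set \<Rightarrow> nat \<Rightarrow> 'a set"
  where "ideal_pow R \<aa> n \<equiv> \<aa> [^]\<^bsub>ideals_set R\<^esub> n"

definition torsion :: "('a, 'r) ring_scheme \<Rightarrow> 'a set \<Rightarrow> ('a, 'm) module \<Rightarrow> 'm set"
  where "torsion R \<aa> M = {x \<in> carrier M. \<exists>n. \<forall>r\<in>ideal_pow R \<aa> n. r \<odot>\<^bsub>M\<^esub> x = \<zero>\<^bsub>M\<^esub>}"

text \<open>Ordinary local cohomology: the right derived functors of the \<open>\<aa>\<close>-torsion functor\<close>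

definition local_cohomology ::
    "('a, 'r) ring_scheme \<Rightarrow> 'a set \<Rightarrow> nat \<Rightarrow> ('a, 'x) module \<Rightarrow> ('a, ('a, 'x) large set) module"
  where "local_cohomology R \<aa> i Y =
    cohomology (\<lambda>n. (inj_obj R Y n)\<lparr>carrier := torsion R \<aa> (inj_obj R Y n)\<rparr>) (inj_diff R Y) i"

text \<open>
  The largest \<open>i\<close> with nonzero local cohomology; \<open>-\<infinity>\<close> if all local cohomology modules vanish
  (and \<open>\<infinity>\<close> if the nonvanishing degrees were unbounded).
\<close>

definition coh_dim :: "('a, 'r) ring_scheme \<Rightarrow> 'a set \<Rightarrow> ('a, 'x) module \<Rightarrow> ereal"
  where "coh_dim R \<aa> Y =
    (SUP i \<in> {i. \<not> zero_mod (local_cohomology R \<aa> i Y)}. ereal (real i))"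

definition pow_submodule ::
    "('a, 'r) ring_scheme \<Rightarrow> 'a set \<Rightarrow> ('a, 'm) module \<Rightarrow> nat \<Rightarrow> 'm set"
  where "pow_submodule R \<aa> M n =
    gen_submodule R M {r \<odot>\<^bsub>M\<^esub> x | r x. r \<in> ideal_pow R \<aa> n \<and> x \<in> carrier M}"

definition pow_quot ::
    "('a, 'r) ring_scheme \<Rightarrow> 'a set \<Rightarrow> ('a, 'm) module \<Rightarrow> nat \<Rightarrow> ('a, 'm set) module"
  where "pow_quot R \<aa> M n = quot_mod M (pow_submodule R \<aa> M n)"

text \<open>The natural epimorphism from \<open>M / \<aa>\<^bsup>n+1\<^esup> M\<close> to \<open>M / \<aa>\<^bsup>n\<^esup> M\<close>\<close>

definition pow_proj ::
    "('a, 'r) ring_scheme \<Rightarrow> 'a set \<Rightarrow> ('a, 'm) module \<Rightarrow> nat \<Rightarrow> 'm set \<Rightarrow> 'm set"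
  where "pow_proj R \<aa> M n =
    (\<lambda>C\<in>carrier (pow_quot R \<aa> M (Suc n)). pow_submodule R \<aa> M n <+>\<^bsub>M\<^esub> C)"

definition gen_local_cohomology ::
    "('a, 'r) ring_scheme \<Rightarrow> 'a set \<Rightarrow> nat \<Rightarrow> ('a, 'm) module \<Rightarrow> ('a, 'x) module \<Rightarrow>
     ('a, (nat \<times> ('m set \<Rightarrow> ('a, 'x) large) set) set) module"
  where "gen_local_cohomology R \<aa> i M Y =
    direct_limit (\<lambda>n. Ext R i (pow_quot R \<aa> M n) Y)
      (\<lambda>n. Ext_map R i (pow_quot R \<aa> M (Suc n)) (pow_proj R \<aa> M n) Y)"

end

theory Submission
  imports Defs "HOL-Algebra.IntRing"
begin

text \<open>
  Let \<open>E\<close> be the injective resolution of \<open>Y\<close>. Since \<open>M\<close> is finitely generated, a map from \<open>M\<close> to the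
  \<open>a\<close>-torsion of \<open>E\<close> factors through some \<open>M / a^n M\<close>, so generalized local cohomology is the
  cohomology of \<open>Hom(M, \<Gamma>)\<close>, where \<open>\<Gamma>\<close> is the torsion subcomplex of \<open>E\<close>. Over a Noetherian ring the terms of
  \<open>\<Gamma>\<close> are again injective, by a weak Artin--Rees lemma and Baer's criterion, and \<open>\<Gamma>\<close> is exact above
  \<open>c = cd(a, Y)\<close>. Dimension shifting along a projective resolution of \<open>M\<close> of length \<open>p\<close> gives the vanishing
  above \<open>p + c\<close>. The projection from the cycles of \<open>\<Gamma>\<close> in degree \<open>c\<close> onto \<open>H = H^c(\<Gamma>)\<close> extends to a map from
  \<open>\<Gamma>\<close>, shifted by \<open>c\<close>, to the injective resolution of \<open>H\<close>, and dimension shifting shows that it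
  induces an isomorphism of \<open>H^{p+c}(Hom(M, \<Gamma>))\<close> with \<open>Ext^p(M, H)\<close>.

  The resolutions chosen in the definition of Ext exist in the prescribed type because a module \<open>N\<close> embeds into
  the module of additive maps from \<open>R\<close> to a divisible hull of \<open>N\<close>, whose cardinality is under control.
\<close>

section \<open>Linear maps and submodules\<close>

text \<open>Each dimension shift replaces a module by a syzygy and lowers the degree by one. From
  degree \<open>p + c\<close>, exactly p shifts lead to degree c, and by then the resolution is used
  up: the last syzygy is projective. So the cohomology of \<Gamma> below c never enters. The map of
  complexes takes the place of the independence of Ext from the resolution: \<Gamma>, from degree c
  on, is compared directly with the one chosen resolution of H. Long exact sequences are replaced by
  explicit corrections of maps, made by lifting from projective modules and extending into injective
  ones. The formal obstacle is that no definition quantifies over types. M, its syzygies, Y, H and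
  the resolutions live over different types, while \<open>injective_module\<close> and
  \<open>projective_module\<close> test modules over one type only. Injectivity is therefore turned
  into Baer's condition on ideals, and projectivity into lifting against modules over any
  type.\<close>

locale rmodule = module R M for R :: "('a, 'r) ring_scheme" (structure) and M :: "('a, 'm) module" (structure)

text \<open>Membership in \<open>mod_hom\<close> also fixes the value off the carrier, which
  composition and pointwise operations do not respect. Maps are handled as \<open>mod_map\<close>
  and restricted only where a member of \<open>mod_hom\<close> is called for.\<close>

definition mod_map ::
    "('a, 'r) ring_scheme \<Rightarrow> ('a, 'm) module \<Rightarrow> ('a, 'n) module \<Rightarrow> ('m \<Rightarrow> 'n) \<Rightarrow> bool"
  where "mod_map R M N f \<longleftrightarrow>
    (\<forall>x\<in>carrier M. f x \<in> carrier N) \<and>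
    (\<forall>x\<in>carrier M. \<forall>y\<in>carrier M. f (x \<oplus>\<^bsub>M\<^esub> y) = f x \<oplus>\<^bsub>N\<^esub> f y) \<and>
    (\<forall>r\<in>carrier R. \<forall>x\<in>carrier M. f (r \<odot>\<^bsub>M\<^esub> x) = r \<odot>\<^bsub>N\<^esub> f x)"

text \<open>Unlike \<^const>\<open>a_minus\<close>, this difference does not depend on the carrier of \<open>M\<close>, so it is
  the same in a module and in its submodules.\<close>

definition msub :: "('a, 'r) ring_scheme \<Rightarrow> ('a, 'm) module \<Rightarrow> 'm \<Rightarrow> 'm \<Rightarrow> 'm"
  where "msub R M x y = x \<oplus>\<^bsub>M\<^esub> ((\<ominus>\<^bsub>R\<^esub> \<one>\<^bsub>R\<^esub>) \<odot>\<^bsub>M\<^esub> y)"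

lemma mod_mapI:
  assumes "\<And>x. x \<in> carrier M \<Longrightarrow> f x \<in> carrier N"
    and "\<And>x y. x \<in> carrier M \<Longrightarrow> y \<in> carrier M \<Longrightarrow> f (x \<oplus>\<^bsub>M\<^esub> y) = f x \<oplus>\<^bsub>N\<^esub> f y"
    and "\<And>r x. r \<in> carrier R \<Longrightarrow> x \<in> carrier M \<Longrightarrow> f (r \<odot>\<^bsub>M\<^esub> x) = r \<odot>\<^bsub>N\<^esub> f x"
  shows "mod_map R M N f"
  using assms by (simp add: mod_map_def)

lemma mod_map_closed: "mod_map R M N f \<Longrightarrow> x \<in> carrier M \<Longrightarrow> f x \<in> carrier N"
  and mod_map_add: "mod_map R M N f \<Longrightarrow> x \<in> carrier M \<Longrightarrow> y \<in> carrier M \<Longrightarrow>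
    f (x \<oplus>\<^bsub>M\<^esub> y) = f x \<oplus>\<^bsub>N\<^esub> f y"
  and mod_map_smult: "mod_map R M N f \<Longrightarrow> r \<in> carrier R \<Longrightarrow> x \<in> carrier M \<Longrightarrow>
    f (r \<odot>\<^bsub>M\<^esub> x) = r \<odot>\<^bsub>N\<^esub> f x"
  by (simp_all add: mod_map_def)

lemma mod_map_cong:
  assumes "module R M" "\<And>x. x \<in> carrier M \<Longrightarrow> f x = g x"
  shows "mod_map R M N f \<longleftrightarrow> mod_map R M N g"
proof -
  interpret rmodule R M by (rule rmodule.intro) fact
  show ?thesis by (simp add: mod_map_def assms(2))
qed

lemma mod_hom_iff: "f \<in> mod_hom R M N \<longleftrightarrow> f \<in> extensional (carrier M) \<and> mod_map R M N f"
  by (auto simp: mod_hom_def mod_map_def PiE_def)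

lemma mod_hom_map: "f \<in> mod_hom R M N \<Longrightarrow> mod_map R M N f"
  by (simp add: mod_hom_iff)

lemma restrict_mod_hom:
  assumes "module R M" "mod_map R M N f"
  shows "restrict f (carrier M) \<in> mod_hom R M N"
  using assms mod_map_cong[OF assms(1), of "restrict f (carrier M)" f N] by (simp add: mod_hom_iff)

lemma mod_map_comp:
  "mod_map R M N f \<Longrightarrow> mod_map R N L g \<Longrightarrow> mod_map R M L (\<lambda>x. g (f x))"
  by (simp add: mod_map_def)

lemma mod_map_id: "mod_map R M M (\<lambda>x. x)"
  by (simp add: mod_map_def)

lemma module_cring: "module R M \<Longrightarrow> cring R"
  by (rule module.axioms)

text \<open>Inverses come for free: \<open>l_distr\<close> and \<open>null\<close> give (-1)x + 1x =
  0x = 0.\<close>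

lemma moduleI':
  fixes R (structure) and M (structure)
  assumes R: "cring R"
    and zero: "\<zero>\<^bsub>M\<^esub> \<in> carrier M"
    and add: "\<And>x y. x \<in> carrier M \<Longrightarrow> y \<in> carrier M \<Longrightarrow> x \<oplus>\<^bsub>M\<^esub> y \<in> carrier M"
    and smult: "\<And>a x. a \<in> carrier R \<Longrightarrow> x \<in> carrier M \<Longrightarrow> a \<odot>\<^bsub>M\<^esub> x \<in> carrier M"
    and assoc: "\<And>x y z. x \<in> carrier M \<Longrightarrow> y \<in> carrier M \<Longrightarrow> z \<in> carrier M \<Longrightarrow>
      (x \<oplus>\<^bsub>M\<^esub> y) \<oplus>\<^bsub>M\<^esub> z = x \<oplus>\<^bsub>M\<^esub> (y \<oplus>\<^bsub>M\<^esub> z)"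
    and comm: "\<And>x y. x \<in> carrier M \<Longrightarrow> y \<in> carrier M \<Longrightarrow> x \<oplus>\<^bsub>M\<^esub> y = y \<oplus>\<^bsub>M\<^esub> x"
    and l_zero: "\<And>x. x \<in> carrier M \<Longrightarrow> \<zero>\<^bsub>M\<^esub> \<oplus>\<^bsub>M\<^esub> x = x"
    and l_distr: "\<And>a b x. a \<in> carrier R \<Longrightarrow> b \<in> carrier R \<Longrightarrow> x \<in> carrier M \<Longrightarrow>
      (a \<oplus> b) \<odot>\<^bsub>M\<^esub> x = (a \<odot>\<^bsub>M\<^esub> x) \<oplus>\<^bsub>M\<^esub> (b \<odot>\<^bsub>M\<^esub> x)"
    and r_distr: "\<And>a x y. a \<in> carrier R \<Longrightarrow> x \<in> carrier M \<Longrightarrow> y \<in> carrier M \<Longrightarrow>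
      a \<odot>\<^bsub>M\<^esub> (x \<oplus>\<^bsub>M\<^esub> y) = (a \<odot>\<^bsub>M\<^esub> x) \<oplus>\<^bsub>M\<^esub> (a \<odot>\<^bsub>M\<^esub> y)"
    and assoc1: "\<And>a b x. a \<in> carrier R \<Longrightarrow> b \<in> carrier R \<Longrightarrow> x \<in> carrier M \<Longrightarrow>
      (a \<otimes> b) \<odot>\<^bsub>M\<^esub> x = a \<odot>\<^bsub>M\<^esub> (b \<odot>\<^bsub>M\<^esub> x)"
    and one: "\<And>x. x \<in> carrier M \<Longrightarrow> \<one> \<odot>\<^bsub>M\<^esub> x = x"
    and null: "\<And>x. x \<in> carrier M \<Longrightarrow> \<zero> \<odot>\<^bsub>M\<^esub> x = \<zero>\<^bsub>M\<^esub>"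
  shows "module R M"
proof -
  interpret R: cring R by fact
  have "abelian_group M"
  proof (rule abelian_groupI)
    fix x assume x: "x \<in> carrier M"
    have "(\<ominus> \<one>) \<odot>\<^bsub>M\<^esub> x \<oplus>\<^bsub>M\<^esub> \<one> \<odot>\<^bsub>M\<^esub> x = \<zero>\<^bsub>M\<^esub>"
      using x l_distr[of "\<ominus> \<one>" "\<one>" x] by (simp add: R.l_neg null)
    then show "\<exists>y\<in>carrier M. y \<oplus>\<^bsub>M\<^esub> x = \<zero>\<^bsub>M\<^esub>"
      using x smult one by (intro bexI[of _ "(\<ominus> \<one>) \<odot>\<^bsub>M\<^esub> x"]) auto
  qed (use assms in auto)
  with R show ?thesis
    by (intro moduleI) (auto simp: assms)
qed

text \<open>The module laws are equations and pass along a surjective linear map. Quotients,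
  transported copies and direct limits get their structure this way. The zero appears as a
  hypothesis because \<open>N\<close> is not yet known to be a module.\<close>

lemma module_image:
  assumes M: "module R M" and h: "mod_map R M N h" and sur: "carrier N = h ` carrier M"
    and zero: "h \<zero>\<^bsub>M\<^esub> = \<zero>\<^bsub>N\<^esub>"
  shows "module R N"
proof -
  interpret rmodule R M by (rule rmodule.intro) fact
  have add: "h x \<oplus>\<^bsub>N\<^esub> h y = h (x \<oplus>\<^bsub>M\<^esub> y)" if "x \<in> carrier M" "y \<in> carrier M" for x y
    using h that by (simp add: mod_map_def)
  have sm: "r \<odot>\<^bsub>N\<^esub> h x = h (r \<odot>\<^bsub>M\<^esub> x)" if "x \<in> carrier M" "r \<in> carrier R" for x r
    using h that by (simp add: mod_map_def)
  show ?thesis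
    apply (rule moduleI')
    apply (rule R.is_cring)
    unfolding sur zero[symmetric]
    by (auto simp: add sm M.a_ac smult_l_distr smult_r_distr smult_assoc1)
qed

context rmodule begin

lemma minus_one_closed: "\<ominus> \<one> \<in> carrier R" by simp

lemma msub_eq: "x \<in> carrier M \<Longrightarrow> y \<in> carrier M \<Longrightarrow> msub R M x y = x \<ominus>\<^bsub>M\<^esub> y"
  by (simp add: msub_def smult_l_minus a_minus_def)

lemma msub_closed [simp]: "x \<in> carrier M \<Longrightarrow> y \<in> carrier M \<Longrightarrow> msub R M x y \<in> carrier M"
  by (simp add: msub_def)

lemma msub_zero_iff: "x \<in> carrier M \<Longrightarrow> y \<in> carrier M \<Longrightarrow> msub R M x y = \<zero>\<^bsub>M\<^esub> \<longleftrightarrow> x = y"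
  unfolding msub_eq a_minus_def
  by (metis M.a_inv_closed M.minus_minus M.minus_equality M.r_neg)

lemma msub_self [simp]: "x \<in> carrier M \<Longrightarrow> msub R M x x = \<zero>\<^bsub>M\<^esub>"
  by (simp add: msub_zero_iff)

lemma msub_zero [simp]: "x \<in> carrier M \<Longrightarrow> msub R M x \<zero>\<^bsub>M\<^esub> = x"
  by (simp add: msub_def)

lemma msub_add_cancel: "x \<in> carrier M \<Longrightarrow> y \<in> carrier M \<Longrightarrow> msub R M x y \<oplus>\<^bsub>M\<^esub> y = x"
  by (simp add: msub_eq a_minus_def M.a_assoc M.l_neg)

lemma add_msub_cancel: "x \<in> carrier M \<Longrightarrow> y \<in> carrier M \<Longrightarrow> msub R M (x \<oplus>\<^bsub>M\<^esub> y) y = x"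
  by (simp add: msub_eq a_minus_def M.a_assoc M.r_neg)

lemma msub_eq_iff: "x \<in> carrier M \<Longrightarrow> y \<in> carrier M \<Longrightarrow> z \<in> carrier M \<Longrightarrow>
    msub R M x y = z \<longleftrightarrow> x = z \<oplus>\<^bsub>M\<^esub> y"
  using msub_add_cancel add_msub_cancel by metis

lemma msub_smult:
  "r \<in> carrier R \<Longrightarrow> x \<in> carrier M \<Longrightarrow> y \<in> carrier M \<Longrightarrow>
    msub R M (r \<odot>\<^bsub>M\<^esub> x) (r \<odot>\<^bsub>M\<^esub> y) = r \<odot>\<^bsub>M\<^esub> msub R M x y"
  by (simp add: msub_def smult_r_distr smult_assoc1[symmetric] R.m_comm)

lemma mod_map_zero: "module R N \<Longrightarrow> mod_map R M N f \<Longrightarrow> f \<zero>\<^bsub>M\<^esub> = \<zero>\<^bsub>N\<^esub>"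
proof -
  assume N: "module R N" and f: "mod_map R M N f"
  interpret N: rmodule R N by (rule rmodule.intro) fact
  have "f (\<zero> \<odot>\<^bsub>M\<^esub> \<zero>\<^bsub>M\<^esub>) = \<zero> \<odot>\<^bsub>N\<^esub> f \<zero>\<^bsub>M\<^esub>"
    using f by (intro mod_map_smult) auto
  then show ?thesis using mod_map_closed[OF f M.zero_closed] by simp
qed

lemma mod_map_msub: "mod_map R M N f \<Longrightarrow> x \<in> carrier M \<Longrightarrow> y \<in> carrier M \<Longrightarrow>
    f (msub R M x y) = msub R N (f x) (f y)"
  by (simp add: msub_def mod_map_add mod_map_smult)

text \<open>Closure under negation is automatic, since -x = (-1)x.\<close>

lemma submodule_alt:
  "submodule H R M \<longleftrightarrow> H \<subseteq> carrier M \<and> \<zero>\<^bsub>M\<^esub> \<in> H \<and> (\<forall>x\<in>H. \<forall>y\<in>H. x \<oplus>\<^bsub>M\<^esub> y \<in> H) \<and>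
    (\<forall>r\<in>carrier R. \<forall>x\<in>H. r \<odot>\<^bsub>M\<^esub> x \<in> H)"
proof
  assume H: "submodule H R M"
  show "H \<subseteq> carrier M \<and> \<zero>\<^bsub>M\<^esub> \<in> H \<and> (\<forall>x\<in>H. \<forall>y\<in>H. x \<oplus>\<^bsub>M\<^esub> y \<in> H) \<and>
    (\<forall>r\<in>carrier R. \<forall>x\<in>H. r \<odot>\<^bsub>M\<^esub> x \<in> H)"
    using submoduleE[OF H] submodule.axioms(1)[OF H] subgroup.one_closed by fastforce
next
  assume H: "H \<subseteq> carrier M \<and> \<zero>\<^bsub>M\<^esub> \<in> H \<and> (\<forall>x\<in>H. \<forall>y\<in>H. x \<oplus>\<^bsub>M\<^esub> y \<in> H) \<and>
    (\<forall>r\<in>carrier R. \<forall>x\<in>H. r \<odot>\<^bsub>M\<^esub> x \<in> H)"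
  have "\<ominus>\<^bsub>M\<^esub> x = (\<ominus> \<one>) \<odot>\<^bsub>M\<^esub> x" if "x \<in> H" for x
    using H that smult_l_minus[of \<one> x] by auto
  then show "submodule H R M"
    using H by (intro submoduleI) auto
qed

lemma submodule_subset: "submodule H R M \<Longrightarrow> H \<subseteq> carrier M"
  and submodule_zero: "submodule H R M \<Longrightarrow> \<zero>\<^bsub>M\<^esub> \<in> H"
  and submodule_add: "submodule H R M \<Longrightarrow> x \<in> H \<Longrightarrow> y \<in> H \<Longrightarrow> x \<oplus>\<^bsub>M\<^esub> y \<in> H"
  and submodule_smult: "submodule H R M \<Longrightarrow> r \<in> carrier R \<Longrightarrow> x \<in> H \<Longrightarrow> r \<odot>\<^bsub>M\<^esub> x \<in> H"
  and submodule_msub: "submodule H R M \<Longrightarrow> x \<in> H \<Longrightarrow> y \<in> H \<Longrightarrow> msub R M x y \<in> H"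
  by (auto simp: submodule_alt msub_def)

lemma submodule_module: "submodule H R M \<Longrightarrow> module R (M\<lparr>carrier := H\<rparr>)"
  by (rule submodule.submodule_is_module) (auto intro: module_axioms)

lemma kernel_submodule:
  assumes "module R N" "mod_map R M N f"
  shows "submodule {x \<in> carrier M. f x = \<zero>\<^bsub>N\<^esub>} R M"
proof -
  interpret N: rmodule R N by (rule rmodule.intro) fact
  show ?thesis
    using assms by (auto simp: submodule_alt mod_map_zero mod_map_add mod_map_smult)
qed

lemma image_submodule:
  assumes N: "module R N" and f: "mod_map R M N f"
  shows "submodule (f ` carrier M) R N"
proof -
  interpret N: rmodule R N by (rule rmodule.intro) fact
  have "f x \<oplus>\<^bsub>N\<^esub> f y \<in> f ` carrier M" if "x \<in> carrier M" "y \<in> carrier M" for x y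
    using that mod_map_add[OF f that] by (metis M.add.m_closed imageI)
  moreover have "r \<odot>\<^bsub>N\<^esub> f x \<in> f ` carrier M" if "r \<in> carrier R" "x \<in> carrier M" for r x
    using that mod_map_smult[OF f that] by (metis smult_closed imageI)
  ultimately show ?thesis
    using f mod_map_zero[OF N f] mod_map_closed[OF f]
    by (auto simp: N.submodule_alt image_iff) (metis M.zero_closed)
qed

lemma zero_submodule: "submodule {\<zero>\<^bsub>M\<^esub>} R M"
  by (auto simp: submodule_alt)

lemma mod_map_add_map:
  assumes "mod_map R N M f" "mod_map R N M g"
  shows "mod_map R N M (\<lambda>x. f x \<oplus>\<^bsub>M\<^esub> g x)"
  using assms by (auto simp: mod_map_def M.a_ac smult_r_distr)

lemma mod_map_smult_map:
  assumes "r \<in> carrier R" "mod_map R N M f"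
  shows "mod_map R N M (\<lambda>x. r \<odot>\<^bsub>M\<^esub> f x)"
  using assms by (auto simp: mod_map_def smult_r_distr smult_assoc1[symmetric] R.m_comm)

lemma mod_map_msub_map:
  assumes "mod_map R N M f" "mod_map R N M g"
  shows "mod_map R N M (\<lambda>x. msub R M (f x) (g x))"
  unfolding msub_def
  by (intro mod_map_add_map mod_map_smult_map assms minus_one_closed)

lemma mod_map_zero_map: "mod_map R N M (\<lambda>x. \<zero>\<^bsub>M\<^esub>)"
  by (simp add: mod_map_def)

end

section \<open>Restricted carriers, factorization through surjections, transport of
  structure\<close>

lemma a_kernel_eq: "a_kernel M N f = {x \<in> carrier M. f x = \<zero>\<^bsub>N\<^esub>}"
  by (simp add: a_kernel_def kernel_def)

lemma mod_map_restrict_carrier: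
  "mod_map R M N f \<Longrightarrow> S \<subseteq> carrier M \<Longrightarrow> mod_map R (M\<lparr>carrier := S\<rparr>) N f"
  by (simp add: mod_map_def subset_iff)

lemma mod_map_into_carrierI:
  "mod_map R M N f \<Longrightarrow> (\<And>x. x \<in> carrier M \<Longrightarrow> f x \<in> S) \<Longrightarrow> mod_map R M (N\<lparr>carrier := S\<rparr>) f"
  by (simp add: mod_map_def)

lemma mod_map_from_carrier:
  "mod_map R M (N\<lparr>carrier := S\<rparr>) f \<Longrightarrow> S \<subseteq> carrier N \<Longrightarrow> mod_map R M N f"
  by (simp add: mod_map_def subset_iff)

lemma msub_carrier_update [simp]: "msub R (M\<lparr>carrier := S\<rparr>) = msub R M"
  by (simp add: msub_def fun_eq_iff)

text \<open>Compose f with an arbitrary section of q: by \<open>ker\<close> the values do not depend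
  on the section, and this makes the composite linear.\<close>

lemma mod_map_factor:
  assumes P: "module R P" and X: "module R X"
    and q: "mod_map R P N q" "q ` carrier P = carrier N"
    and f: "mod_map R P X f"
    and ker: "\<And>x y. x \<in> carrier P \<Longrightarrow> q x = q y \<Longrightarrow> y \<in> carrier P \<Longrightarrow> f x = f y"
  shows "\<exists>g. mod_map R N X g \<and> (\<forall>x\<in>carrier P. g (q x) = f x)"
proof -
  interpret P: rmodule R P by (rule rmodule.intro) fact
  define s where "s y = (SOME x. x \<in> carrier P \<and> q x = y)" for y
  have s: "s y \<in> carrier P \<and> q (s y) = y" if "y \<in> carrier N" for y
    unfolding s_def by (rule someI_ex) (use that q(2) in \<open>metis imageE\<close>)
  have *: "f (s (q x)) = f x" if "x \<in> carrier P" for x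
    using s[of "q x"] that mod_map_closed[OF q(1) that] by (intro ker) auto
  have "mod_map R N X (\<lambda>y. f (s y))"
  proof (rule mod_mapI)
    fix x y assume xy: "x \<in> carrier N" "y \<in> carrier N"
    have "f (s (x \<oplus>\<^bsub>N\<^esub> y)) = f (s (q (s x \<oplus>\<^bsub>P\<^esub> s y)))"
      using s xy by (simp add: mod_map_add[OF q(1)])
    then show "f (s (x \<oplus>\<^bsub>N\<^esub> y)) = f (s x) \<oplus>\<^bsub>X\<^esub> f (s y)"
      using s xy by (simp add: * mod_map_add[OF f])
  next
    fix r x assume xy: "x \<in> carrier N" "r \<in> carrier R"
    have "f (s (r \<odot>\<^bsub>N\<^esub> x)) = f (s (q (r \<odot>\<^bsub>P\<^esub> s x)))"
      using s xy by (simp add: mod_map_smult[OF q(1)])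
    then show "f (s (r \<odot>\<^bsub>N\<^esub> x)) = r \<odot>\<^bsub>X\<^esub> f (s x)"
      using s xy by (simp add: * mod_map_smult[OF f])
  qed (use s mod_map_closed[OF f] in auto)
  with * show ?thesis by blast
qed

lemma mod_map_factor_kernel:
  assumes P: "module R P" and X: "module R X" and N: "module R N"
    and q: "mod_map R P N q" "q ` carrier P = carrier N"
    and f: "mod_map R P X f"
    and ker: "\<And>x. x \<in> carrier P \<Longrightarrow> q x = \<zero>\<^bsub>N\<^esub> \<Longrightarrow> f x = \<zero>\<^bsub>X\<^esub>"
  shows "\<exists>g. mod_map R N X g \<and> (\<forall>x\<in>carrier P. g (q x) = f x)"
proof (rule mod_map_factor[OF P X q f])
  interpret P: rmodule R P by (rule rmodule.intro) fact
  interpret N: rmodule R N by (rule rmodule.intro) fact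
  interpret X: rmodule R X by (rule rmodule.intro) fact
  fix x y assume xy: "x \<in> carrier P" "q x = q y" "y \<in> carrier P"
  have "q (msub R P x y) = \<zero>\<^bsub>N\<^esub>"
    using xy mod_map_closed[OF q(1)] by (simp add: P.mod_map_msub[OF q(1)] N.msub_zero_iff)
  then have "f (msub R P x y) = \<zero>\<^bsub>X\<^esub>" using xy by (intro ker) auto
  then show "f x = f y"
    using xy mod_map_closed[OF f] by (simp add: P.mod_map_msub[OF f] X.msub_zero_iff)
qed

text \<open>For h injective on the carrier this is an isomorphic copy. It is the device that moves
  modules into the types prescribed by \<open>large\<close>.\<close>

definition transport :: "('m \<Rightarrow> 'n) \<Rightarrow> ('a, 'm) module \<Rightarrow> ('a, 'n) module"
  where "transport h M =
    \<lparr>carrier = h ` carrier M, monoid.mult = undefined, monoid.one = undefined,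
     ring.zero = h \<zero>\<^bsub>M\<^esub>,
     ring.add = (\<lambda>x y. h (inv_into (carrier M) h x \<oplus>\<^bsub>M\<^esub> inv_into (carrier M) h y)),
     module.smult = (\<lambda>r x. h (r \<odot>\<^bsub>M\<^esub> inv_into (carrier M) h x))\<rparr>"

lemma transport_carrier [simp]: "carrier (transport h M) = h ` carrier M"
  by (simp add: transport_def)

lemma transport_map: "inj_on h (carrier M) \<Longrightarrow> mod_map R M (transport h M) h"
  by (auto simp: mod_map_def transport_def)

lemma transport_module:
  assumes "module R M" "inj_on h (carrier M)"
  shows "module R (transport h M)"
  by (rule module_image[OF assms(1) transport_map[OF assms(2)]]) (auto simp: transport_def)

lemma transport_inv_map:
  assumes "module R M" "inj_on h (carrier M)"
  shows "mod_map R (transport h M) M (inv_into (carrier M) h)"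
proof -
  interpret rmodule R M by (rule rmodule.intro) fact
  show ?thesis using assms by (auto simp: mod_map_def transport_def)
qed

section \<open>Quotients\<close>

lemma quot_carrier: "carrier (quot_mod M H) = (\<lambda>x. H +>\<^bsub>M\<^esub> x) ` carrier M"
  by (auto simp: quot_mod_def A_RCOSETS_def')

lemma quot_zero [simp]: "\<zero>\<^bsub>quot_mod M H\<^esub> = H"
  by (simp add: quot_mod_def)

context rmodule begin

lemma submodule_abelian_subgroup:
  assumes "submodule H R M" shows "abelian_subgroup H M"
  using submodule.axioms(1)[OF assms] M.abelian_group_axioms
  by (intro abelian_subgroupI3 additive_subgroupI)

lemma coset_eq_iff:
  assumes H: "submodule H R M" and "x \<in> carrier M" "y \<in> carrier M"
  shows "H +>\<^bsub>M\<^esub> x = H +>\<^bsub>M\<^esub> y \<longleftrightarrow> msub R M x y \<in> H"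
proof
  interpret abelian_subgroup H M by (rule submodule_abelian_subgroup[OF H])
  note sub = submodule.axioms(1)[OF H]
  {
    assume "H +>\<^bsub>M\<^esub> x = H +>\<^bsub>M\<^esub> y"
    then have "x \<in> H +>\<^bsub>M\<^esub> y"
      using a_rcos_self assms(2) by blast
    then obtain h where "h \<in> H" "x = h \<oplus>\<^bsub>M\<^esub> y" by (auto simp: a_r_coset_def')
    then show "msub R M x y \<in> H" using assms submodule_subset[OF H] by (auto simp: add_msub_cancel)
  }
  assume "msub R M x y \<in> H"
  then have "x \<in> H +>\<^bsub>M\<^esub> y"
    using assms msub_add_cancel[of x y] by (auto simp: a_r_coset_def') metis
  then show "H +>\<^bsub>M\<^esub> x = H +>\<^bsub>M\<^esub> y"
    using a_repr_independence assms(3) sub by metis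
qed

lemma coset_zero_iff:
  assumes H: "submodule H R M" and "x \<in> carrier M"
  shows "H +>\<^bsub>M\<^esub> x = H \<longleftrightarrow> x \<in> H"
  using coset_eq_iff[OF assms M.zero_closed] submodule_subset[OF H] assms(2) by simp

lemma coset_self: "submodule H R M \<Longrightarrow> x \<in> carrier M \<Longrightarrow> x \<in> H +>\<^bsub>M\<^esub> x"
  using abelian_subgroup.a_rcos_self[OF submodule_abelian_subgroup] .

lemma coset_map:
  assumes H: "submodule H R M"
  shows "mod_map R M (quot_mod M H) (\<lambda>x. H +>\<^bsub>M\<^esub> x)"
proof (rule mod_mapI)
  interpret abelian_subgroup H M by (rule submodule_abelian_subgroup[OF H])
  fix x y assume xy: "x \<in> carrier M" "y \<in> carrier M"
  then show "H +>\<^bsub>M\<^esub> (x \<oplus>\<^bsub>M\<^esub> y) = (H +>\<^bsub>M\<^esub> x) \<oplus>\<^bsub>quot_mod M H\<^esub> (H +>\<^bsub>M\<^esub> y)"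
    by (simp add: quot_mod_def a_rcos_sum)
next
  interpret abelian_subgroup H M by (rule submodule_abelian_subgroup[OF H])
  fix r x assume rx: "r \<in> carrier R" "x \<in> carrier M"
  have "H +>\<^bsub>M\<^esub> (r \<odot>\<^bsub>M\<^esub> y) = H +>\<^bsub>M\<^esub> (r \<odot>\<^bsub>M\<^esub> x)" if y: "y \<in> H +>\<^bsub>M\<^esub> x" for y
  proof -
    have yM: "y \<in> carrier M" using y rx a_r_coset_subset_G submodule_subset[OF H] by blast
    have "H +>\<^bsub>M\<^esub> y = H +>\<^bsub>M\<^esub> x"
      using a_repr_independence[OF y _ submodule.axioms(1)[OF H]] rx by simp
    then have "msub R M y x \<in> H" using coset_eq_iff[OF H yM] rx by simp
    then have "msub R M (r \<odot>\<^bsub>M\<^esub> y) (r \<odot>\<^bsub>M\<^esub> x) \<in> H"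
      using rx yM by (simp add: msub_smult submodule_smult[OF H])
    then show ?thesis using coset_eq_iff[OF H] rx yM by simp
  qed
  then have "(\<Union>y\<in>H +>\<^bsub>M\<^esub> x. H +>\<^bsub>M\<^esub> (r \<odot>\<^bsub>M\<^esub> y)) = (\<Union>y\<in>H +>\<^bsub>M\<^esub> x. H +>\<^bsub>M\<^esub> (r \<odot>\<^bsub>M\<^esub> x))"
    by (rule SUP_cong[OF refl])
  moreover have "H +>\<^bsub>M\<^esub> x \<noteq> {}" using coset_self[OF H] rx by blast
  ultimately show "H +>\<^bsub>M\<^esub> (r \<odot>\<^bsub>M\<^esub> x) = r \<odot>\<^bsub>quot_mod M H\<^esub> (H +>\<^bsub>M\<^esub> x)"
    by (simp add: quot_mod_def)
qed (simp add: quot_carrier)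

lemma quot_module: "submodule H R M \<Longrightarrow> module R (quot_mod M H)"
  by (rule module_image[OF module_axioms coset_map]) (auto simp: quot_carrier coset_zero_iff submodule_zero)

text \<open>\<open>Ext_map\<close> and \<open>pow_proj\<close> add a submodule to the image of a
  coset. The image may fill only part of a coset; adding H completes it.\<close>

lemma set_add_coset:
  assumes H: "submodule H R M" and x: "x \<in> carrier M" and C: "x \<in> C" "C \<subseteq> H +>\<^bsub>M\<^esub> x"
  shows "H <+>\<^bsub>M\<^esub> C = H +>\<^bsub>M\<^esub> x"
proof
  have "h \<oplus>\<^bsub>M\<^esub> (h' \<oplus>\<^bsub>M\<^esub> x) \<in> H +>\<^bsub>M\<^esub> x" if "h \<in> H" "h' \<in> H" for h h'
  proof -
    have "h \<oplus>\<^bsub>M\<^esub> (h' \<oplus>\<^bsub>M\<^esub> x) = (h \<oplus>\<^bsub>M\<^esub> h') \<oplus>\<^bsub>M\<^esub> x"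
      using that x submodule_subset[OF H] by (simp add: M.a_assoc subset_iff)
    then show ?thesis using submodule_add[OF H that] by (auto simp: a_r_coset_def')
  qed
  then show "H <+>\<^bsub>M\<^esub> C \<subseteq> H +>\<^bsub>M\<^esub> x"
    using C(2) unfolding set_add_def' by (fastforce simp: a_r_coset_def')
  show "H +>\<^bsub>M\<^esub> x \<subseteq> H <+>\<^bsub>M\<^esub> C"
    using C(1) by (auto simp: a_r_coset_def' set_add_def')
qed

end

text \<open>The induced map on quotients in the set form in which \<open>pow_proj\<close> and
  \<open>Ext_map\<close> are defined; the maps from the Ext sequence to its limit are later written
  in the same form.\<close>

lemma quot_induced:
  assumes M: "module R M" and H: "submodule H R M"
    and N: "module R N" and K: "submodule K R N"
    and f: "mod_map R M N f" and HK: "\<And>x. x \<in> H \<Longrightarrow> f x \<in> K"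
  shows quot_induced_coset: "\<And>x. x \<in> carrier M \<Longrightarrow> K <+>\<^bsub>N\<^esub> f ` (H +>\<^bsub>M\<^esub> x) = K +>\<^bsub>N\<^esub> f x"
    and quot_induced_map: "mod_map R (quot_mod M H) (quot_mod N K) (\<lambda>C. K <+>\<^bsub>N\<^esub> f ` C)"
proof -
  interpret M: rmodule R M by (rule rmodule.intro) fact
  interpret N: rmodule R N by (rule rmodule.intro) fact
  show *: "K <+>\<^bsub>N\<^esub> f ` (H +>\<^bsub>M\<^esub> x) = K +>\<^bsub>N\<^esub> f x" if x: "x \<in> carrier M" for x
  proof (rule N.set_add_coset[OF K])
    show "f x \<in> carrier N" using f x by (rule mod_map_closed)
    show "f x \<in> f ` (H +>\<^bsub>M\<^esub> x)" using M.coset_self[OF H x] by simp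
    show "f ` (H +>\<^bsub>M\<^esub> x) \<subseteq> K +>\<^bsub>N\<^esub> f x"
      using M.submodule_subset[OF H] x HK
      by (auto simp: a_r_coset_def' mod_map_add[OF f] subset_iff)
  qed
  have "\<exists>g. mod_map R (quot_mod M H) (quot_mod N K) g \<and>
      (\<forall>x\<in>carrier M. g (H +>\<^bsub>M\<^esub> x) = K +>\<^bsub>N\<^esub> f x)"
  proof (rule mod_map_factor_kernel)
    show "mod_map R M (quot_mod N K) (\<lambda>x. K +>\<^bsub>N\<^esub> f x)"
      by (rule mod_map_comp[OF f N.coset_map[OF K]])
    show "K +>\<^bsub>N\<^esub> f x = \<zero>\<^bsub>quot_mod N K\<^esub>"
      if "x \<in> carrier M" "H +>\<^bsub>M\<^esub> x = \<zero>\<^bsub>quot_mod M H\<^esub>" for x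
      using that HK mod_map_closed[OF f] by (simp add: M.coset_zero_iff[OF H] N.coset_zero_iff[OF K])
  qed (use M N H K M.coset_map M.quot_module N.quot_module in \<open>auto simp: quot_carrier\<close>)
  then obtain g where g: "mod_map R (quot_mod M H) (quot_mod N K) g"
    and gx: "\<And>x. x \<in> carrier M \<Longrightarrow> g (H +>\<^bsub>M\<^esub> x) = K +>\<^bsub>N\<^esub> f x" by blast
  show "mod_map R (quot_mod M H) (quot_mod N K) (\<lambda>C. K <+>\<^bsub>N\<^esub> f ` C)"
    using g by (rule iffD1[OF mod_map_cong[OF M.quot_module[OF H]], rotated])
      (auto simp: quot_carrier gx *)
qed

section \<open>Modules of homomorphisms\<close>

lemma mod_hom_eqI:
  "f \<in> mod_hom R M N \<Longrightarrow> g \<in> mod_hom R M N \<Longrightarrow> (\<And>x. x \<in> carrier M \<Longrightarrow> f x = g x) \<Longrightarrow> f = g"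
  by (auto simp: mod_hom_iff intro: extensionalityI)

lemma Hom_simps:
  "\<zero>\<^bsub>Hom_mod R M N\<^esub> = (\<lambda>x\<in>carrier M. \<zero>\<^bsub>N\<^esub>)"
  "f \<oplus>\<^bsub>Hom_mod R M N\<^esub> g = (\<lambda>x\<in>carrier M. f x \<oplus>\<^bsub>N\<^esub> g x)"
  "r \<odot>\<^bsub>Hom_mod R M N\<^esub> f = (\<lambda>x\<in>carrier M. r \<odot>\<^bsub>N\<^esub> f x)"
  and Hom_carrier [simp]: "carrier (Hom_mod R M N) = mod_hom R M N"
  by (simp_all add: Hom_mod_def)

lemma Hom_module:
  assumes M: "module R M" and N: "module R N"
  shows "module R (Hom_mod R M N)"
proof -
  interpret M: rmodule R M by (rule rmodule.intro) fact
  interpret N: rmodule R N by (rule rmodule.intro) fact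
  note cl = mod_map_closed[OF mod_hom_map]
  note r = restrict_mod_hom[OF M]
  show ?thesis
  proof (rule moduleI')
    show "cring R" using M by (rule module_cring)
    show z: "\<zero>\<^bsub>Hom_mod R M N\<^esub> \<in> carrier (Hom_mod R M N)"
      unfolding Hom_carrier Hom_simps by (intro r N.mod_map_zero_map)
    show a: "f \<oplus>\<^bsub>Hom_mod R M N\<^esub> g \<in> carrier (Hom_mod R M N)"
      if "f \<in> carrier (Hom_mod R M N)" "g \<in> carrier (Hom_mod R M N)" for f g
      using that unfolding Hom_carrier Hom_simps by (intro r N.mod_map_add_map mod_hom_map)
    show s: "t \<odot>\<^bsub>Hom_mod R M N\<^esub> f \<in> carrier (Hom_mod R M N)"
      if "t \<in> carrier R" "f \<in> carrier (Hom_mod R M N)" for t f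
      using that unfolding Hom_carrier Hom_simps by (intro r N.mod_map_smult_map mod_hom_map)
    show "\<zero>\<^bsub>Hom_mod R M N\<^esub> \<oplus>\<^bsub>Hom_mod R M N\<^esub> f = f" if "f \<in> carrier (Hom_mod R M N)" for f
      by (rule mod_hom_eqI[of _ R M N]) (use that a[OF z that] cl[of f R M N] in \<open>simp_all add: Hom_simps\<close>)
    show "\<one>\<^bsub>R\<^esub> \<odot>\<^bsub>Hom_mod R M N\<^esub> f = f" if "f \<in> carrier (Hom_mod R M N)" for f
      by (rule mod_hom_eqI[of _ R M N]) (use that s[OF _ that] cl[of f R M N] in \<open>simp_all add: Hom_simps\<close>)
  qed (auto simp: Hom_simps fun_eq_iff N.smult_l_distr N.smult_r_distr N.smult_assoc1 cl N.M.a_assoc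
      intro: N.M.a_comm cl)
qed

lemma Hom_msub:
  assumes "module R M" "module R N" "f \<in> mod_hom R M N" "g \<in> mod_hom R M N" "x \<in> carrier M"
  shows "msub R (Hom_mod R M N) f g x = msub R N (f x) (g x)"
  using assms by (simp add: msub_def Hom_simps mod_map_closed[OF mod_hom_map])

section \<open>Baer's criterion\<close>

definition regular_module :: "('a, 'r) ring_scheme \<Rightarrow> ('a, 'a) module"
  where "regular_module R =
    \<lparr>carrier = carrier R, monoid.mult = undefined, monoid.one = undefined,
     ring.zero = \<zero>\<^bsub>R\<^esub>, ring.add = ring.add R, module.smult = monoid.mult R\<rparr>"

lemma regular_simps [simp]:
  "carrier (regular_module R) = carrier R" "\<zero>\<^bsub>regular_module R\<^esub> = \<zero>\<^bsub>R\<^esub>"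
  "x \<oplus>\<^bsub>regular_module R\<^esub> y = x \<oplus>\<^bsub>R\<^esub> y" "r \<odot>\<^bsub>regular_module R\<^esub> x = r \<otimes>\<^bsub>R\<^esub> x"
  by (simp_all add: regular_module_def)

lemma regular_module: assumes "cring R" shows "module R (regular_module R)"
proof -
  interpret cring R by fact
  show ?thesis
    by (rule moduleI') (use assms in \<open>auto simp: a_ac m_assoc l_distr r_distr\<close>)
qed

lemma submodule_regular_ideal:
  assumes R: "cring R" shows "submodule I R (regular_module R) \<longleftrightarrow> ideal I R"
proof -
  interpret cring R by fact
  interpret M: rmodule R "regular_module R" by (rule rmodule.intro) (rule regular_module[OF R])
  show ?thesis
  proof
    assume "ideal I R"
    then interpret I: ideal I R .
    show "submodule I R (regular_module R)"
      by (auto simp: M.submodule_alt intro: I.I_l_closed I.Icarr I.a_closed)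
  next
    assume s: "submodule I R (regular_module R)"
    have neg: "\<ominus>\<^bsub>regular_module R\<^esub> x = \<ominus>\<^bsub>R\<^esub> x" if "x \<in> carrier R" for x
      using M.smult_l_minus[of "\<one>\<^bsub>R\<^esub>" x] that by (simp add: l_minus)
    show "ideal I R"
    proof (rule idealI)
      show "subgroup I (add_monoid R)"
        using s submodule_def M.submoduleE[OF s] M.submodule_zero[OF s] neg
        by (intro add.subgroupI) (auto simp: subset_iff)
      show "x \<otimes>\<^bsub>R\<^esub> a \<in> I" if "a \<in> I" "x \<in> carrier R" for a x
        using M.submodule_smult[OF s that(2,1)] by simp
      then show "a \<otimes>\<^bsub>R\<^esub> x \<in> I" if "a \<in> I" "x \<in> carrier R" for a x
        using that M.submodule_subset[OF s] by (auto simp: m_comm[of a x])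
    qed (rule ring_axioms)
  qed
qed

text \<open>Unlike \<open>injective_module\<close>, this condition mentions no test modules over an
  auxiliary type, so it can be used against modules over any type.\<close>

definition baer :: "('a, 'r) ring_scheme \<Rightarrow> ('a, 'e) module \<Rightarrow> bool"
  where "baer R E \<longleftrightarrow> module R E \<and>
    (\<forall>I g. submodule I R (regular_module R) \<and> mod_map R (regular_module R\<lparr>carrier := I\<rparr>) E g \<longrightarrow>
      (\<exists>e\<in>carrier E. \<forall>r\<in>I. g r = r \<odot>\<^bsub>E\<^esub> e))"

lemma baer_module: "baer R E \<Longrightarrow> module R E"
  by (simp add: baer_def)

text \<open>Baer's criterion, with \<open>B\<close> over an arbitrary type. A maximal partial
  extension is defined at every b, because b can always be given a value e consistent with what is
  already fixed.\<close>

lemma baer_extend: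
  assumes E: "baer R E" and B: "module R B" and A: "submodule A R B"
    and g: "mod_map R (B\<lparr>carrier := A\<rparr>) E g"
  shows "\<exists>h. mod_map R B E h \<and> (\<forall>x\<in>A. h x = g x)"
proof -
  interpret E: rmodule R E by (rule rmodule.intro) (rule baer_module[OF E])
  interpret B: rmodule R B by (rule rmodule.intro) fact
  have B': "module R (B\<lparr>carrier := A\<rparr>)" by (rule B.submodule_module[OF A])
  interpret A: rmodule R "B\<lparr>carrier := A\<rparr>" by (rule rmodule.intro) (rule B')
  interpret L: rmodule R "regular_module R" by (rule rmodule.intro, rule regular_module, rule module_cring[OF B])
  note AB = subsetD[OF B.submodule_subset[OF A]]
  have gc: "g x \<in> carrier E" if "x \<in> A" for x using mod_map_closed[OF g] that by simp
  have ga: "g (x \<oplus>\<^bsub>B\<^esub> y) = g x \<oplus>\<^bsub>E\<^esub> g y" if "x \<in> A" "y \<in> A" for x y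
    using mod_map_add[OF g] that by simp
  have gs: "g (r \<odot>\<^bsub>B\<^esub> x) = r \<odot>\<^bsub>E\<^esub> g x" if "r \<in> carrier R" "x \<in> A" for r x
    using mod_map_smult[OF g] that by simp
  \<comment> \<open>Zorn's lemma for graphs of partial extensions; a linear relation is single valued as soon as
    it is so over zero\<close>
  define good where "good G \<longleftrightarrow> G \<subseteq> carrier B \<times> carrier E \<and> (\<forall>x\<in>A. (x, g x) \<in> G) \<and>
    (\<forall>x y u v. (x, u) \<in> G \<longrightarrow> (y, v) \<in> G \<longrightarrow> (x \<oplus>\<^bsub>B\<^esub> y, u \<oplus>\<^bsub>E\<^esub> v) \<in> G) \<and>
    (\<forall>r x u. r \<in> carrier R \<longrightarrow> (x, u) \<in> G \<longrightarrow> (r \<odot>\<^bsub>B\<^esub> x, r \<odot>\<^bsub>E\<^esub> u) \<in> G) \<and>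
    (\<forall>u. (\<zero>\<^bsub>B\<^esub>, u) \<in> G \<longrightarrow> u = \<zero>\<^bsub>E\<^esub>)" for G
  have "\<exists>G\<in>Collect good. \<forall>X\<in>Collect good. G \<subseteq> X \<longrightarrow> X = G"
  proof (rule subset_Zorn_nonempty)
    have "good {(x, g x) | x. x \<in> A}"
      using AB gc ga gs B.submodule_add[OF A] B.submodule_smult[OF A] A.mod_map_zero[OF _ g] E.module_axioms
      by (auto simp: good_def)
    then show "Collect good \<noteq> {}" by blast
    fix C assume C: "C \<noteq> {}" "subset.chain (Collect good) C"
    have ch: "X \<subseteq> Y \<or> Y \<subseteq> X" if "X \<in> C" "Y \<in> C" for X Y
      using C(2) that unfolding pred_on.chain_def by blast
    have gd: "good X" if "X \<in> C" for X using C(2) that unfolding pred_on.chain_def by blast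
    have "good (\<Union>C)"
      unfolding good_def
    proof (intro conjI allI impI ballI)
      fix x y u v assume "(x, u) \<in> \<Union>C" "(y, v) \<in> \<Union>C"
      then obtain X Y where "X \<in> C" "Y \<in> C" "(x, u) \<in> X" "(y, v) \<in> Y" by blast
      with ch have "\<exists>Z\<in>C. (x, u) \<in> Z \<and> (y, v) \<in> Z" by blast
      then show "(x \<oplus>\<^bsub>B\<^esub> y, u \<oplus>\<^bsub>E\<^esub> v) \<in> \<Union>C" using gd unfolding good_def by blast
    next
      fix x assume "x \<in> A" then show "(x, g x) \<in> \<Union>C" using gd C(1) unfolding good_def by blast
    next
      show "\<Union>C \<subseteq> carrier B \<times> carrier E" using gd unfolding good_def by blast
    next
      fix r x u assume "r \<in> carrier R" "(x, u) \<in> \<Union>C"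
      then show "(r \<odot>\<^bsub>B\<^esub> x, r \<odot>\<^bsub>E\<^esub> u) \<in> \<Union>C" using gd unfolding good_def by blast
    next
      fix u assume "(\<zero>\<^bsub>B\<^esub>, u) \<in> \<Union>C" then show "u = \<zero>\<^bsub>E\<^esub>" using gd unfolding good_def by blast
    qed
    then show "\<Union>C \<in> Collect good" by simp
  qed
  then obtain G where G: "good G" and max: "\<And>X. good X \<Longrightarrow> G \<subseteq> X \<Longrightarrow> X = G" by blast
  have Gc: "x \<in> carrier B" "u \<in> carrier E" if "(x, u) \<in> G" for x u
    using G that unfolding good_def by blast+
  have Ga: "(x \<oplus>\<^bsub>B\<^esub> y, u \<oplus>\<^bsub>E\<^esub> v) \<in> G" if "(x, u) \<in> G" "(y, v) \<in> G" for x y u v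
    using G that unfolding good_def by blast
  have Gs: "(r \<odot>\<^bsub>B\<^esub> x, r \<odot>\<^bsub>E\<^esub> u) \<in> G" if "r \<in> carrier R" "(x, u) \<in> G" for x r u
    using G that unfolding good_def by blast
  have Gz: "u = \<zero>\<^bsub>E\<^esub>" if "(\<zero>\<^bsub>B\<^esub>, u) \<in> G" for u
    using G that unfolding good_def by blast
  have Gg: "(x, g x) \<in> G" if "x \<in> A" for x
    using G that unfolding good_def by blast
  have Gm: "(msub R B x y, msub R E u v) \<in> G" if "(x, u) \<in> G" "(y, v) \<in> G" for x y u v
    unfolding msub_def by (intro Ga Gs that) simp
  have single: "u = v" if "(x, u) \<in> G" "(x, v) \<in> G" for x u v
  proof -
    have "(\<zero>\<^bsub>B\<^esub>, msub R E u v) \<in> G" using Gm[OF that] Gc(1)[OF that(1)] by simp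
    then show ?thesis using Gz E.msub_zero_iff[OF Gc(2)[OF that(1)] Gc(2)[OF that(2)]] by blast
  qed
  have G0: "(\<zero>\<^bsub>B\<^esub>, \<zero>\<^bsub>E\<^esub>) \<in> G"
    using Gg[OF B.submodule_zero[OF A]] A.mod_map_zero[OF _ g] E.module_axioms by simp
  have dom: "\<exists>u. (b, u) \<in> G" if b: "b \<in> carrier B" for b
  proof -
    \<comment> \<open>The ideal of scalars that move b into the domain of G. On it the value at r b
      is forced, and Baer's condition writes this forced value as r e.\<close>
    define I where "I = {r \<in> carrier R. \<exists>u. (r \<odot>\<^bsub>B\<^esub> b, u) \<in> G}"
    define k where "k r = (THE u. (r \<odot>\<^bsub>B\<^esub> b, u) \<in> G)" for r
    have kI: "k r = u" if "(r \<odot>\<^bsub>B\<^esub> b, u) \<in> G" for r u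
      unfolding k_def using that single by blast
    have k: "(r \<odot>\<^bsub>B\<^esub> b, k r) \<in> G" if "r \<in> I" for r
      using that kI by (auto simp: I_def)
    have add: "((r \<oplus>\<^bsub>R\<^esub> s) \<odot>\<^bsub>B\<^esub> b, k r \<oplus>\<^bsub>E\<^esub> k s) \<in> G" if "r \<in> I" "s \<in> I" for r s
      using Ga[OF k[OF that(1)] k[OF that(2)]] that b by (simp add: B.smult_l_distr I_def)
    have sm: "((r \<otimes>\<^bsub>R\<^esub> s) \<odot>\<^bsub>B\<^esub> b, r \<odot>\<^bsub>E\<^esub> k s) \<in> G" if "r \<in> carrier R" "s \<in> I" for r s
      using Gs[OF that(1) k[OF that(2)]] that b by (simp add: B.smult_assoc1 I_def)
    have "submodule I R (regular_module R)"
      unfolding L.submodule_alt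
    proof (intro conjI ballI)
      show "r \<oplus>\<^bsub>regular_module R\<^esub> s \<in> I" if "r \<in> I" "s \<in> I" for r s
        using add[OF that] that by (auto simp: I_def)
      show "r \<odot>\<^bsub>regular_module R\<^esub> s \<in> I" if "r \<in> carrier R" "s \<in> I" for r s
        using sm[OF that] that by (auto simp: I_def)
    qed (use G0 b in \<open>auto simp: I_def\<close>)
    moreover have "mod_map R (regular_module R\<lparr>carrier := I\<rparr>) E k"
      using Gc(2)[OF k] kI add sm by (auto simp: mod_map_def)
    ultimately obtain e where e: "e \<in> carrier E" "\<And>r. r \<in> I \<Longrightarrow> k r = r \<odot>\<^bsub>E\<^esub> e"
      using E unfolding baer_def by blast
    define G' where "G' = {(x \<oplus>\<^bsub>B\<^esub> r \<odot>\<^bsub>B\<^esub> b, u \<oplus>\<^bsub>E\<^esub> r \<odot>\<^bsub>E\<^esub> e) | x u r. (x, u) \<in> G \<and> r \<in> carrier R}"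
    have G'I: "(x \<oplus>\<^bsub>B\<^esub> r \<odot>\<^bsub>B\<^esub> b, u \<oplus>\<^bsub>E\<^esub> r \<odot>\<^bsub>E\<^esub> e) \<in> G'" if "(x, u) \<in> G" "r \<in> carrier R" for x u r
      using that by (auto simp: G'_def)
    have sub: "G \<subseteq> G'"
    proof
      fix p assume p: "p \<in> G"
      obtain x u where "p = (x, u)" by (cases p)
      then show "p \<in> G'" using G'I[of x u "\<zero>\<^bsub>R\<^esub>"] p Gc b e by simp
    qed
    have "good G'"
      unfolding good_def
    proof (intro conjI allI impI ballI)
      show "G' \<subseteq> carrier B \<times> carrier E" using Gc b e by (auto simp: G'_def)
      show "(x, g x) \<in> G'" if "x \<in> A" for x using Gg[OF that] sub by blast
    next
      fix x y u v assume "(x, u) \<in> G'" "(y, v) \<in> G'"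
      then obtain x' u' r y' v' s where xy: "(x', u') \<in> G" "r \<in> carrier R" "(y', v') \<in> G" "s \<in> carrier R"
        and eq: "x = x' \<oplus>\<^bsub>B\<^esub> r \<odot>\<^bsub>B\<^esub> b" "u = u' \<oplus>\<^bsub>E\<^esub> r \<odot>\<^bsub>E\<^esub> e"
          "y = y' \<oplus>\<^bsub>B\<^esub> s \<odot>\<^bsub>B\<^esub> b" "v = v' \<oplus>\<^bsub>E\<^esub> s \<odot>\<^bsub>E\<^esub> e"
        unfolding G'_def by blast
      have "x \<oplus>\<^bsub>B\<^esub> y = (x' \<oplus>\<^bsub>B\<^esub> y') \<oplus>\<^bsub>B\<^esub> (r \<oplus>\<^bsub>R\<^esub> s) \<odot>\<^bsub>B\<^esub> b"
        "u \<oplus>\<^bsub>E\<^esub> v = (u' \<oplus>\<^bsub>E\<^esub> v') \<oplus>\<^bsub>E\<^esub> (r \<oplus>\<^bsub>R\<^esub> s) \<odot>\<^bsub>E\<^esub> e"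
        using xy Gc b e by (simp_all add: eq B.smult_l_distr E.smult_l_distr B.M.a_ac E.M.a_ac)
      then show "(x \<oplus>\<^bsub>B\<^esub> y, u \<oplus>\<^bsub>E\<^esub> v) \<in> G'"
        using G'I[OF Ga[OF xy(1,3)] E.R.a_closed[OF xy(2,4)]] by simp
    next
      fix r x u assume r: "r \<in> carrier R" and "(x, u) \<in> G'"
      then obtain x' u' s where xy: "(x', u') \<in> G" "s \<in> carrier R"
        and eq: "x = x' \<oplus>\<^bsub>B\<^esub> s \<odot>\<^bsub>B\<^esub> b" "u = u' \<oplus>\<^bsub>E\<^esub> s \<odot>\<^bsub>E\<^esub> e"
        unfolding G'_def by blast
      have "r \<odot>\<^bsub>B\<^esub> x = (r \<odot>\<^bsub>B\<^esub> x') \<oplus>\<^bsub>B\<^esub> (r \<otimes>\<^bsub>R\<^esub> s) \<odot>\<^bsub>B\<^esub> b"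
        "r \<odot>\<^bsub>E\<^esub> u = (r \<odot>\<^bsub>E\<^esub> u') \<oplus>\<^bsub>E\<^esub> (r \<otimes>\<^bsub>R\<^esub> s) \<odot>\<^bsub>E\<^esub> e"
        using xy r Gc b e
        by (simp_all add: eq B.smult_r_distr E.smult_r_distr B.smult_assoc1 E.smult_assoc1)
      then show "(r \<odot>\<^bsub>B\<^esub> x, r \<odot>\<^bsub>E\<^esub> u) \<in> G'"
        using G'I[OF Gs[OF r xy(1)] E.R.m_closed[OF r xy(2)]] by simp
    next
      \<comment> \<open>The enlarged relation stays single valued: if x + r b = 0, then r b = -x
        lies in the domain of G, so r is in I and the forced value -u equals r e.\<close>
      fix w assume "(\<zero>\<^bsub>B\<^esub>, w) \<in> G'"
      then obtain x u r where xu: "(x, u) \<in> G" "r \<in> carrier R"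
        and eq: "\<zero>\<^bsub>B\<^esub> = x \<oplus>\<^bsub>B\<^esub> r \<odot>\<^bsub>B\<^esub> b" "w = u \<oplus>\<^bsub>E\<^esub> r \<odot>\<^bsub>E\<^esub> e"
        unfolding G'_def by blast
      have "msub R B \<zero>\<^bsub>B\<^esub> x = r \<odot>\<^bsub>B\<^esub> b"
        using eq(1) xu b Gc by (subst B.msub_eq_iff) (auto simp: B.M.a_comm)
      then have G1: "(r \<odot>\<^bsub>B\<^esub> b, msub R E \<zero>\<^bsub>E\<^esub> u) \<in> G" using Gm[OF G0 xu(1)] by simp
      then have "r \<in> I" using xu by (auto simp: I_def)
      then have "msub R E \<zero>\<^bsub>E\<^esub> u = r \<odot>\<^bsub>E\<^esub> e" using e(2) kI[OF G1] by simp
      then show "w = \<zero>\<^bsub>E\<^esub>"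
        using xu e Gc E.msub_add_cancel[of "\<zero>\<^bsub>E\<^esub>" u] by (simp add: eq(2) E.M.a_comm)
    qed
    then have "G' = G" using max sub by blast
    then have "(b, e) \<in> G" using G'I[OF G0 E.R.one_closed] b e by simp
    then show ?thesis ..
  qed
  define h where "h x = (THE u. (x, u) \<in> G)" for x
  have hI: "h x = u" if "(x, u) \<in> G" for x u unfolding h_def using that single by blast
  have h: "(x, h x) \<in> G" if "x \<in> carrier B" for x using dom[OF that] hI by auto
  have "mod_map R B E h"
  proof (rule mod_mapI)
    show "h x \<in> carrier E" if "x \<in> carrier B" for x using Gc(2)[OF h[OF that]] .
    show "h (x \<oplus>\<^bsub>B\<^esub> y) = h x \<oplus>\<^bsub>E\<^esub> h y" if "x \<in> carrier B" "y \<in> carrier B" for x y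
      using hI[OF Ga[OF h[OF that(1)] h[OF that(2)]]] .
    show "h (r \<odot>\<^bsub>B\<^esub> x) = r \<odot>\<^bsub>E\<^esub> h x" if "r \<in> carrier R" "x \<in> carrier B" for r x
      using hI[OF Gs[OF that(1) h[OF that(2)]]] .
  qed
  moreover have "h x = g x" if "x \<in> A" for x using hI[OF Gg[OF that]] .
  ultimately show ?thesis by blast
qed

text \<open>Extension along a map that may have a kernel, by passing to its image. It will be
  applied to differentials and to the map from an ideal to R / a^k.\<close>

lemma baer_extend_along:
  assumes X: "baer R X" and A: "module R A" and B: "module R B"
    and f: "mod_map R A B f" and u: "mod_map R A X u"
    and ker: "\<And>x. x \<in> carrier A \<Longrightarrow> f x = \<zero>\<^bsub>B\<^esub> \<Longrightarrow> u x = \<zero>\<^bsub>X\<^esub>"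
  shows "\<exists>g. mod_map R B X g \<and> (\<forall>x\<in>carrier A. g (f x) = u x)"
proof -
  interpret A: rmodule R A by (rule rmodule.intro) fact
  interpret B: rmodule R B by (rule rmodule.intro) fact
  have im: "submodule (f ` carrier A) R B" by (rule A.image_submodule[OF B f])
  have "\<exists>g. mod_map R (B\<lparr>carrier := f ` carrier A\<rparr>) X g \<and> (\<forall>x\<in>carrier A. g (f x) = u x)"
    by (rule mod_map_factor_kernel[OF A baer_module[OF X] B.submodule_module[OF im] _ _ u])
      (use f ker in \<open>auto intro: mod_map_into_carrierI\<close>)
  then obtain g where g: "mod_map R (B\<lparr>carrier := f ` carrier A\<rparr>) X g" "\<forall>x\<in>carrier A. g (f x) = u x"
    by blast
  from baer_extend[OF X B im g(1)] show ?thesis using g(2) by auto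
qed

lemma injective_module_imp_baer:
  fixes E :: "('a, 'e) module"
  assumes E: "injective_module R E" shows "baer R E"
  unfolding baer_def
proof (intro conjI allI impI)
  show EM: "module R E" using E by (simp add: injective_module_def)
  fix I g assume *: "submodule I R (regular_module R) \<and> mod_map R (regular_module R\<lparr>carrier := I\<rparr>) E g"
  then have I: "submodule I R (regular_module R)" and g: "mod_map R (regular_module R\<lparr>carrier := I\<rparr>) E g"
    by auto
  have R: "module R (regular_module R)" using EM by (rule regular_module[OF module_cring])
  interpret L: rmodule R "regular_module R" by (rule rmodule.intro) (rule R)
  have RI: "module R (regular_module R\<lparr>carrier := I\<rparr>)" by (rule L.submodule_module[OF I])
  have IR: "I \<subseteq> carrier R" using L.submodule_subset[OF I] by simp
  \<comment> \<open>Tagged singletons put a copy of R, and with it of every ideal, into the type of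
    the test modules.\<close>
  define j :: "'a \<Rightarrow> ('a, 'e) large" where "j r = {Inr (Inl r)}" for r
  have j: "inj_on j S" for S by (auto simp: j_def inj_on_def)
  let ?A = "transport j (regular_module R\<lparr>carrier := I\<rparr>)" and ?B = "transport j (regular_module R)"
  have A: "module R ?A" and B: "module R ?B" by (rule transport_module j R RI)+
  have "mod_map R ?A ?B (\<lambda>x. j (inv_into (carrier (regular_module R\<lparr>carrier := I\<rparr>)) j x))"
    using transport_inv_map[OF RI j] mod_map_restrict_carrier transport_map[OF j] IR
    by (intro mod_map_comp[OF transport_inv_map[OF RI j]]
      mod_map_restrict_carrier[OF transport_map[OF j]]) simp
  then have f: "mod_map R ?A ?B (\<lambda>x. x)"
    by (rule iffD1[OF mod_map_cong[OF A], rotated]) (auto simp: f_inv_into_f)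
  have g': "mod_map R ?A E (\<lambda>x. g (inv_into I j x))"
    using mod_map_comp[OF transport_inv_map[OF RI j] g] by simp
  have inv: "inv_into I j (j r) = r" if "r \<in> I" for r using that by (simp add: j)
  let ?f = "restrict (\<lambda>x. x) (carrier ?A)" and ?g = "restrict (\<lambda>x. g (inv_into I j x)) (carrier ?A)"
  have "\<exists>h\<in>mod_hom R ?B E. \<forall>x\<in>carrier ?A. h (?f x) = ?g x"
  proof (rule E[unfolded injective_module_def, THEN conjunct2, rule_format])
    show "module R ?A \<and> module R ?B \<and> ?f \<in> mod_hom R ?A ?B \<and> inj_on ?f (carrier ?A) \<and> ?g \<in> mod_hom R ?A E"
      using A B restrict_mod_hom[OF A f] restrict_mod_hom[OF A g'] by (simp add: inj_on_def)
  qed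
  then obtain h where h: "h \<in> mod_hom R ?B E" "\<And>r. r \<in> I \<Longrightarrow> h (j r) = g r"
    using inv by auto
  let ?e = "h (j \<one>\<^bsub>R\<^esub>)"
  have e: "?e \<in> carrier E" using mod_map_closed[OF mod_hom_map[OF h(1)]] by simp
  have "g r = r \<odot>\<^bsub>E\<^esub> ?e" if "r \<in> I" for r
  proof -
    have r: "r \<in> carrier R" using that IR by auto
    have "j r = r \<odot>\<^bsub>?B\<^esub> j \<one>\<^bsub>R\<^esub>"
      using mod_map_smult[OF transport_map[OF j], of r R "\<one>\<^bsub>R\<^esub>" "regular_module R"] r by simp
    then have "h (j r) = r \<odot>\<^bsub>E\<^esub> ?e"
      using mod_map_smult[OF mod_hom_map[OF h(1)] r] by simp
    then show ?thesis using h(2)[OF that] by simp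
  qed
  with e show "\<exists>e\<in>carrier E. \<forall>r\<in>I. g r = r \<odot>\<^bsub>E\<^esub> e" by blast
qed

lemma baer_imp_injective_module:
  fixes R :: "('a, 'r) ring_scheme" and E :: "('a, 'e) module"
  assumes "baer R E" shows "injective_module R E"
  unfolding injective_module_def
proof (intro conjI allI impI)
  show "module R E" using assms by (rule baer_module)
next
  fix A B :: "('a, ('a, 'e) large) module" and f g
  assume *: "module R A \<and> module R B \<and> f \<in> mod_hom R A B \<and> inj_on f (carrier A) \<and> g \<in> mod_hom R A E"
  then have A: "module R A" and B: "module R B" by auto
  interpret A: rmodule R A by (rule rmodule.intro) fact
  have f: "mod_map R A B f" and g: "mod_map R A E g" using * by (auto intro: mod_hom_map)
  have "\<exists>h. mod_map R B E h \<and> (\<forall>x\<in>carrier A. h (f x) = g x)"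
  proof (rule baer_extend_along[OF assms A B f g])
    fix x assume x: "x \<in> carrier A" "f x = \<zero>\<^bsub>B\<^esub>"
    then have "x = \<zero>\<^bsub>A\<^esub>" using * A.mod_map_zero[OF B f] by (auto simp: inj_on_def)
    then show "g x = \<zero>\<^bsub>E\<^esub>" using A.mod_map_zero[OF baer_module[OF assms] g] by simp
  qed
  then obtain h where h: "mod_map R B E h" "\<forall>x\<in>carrier A. h (f x) = g x" by blast
  then show "\<exists>h\<in>mod_hom R B E. \<forall>x\<in>carrier A. h (f x) = g x"
    using mod_map_closed[OF f] by (intro bexI[OF _ restrict_mod_hom[OF B h(1)]]) auto
qed

section \<open>Cardinality\<close>

lemma inj_prod_infinite:
  assumes "infinite (UNIV :: 'w set)"
  shows "\<exists>k :: 'w \<times> 'w \<Rightarrow> 'w. inj k"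
  using card_of_Times_same_infinite[OF assms] card_of_ordLeq[of "UNIV \<times> UNIV" "UNIV :: 'w set"]
    ordIso_imp_ordLeq by (metis UNIV_Times_UNIV)

lemma infinite_sum: "infinite (UNIV :: (nat + 'b) set)"
  by (metis finite_Plus_UNIV_iff infinite_UNIV_nat)

text \<open>Sets over an infinite type absorb finite sequences of such sets. This keeps spans and
  divisible hulls within the prescribed types.\<close>

lemma inj_set_lists: "\<exists>f :: (nat + 'b) set list \<Rightarrow> (nat + 'b) set. inj f"
proof -
  obtain k :: "(nat + 'b) \<times> (nat + 'b) \<Rightarrow> nat + 'b" where k: "inj k"
    using inj_prod_infinite[OF infinite_sum] by blast
  have k': "k (x, y) = k (x', y') \<longleftrightarrow> x = x' \<and> y = y'" for x y x' y'
    using inj_eq[OF k] by simp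
  \<comment> \<open>Tag 0 records which positions exist, tag 1 the members of the set at each
    position. Without tag 0 an entry that is the empty set would leave no trace.\<close>
  define f where "f xs = {k (Inl i, k (Inl 0, Inl 0)) | i. i < length xs} \<union>
    {k (Inl i, k (Inl 1, w)) | i w. i < length xs \<and> w \<in> xs ! i}" for xs
  have len: "i < length xs \<longleftrightarrow> k (Inl i, k (Inl 0, Inl 0)) \<in> f xs" for i xs
    by (auto simp: f_def k')
  have elt: "i < length xs \<Longrightarrow> w \<in> xs ! i \<longleftrightarrow> k (Inl i, k (Inl 1, w)) \<in> f xs" for i w xs
    by (auto simp: f_def k')
  have "inj f"
  proof (rule injI)
    fix xs ys assume eq: "f xs = f ys"
    have l: "i < length xs \<longleftrightarrow> i < length ys" for i using len[of i xs] len[of i ys] eq by simp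
    then have "length xs = length ys" by (meson linorder_neqE_nat nless_le)
    moreover have "xs ! i = ys ! i" if "i < length xs" for i
      using that l elt[of i xs] elt[of i ys] eq by blast
    ultimately show "xs = ys" by (rule nth_equalityI)
  qed
  then show ?thesis by blast
qed

section \<open>Projective modules\<close>

primrec lin_comb :: "('a, 'm) module \<Rightarrow> ('a \<times> 'm) list \<Rightarrow> 'm"
  where
    "lin_comb M [] = \<zero>\<^bsub>M\<^esub>"
  | "lin_comb M (p # ps) = fst p \<odot>\<^bsub>M\<^esub> snd p \<oplus>\<^bsub>M\<^esub> lin_comb M ps"

context rmodule begin

lemma lin_comb_closed: "set ps \<subseteq> carrier R \<times> carrier M \<Longrightarrow> lin_comb M ps \<in> carrier M"
  by (induction ps) auto

lemma lin_comb_append: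
  "set ps \<subseteq> carrier R \<times> carrier M \<Longrightarrow> set qs \<subseteq> carrier R \<times> carrier M \<Longrightarrow>
    lin_comb M (ps @ qs) = lin_comb M ps \<oplus>\<^bsub>M\<^esub> lin_comb M qs"
  by (induction ps) (auto simp: lin_comb_closed M.a_assoc)

lemma lin_comb_smult:
  "r \<in> carrier R \<Longrightarrow> set ps \<subseteq> carrier R \<times> carrier M \<Longrightarrow>
    lin_comb M (map (\<lambda>(s, x). (r \<otimes> s, x)) ps) = r \<odot>\<^bsub>M\<^esub> lin_comb M ps"
  by (induction ps) (auto simp: lin_comb_closed smult_r_distr smult_assoc1)

text \<open>Lists of coefficients and generators name the elements of a span, so that the span can
  be coded in a small type.\<close>

lemma lin_comb_submodule:
  assumes T: "T \<subseteq> carrier M"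
  shows "submodule (lin_comb M ` {ps. set ps \<subseteq> carrier R \<times> T}) R M" (is "submodule ?S R M")
    and "T \<subseteq> lin_comb M ` {ps. set ps \<subseteq> carrier R \<times> T}"
proof -
  have TM: "set ps \<subseteq> carrier R \<times> carrier M" if "set ps \<subseteq> carrier R \<times> T" for ps
    using that T by auto
  show "submodule ?S R M"
    unfolding submodule_alt
  proof (intro conjI ballI)
    show "?S \<subseteq> carrier M" using TM lin_comb_closed by blast
    show "\<zero>\<^bsub>M\<^esub> \<in> ?S" by (rule image_eqI[of _ _ "[]"]) auto
  next
    fix x y assume "x \<in> ?S" "y \<in> ?S"
    then obtain ps qs where "x = lin_comb M ps" "y = lin_comb M qs"
      "set ps \<subseteq> carrier R \<times> T" "set qs \<subseteq> carrier R \<times> T" by blast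
    then show "x \<oplus>\<^bsub>M\<^esub> y \<in> ?S"
      using lin_comb_append[of ps qs] TM by (intro image_eqI[of _ _ "ps @ qs"]) auto
  next
    fix r x assume r: "r \<in> carrier R" and "x \<in> ?S"
    then obtain ps where "x = lin_comb M ps" "set ps \<subseteq> carrier R \<times> T" by blast
    then show "r \<odot>\<^bsub>M\<^esub> x \<in> ?S"
      using lin_comb_smult[OF r, of ps] TM r by (intro image_eqI[of _ _ "map (\<lambda>(s, x). (r \<otimes> s, x)) ps"]) auto
  qed
  show "T \<subseteq> ?S"
  proof
    fix x assume "x \<in> T"
    then show "x \<in> ?S" using T by (intro image_eqI[of _ _ "[(\<one>, x)]"]) auto
  qed
qed

end

text \<open>\<open>A\<close> may be too large for the types over which projectivity is tested, but the submodule that is generated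
  by one preimage in \<open>A\<close> of each \<open>g x\<close> is not.\<close>

lemma projective_lift:
  fixes P :: "('a, 'p) module" and A :: "('a, 's) module"
  assumes P: "projective_module R P" and A: "module R A" and B: "module R B"
    and q: "mod_map R A B q" and g: "mod_map R P B g" and sur: "\<And>x. x \<in> carrier P \<Longrightarrow> g x \<in> q ` carrier A"
  shows "\<exists>h. mod_map R P A h \<and> (\<forall>x\<in>carrier P. q (h x) = g x)"
proof -
  have PM: "module R P" using P by (simp add: projective_module_def)
  interpret A: rmodule R A by (rule rmodule.intro) fact
  interpret B: rmodule R B by (rule rmodule.intro) fact
  have "\<forall>x\<in>carrier P. \<exists>a. a \<in> carrier A \<and> q a = g x" using sur by fastforce
  then obtain a where a: "\<And>x. x \<in> carrier P \<Longrightarrow> a x \<in> carrier A \<and> q (a x) = g x" by metis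
  let ?L = "{ps. set ps \<subseteq> carrier R \<times> a ` carrier P}"
  define S where "S = lin_comb A ` ?L"
  have aA: "a ` carrier P \<subseteq> carrier A" using a by auto
  have S: "submodule S R A" and aS: "\<And>x. x \<in> carrier P \<Longrightarrow> a x \<in> S"
    using A.lin_comb_submodule[OF aA] by (auto simp: S_def)
  let ?A = "A\<lparr>carrier := S\<rparr>"
  have A': "module R ?A" by (rule A.submodule_module[OF S])
  interpret A': rmodule R ?A by (rule rmodule.intro) (rule A')
  have q': "mod_map R ?A B q" by (rule mod_map_restrict_carrier[OF q A.submodule_subset[OF S]])
  have qS: "submodule (q ` S) R B" using A'.image_submodule[OF B q'] by simp
  let ?B = "B\<lparr>carrier := q ` S\<rparr>"
  have B': "module R ?B" by (rule B.submodule_module[OF qS])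
  have q'': "mod_map R ?A ?B q" by (rule mod_map_into_carrierI[OF q']) auto
  have g': "mod_map R P ?B g" by (rule mod_map_into_carrierI[OF g]) (use a aS in \<open>metis imageI\<close>)
  obtain enc :: "(nat + 'a + 'p) set list \<Rightarrow> (nat + 'a + 'p) set" where enc: "inj enc"
    using inj_set_lists by blast
  \<comment> \<open>One list of coefficients and generators is fixed for each element of S.\<close>
  define c where "c s = inv_into ?L (lin_comb A) s" for s
  have c: "lin_comb A (c s) = s" "set (c s) \<subseteq> carrier R \<times> a ` carrier P" if "s \<in> S" for s
    using that f_inv_into_f[of s "lin_comb A" ?L] inv_into_into[of s "lin_comb A" ?L]
    by (auto simp: c_def S_def)
  \<comment> \<open>A generator is named by an index in P instead of by itself, so the type of A
    does not enter the code.\<close>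
  define code :: "('a \<times> 's) \<Rightarrow> (nat + 'a + 'p) set"
    where "code p = {Inr (Inl (fst p)), Inr (Inr (inv_into (carrier P) a (snd p)))}" for p
  have code: "inj_on code (carrier R \<times> a ` carrier P)"
    by (rule inj_onI) (auto simp: code_def doubleton_eq_iff dest: inv_into_injective)
  define j where "j s = enc (map code (c s))" for s
  have j: "inj_on j S"
  proof (rule inj_onI)
    fix s t assume st: "s \<in> S" "t \<in> S" "j s = j t"
    then have "map code (c s) = map code (c t)" using enc by (simp add: j_def inj_eq)
    moreover have "inj_on code (set (c s) \<union> set (c t))"
      using c st by (intro inj_on_subset[OF code]) auto
    ultimately have "c s = c t" by (rule map_inj_on)
    then show "s = t" using c(1) st by metis
  qed
  \<comment> \<open>The image of S is coded through chosen preimages in S, so B needs no code of its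
    own.\<close>
  let ?k = "\<lambda>b. j (inv_into S q b)"
  have k: "inj_on ?k (q ` S)"
    by (rule comp_inj_on[of "inv_into S q" _ j, unfolded o_def])
      (auto intro: inj_on_inv_into inj_on_subset[OF j] inv_into_into)
  let ?A1 = "transport j ?A" and ?B1 = "transport ?k ?B"
  have A1: "module R ?A1" and B1: "module R ?B1" using j k by (auto intro!: transport_module A' B')
  have iA: "mod_map R ?A1 ?A (inv_into S j)" using transport_inv_map[OF A'] j by simp
  have kB: "mod_map R ?B ?B1 ?k" using transport_map[of ?k ?B] k by simp
  have f1: "mod_map R ?A1 ?B1 (\<lambda>x. ?k (q (inv_into S j x)))"
    by (rule mod_map_comp[OF mod_map_comp[OF iA q''] kB])
  have g1: "mod_map R P ?B1 (\<lambda>x. ?k (g x))" by (rule mod_map_comp[OF g' kB])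
  let ?f = "restrict (\<lambda>x. ?k (q (inv_into S j x))) (carrier ?A1)" and ?g = "restrict (\<lambda>x. ?k (g x)) (carrier P)"
  have "?f ` carrier ?A1 = carrier ?B1"
    by (auto simp: image_image j)
  then have "\<exists>h\<in>mod_hom R P ?A1. \<forall>x\<in>carrier P. ?f (h x) = ?g x"
    using P A1 B1 restrict_mod_hom[OF A1 f1] restrict_mod_hom[OF PM g1]
    unfolding projective_module_def by blast
  then obtain h where h: "h \<in> mod_hom R P ?A1" "\<And>x. x \<in> carrier P \<Longrightarrow> ?f (h x) = ?g x" by blast
  have hm: "mod_map R P ?A1 h" by (rule mod_hom_map[OF h(1)])
  have hh: "mod_map R P ?A (\<lambda>x. inv_into S j (h x))" by (rule mod_map_comp[OF hm iA])
  have "q (inv_into S j (h x)) = g x" if x: "x \<in> carrier P" for x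
  proof -
    have "?k (q (inv_into S j (h x))) = ?k (g x)" using h(2)[OF x] x mod_map_closed[OF hm x] by simp
    then show ?thesis
      using inj_onD[OF k] mod_map_closed[OF hh x] mod_map_closed[OF g' x] by simp
  qed
  then show ?thesis using mod_map_from_carrier[OF hh A.submodule_subset[OF S]] by blast
qed

section \<open>Divisible hulls of abelian groups\<close>

definition int_cring :: "int ring" where "int_cring = \<Z>"

lemma int_cring: "cring int_cring"
  by (simp add: int_cring_def int_is_cring)

lemma int_cring_simps [simp]:
  "carrier int_cring = UNIV" "\<zero>\<^bsub>int_cring\<^esub> = 0" "\<one>\<^bsub>int_cring\<^esub> = 1"
  "x \<oplus>\<^bsub>int_cring\<^esub> y = x + y" "x \<otimes>\<^bsub>int_cring\<^esub> y = x * y" "\<ominus>\<^bsub>int_cring\<^esub> x = - x"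
  by (simp_all add: int_cring_def int_a_inv_eq)

lemma int_submodule_principal:
  assumes I: "submodule I int_cring (regular_module int_cring)"
  shows "\<exists>a\<in>I. \<forall>r\<in>I. a dvd r"
proof -
  interpret L: rmodule int_cring "regular_module int_cring"
    by (rule rmodule.intro regular_module int_cring)+
  have add: "x + y \<in> I" if "x \<in> I" "y \<in> I" for x y
    using L.submodule_add[OF I that] by simp
  have mult: "k * x \<in> I" if "x \<in> I" for k x
    using L.submodule_smult[OF I _ that, of k] by simp
  show ?thesis
  proof (cases "I \<subseteq> {0}")
    case True then show ?thesis using L.submodule_zero[OF I] by auto
  next
    case False
    then obtain x where "x \<in> I" "x \<noteq> 0" by auto
    have ex: "\<exists>n. n > 0 \<and> int n \<in> I"
    proof (cases "x > 0")
      case True with \<open>x \<in> I\<close> show ?thesis by (intro exI[of _ "nat x"]) simp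
    next
      case False with \<open>x \<in> I\<close> \<open>x \<noteq> 0\<close> mult[of x "-1"] show ?thesis by (intro exI[of _ "nat (-x)"]) simp
    qed
    define m where "m = (LEAST n. n > 0 \<and> int n \<in> I)"
    have m: "m > 0" "int m \<in> I" using LeastI_ex[OF ex] by (auto simp: m_def)
    have "int m dvd r" if "r \<in> I" for r
    proof (rule ccontr)
      assume nd: "\<not> int m dvd r"
      have "r + (- (r div int m)) * int m \<in> I" by (intro add mult that m)
      then have "r mod int m \<in> I" by (simp add: minus_div_mult_eq_mod[symmetric])
      moreover have "r mod int m \<noteq> 0" using nd by (simp add: dvd_eq_mod_eq_0)
      moreover have "r mod int m \<ge> 0" "r mod int m < int m" using m(1) by simp_all
      ultimately have "nat (r mod int m) > 0 \<and> int (nat (r mod int m)) \<in> I" "nat (r mod int m) < m"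
        by auto
      then show False using not_less_Least[of _ "\<lambda>n. n > 0 \<and> int n \<in> I", folded m_def] by metis
    qed
    then show ?thesis using m by blast
  qed
qed

text \<open>Ideals of the integers are principal, so a map on (a) is determined by its value at a,
  and any solution of a e = g a is the required element. For a = 0 the map is zero.\<close>

lemma divisible_baer:
  assumes D: "module int_cring D"
    and div: "\<And>n d. n \<noteq> 0 \<Longrightarrow> d \<in> carrier D \<Longrightarrow> \<exists>e\<in>carrier D. n \<odot>\<^bsub>D\<^esub> e = d"
  shows "baer int_cring D"
  unfolding baer_def
proof (intro conjI allI impI D)
  interpret D: rmodule int_cring D by (rule rmodule.intro) fact
  fix I g assume "submodule I int_cring (regular_module int_cring) \<and>
    mod_map int_cring (regular_module int_cring\<lparr>carrier := I\<rparr>) D g"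
  then have I: "submodule I int_cring (regular_module int_cring)"
    and g: "mod_map int_cring (regular_module int_cring\<lparr>carrier := I\<rparr>) D g" by auto
  obtain a where a: "a \<in> I" "\<And>r. r \<in> I \<Longrightarrow> a dvd r" using int_submodule_principal[OF I] by blast
  have ga: "g a \<in> carrier D" using mod_map_closed[OF g] a by simp
  have gs: "g (k * a) = k \<odot>\<^bsub>D\<^esub> g a" for k using mod_map_smult[OF g, of k a] a by simp
  have "\<exists>e\<in>carrier D. a \<odot>\<^bsub>D\<^esub> e = g a"
  proof (cases "a = 0")
    case True
    have "g a = \<zero>\<^bsub>D\<^esub>" using gs[of 0] True ga D.smult_l_null by simp
    then show ?thesis using True D.smult_l_null by auto
  qed (use div ga in auto)
  then obtain e where e: "e \<in> carrier D" "a \<odot>\<^bsub>D\<^esub> e = g a" by blast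
  have "g r = r \<odot>\<^bsub>D\<^esub> e" if r: "r \<in> I" for r
  proof -
    obtain k where k: "r = k * a" using a(2)[OF r] by (metis dvd_def mult.commute)
    show ?thesis using gs[of k] e(2)[symmetric] D.smult_assoc1[of k a e] e(1) by (simp add: k)
  qed
  then show "\<exists>e\<in>carrier D. \<forall>r\<in>I. g r = r \<odot>\<^bsub>D\<^esub> e" using e by blast
qed

text \<open>The rational vector space with basis X, as a module over the integers.\<close>

definition rat_span :: "'n set \<Rightarrow> (int, 'n \<Rightarrow> rat) module"
  where "rat_span X =
    \<lparr>carrier = {f. finite {x. f x \<noteq> 0} \<and> {x. f x \<noteq> 0} \<subseteq> X}, monoid.mult = undefined, monoid.one = undefined,
     ring.zero = (\<lambda>x. 0), ring.add = (\<lambda>f g x. f x + g x), module.smult = (\<lambda>k f x. of_int k * f x)\<rparr>"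

lemma rat_span_simps:
  "f \<in> carrier (rat_span X) \<longleftrightarrow> finite {x. f x \<noteq> 0} \<and> {x. f x \<noteq> 0} \<subseteq> X"
  "\<zero>\<^bsub>rat_span X\<^esub> = (\<lambda>x. 0)" "f \<oplus>\<^bsub>rat_span X\<^esub> g = (\<lambda>x. f x + g x)"
  "k \<odot>\<^bsub>rat_span X\<^esub> f = (\<lambda>x. of_int k * f x)"
  by (simp_all add: rat_span_def)

lemma rat_span_add_closed:
  assumes "f \<in> carrier (rat_span X)" "g \<in> carrier (rat_span X)"
  shows "(\<lambda>x. f x + g x) \<in> carrier (rat_span X)"
proof -
  have "{x. f x + g x \<noteq> 0} \<subseteq> {x. f x \<noteq> 0} \<union> {x. g x \<noteq> 0}" by auto
  then show ?thesis
    using assms finite_subset[of "{x. f x + g x \<noteq> 0}" "{x. f x \<noteq> 0} \<union> {x. g x \<noteq> 0}"]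
    by (auto simp: rat_span_simps)
qed

lemma rat_span_mult_closed:
  assumes "f \<in> carrier (rat_span X)"
  shows "(\<lambda>x. q * f x) \<in> carrier (rat_span X)"
proof -
  have "{x. q * f x \<noteq> 0} \<subseteq> {x. f x \<noteq> 0}" by auto
  then show ?thesis
    using assms finite_subset[of "{x. q * f x \<noteq> 0}" "{x. f x \<noteq> 0}"]
    by (auto simp: rat_span_simps)
qed

lemma rat_span_module: "module int_cring (rat_span X)"
proof (rule moduleI')
  show "f \<oplus>\<^bsub>rat_span X\<^esub> g \<in> carrier (rat_span X)"
    if "f \<in> carrier (rat_span X)" "g \<in> carrier (rat_span X)" for f g
    unfolding rat_span_simps(3) using that by (rule rat_span_add_closed)
  show "k \<odot>\<^bsub>rat_span X\<^esub> f \<in> carrier (rat_span X)" if "f \<in> carrier (rat_span X)" for k f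
    unfolding rat_span_simps(4) using that by (rule rat_span_mult_closed)
qed (simp_all add: int_cring rat_span_simps algebra_simps)

text \<open>Evaluation in A of a formal integral combination of elements of A. The floor merely
  reads an integral rational as an integer; it is used, and is additive, only on
  \<open>int_span\<close>.\<close>

definition int_eval :: "(int, 'n) module \<Rightarrow> ('n \<Rightarrow> rat) \<Rightarrow> 'n"
  where "int_eval A f = finsum A (\<lambda>x. \<lfloor>f x\<rfloor> \<odot>\<^bsub>A\<^esub> x) {x. f x \<noteq> 0}"

definition int_span :: "'n set \<Rightarrow> ('n \<Rightarrow> rat) set"
  where "int_span X = {f \<in> carrier (rat_span X). \<forall>x. f x \<in> \<int>}"

lemma int_span_submodule: "submodule (int_span X) int_cring (rat_span X)"
proof -
  interpret V: rmodule int_cring "rat_span X" by (rule rmodule.intro rat_span_module)+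
  show ?thesis
    unfolding V.submodule_alt int_span_def
    using rat_span_add_closed rat_span_mult_closed by (auto simp: rat_span_simps(2-4)) (auto simp: rat_span_simps)
qed

lemma int_eval_map:
  assumes A: "module int_cring A"
  shows "mod_map int_cring (rat_span (carrier A)\<lparr>carrier := int_span (carrier A)\<rparr>) A (int_eval A)"
proof -
  interpret A: rmodule int_cring A by (rule rmodule.intro) fact
  \<comment> \<open>Terms off the support vanish, so the sum may run over any larger finite set;
    this gives f, g and their sum a common index set.\<close>
  have ev: "int_eval A f = finsum A (\<lambda>x. \<lfloor>f x\<rfloor> \<odot>\<^bsub>A\<^esub> x) S"
    if "finite S" "S \<subseteq> carrier A" "{x. f x \<noteq> 0} \<subseteq> S" for f S
    unfolding int_eval_def
    by (rule A.M.add.finprod_mono_neutral_cong_left)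
      (use that A.smult_l_null in \<open>auto simp: subset_iff\<close>)
  have fl: "\<lfloor>p + q\<rfloor> = \<lfloor>p\<rfloor> + \<lfloor>q\<rfloor>" if "p \<in> \<int>" "q \<in> \<int>" for p q :: rat
    using that by (auto elim!: Ints_cases simp flip: of_int_add)
  have fm: "\<lfloor>of_int k * p\<rfloor> = k * \<lfloor>p\<rfloor>" if "p \<in> \<int>" for p :: rat and k
    using that by (auto elim!: Ints_cases simp flip: of_int_mult)
  show ?thesis
  proof (rule mod_mapI; simp add: rat_span_simps)
    fix f assume "f \<in> int_span (carrier A)"
    then have "{x. f x \<noteq> 0} \<subseteq> carrier A" by (simp add: int_span_def rat_span_simps)
    then show "int_eval A f \<in> carrier A"
      unfolding int_eval_def by (intro A.M.finsum_closed) auto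
  next
    fix f g assume fg: "f \<in> int_span (carrier A)" "g \<in> int_span (carrier A)"
    let ?S = "{x. f x \<noteq> 0} \<union> {x. g x \<noteq> 0}"
    have S: "finite ?S" "?S \<subseteq> carrier A" using fg by (auto simp: int_span_def rat_span_simps)
    have "int_eval A (\<lambda>x. f x + g x) = finsum A (\<lambda>x. \<lfloor>f x + g x\<rfloor> \<odot>\<^bsub>A\<^esub> x) ?S"
      by (rule ev[OF S]) auto
    also have "\<dots> = finsum A (\<lambda>x. \<lfloor>f x\<rfloor> \<odot>\<^bsub>A\<^esub> x \<oplus>\<^bsub>A\<^esub> \<lfloor>g x\<rfloor> \<odot>\<^bsub>A\<^esub> x) ?S"
    proof (rule A.M.finsum_cong'[OF refl])
      fix x assume "x \<in> ?S"
      then have "x \<in> carrier A" "f x \<in> \<int>" "g x \<in> \<int>" using S fg by (auto simp: int_span_def)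
      then show "\<lfloor>f x + g x\<rfloor> \<odot>\<^bsub>A\<^esub> x = \<lfloor>f x\<rfloor> \<odot>\<^bsub>A\<^esub> x \<oplus>\<^bsub>A\<^esub> \<lfloor>g x\<rfloor> \<odot>\<^bsub>A\<^esub> x"
        using A.smult_l_distr[of "\<lfloor>f x\<rfloor>" "\<lfloor>g x\<rfloor>" x] fl by simp
    qed (use S in auto)
    also have "\<dots> = finsum A (\<lambda>x. \<lfloor>f x\<rfloor> \<odot>\<^bsub>A\<^esub> x) ?S \<oplus>\<^bsub>A\<^esub> finsum A (\<lambda>x. \<lfloor>g x\<rfloor> \<odot>\<^bsub>A\<^esub> x) ?S"
      by (rule A.M.finsum_addf) (use S in auto)
    also have "\<dots> = int_eval A f \<oplus>\<^bsub>A\<^esub> int_eval A g"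
      using ev[OF S, of f] ev[OF S, of g] by auto
    finally show "int_eval A (\<lambda>x. f x + g x) = int_eval A f \<oplus>\<^bsub>A\<^esub> int_eval A g" .
  next
    fix k f assume f: "f \<in> int_span (carrier A)"
    let ?S = "{x. f x \<noteq> 0}"
    have S: "finite ?S" "?S \<subseteq> carrier A" using f by (auto simp: int_span_def rat_span_simps)
    have "int_eval A (\<lambda>x. of_int k * f x) = finsum A (\<lambda>x. \<lfloor>of_int k * f x\<rfloor> \<odot>\<^bsub>A\<^esub> x) ?S"
      by (rule ev[OF S]) auto
    also have "\<dots> = finsum A (\<lambda>x. k \<odot>\<^bsub>A\<^esub> (\<lfloor>f x\<rfloor> \<odot>\<^bsub>A\<^esub> x)) ?S"
    proof (rule A.M.finsum_cong'[OF refl])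
      fix x assume "x \<in> ?S"
      then have "x \<in> carrier A" "f x \<in> \<int>" using S f by (auto simp: int_span_def)
      then show "\<lfloor>of_int k * f x\<rfloor> \<odot>\<^bsub>A\<^esub> x = k \<odot>\<^bsub>A\<^esub> (\<lfloor>f x\<rfloor> \<odot>\<^bsub>A\<^esub> x)"
        using A.smult_assoc1[of k "\<lfloor>f x\<rfloor>" x] fm by simp
    qed (use S in auto)
    also have "\<dots> = k \<odot>\<^bsub>A\<^esub> finsum A (\<lambda>x. \<lfloor>f x\<rfloor> \<odot>\<^bsub>A\<^esub> x) ?S"
      by (rule A.finsum_smult_ldistr[symmetric]) (use S in auto)
    finally show "int_eval A (\<lambda>x. of_int k * f x) = k \<odot>\<^bsub>A\<^esub> int_eval A f"
      by (simp add: int_eval_def)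
  qed
qed

lemma transport_baer:
  assumes E: "baer R E" and j: "inj_on j (carrier E)"
  shows "baer R (transport j E)"
  unfolding baer_def
proof (intro conjI allI impI transport_module[OF baer_module[OF E] j])
  fix I g assume *: "submodule I R (regular_module R) \<and>
    mod_map R (regular_module R\<lparr>carrier := I\<rparr>) (transport j E) g"
  note iv = transport_inv_map[OF baer_module[OF E] j]
  have "mod_map R (regular_module R\<lparr>carrier := I\<rparr>) E (\<lambda>r. inv_into (carrier E) j (g r))"
    using * by (intro mod_map_comp[OF _ iv]) auto
  then obtain e where e: "e \<in> carrier E" "\<And>r. r \<in> I \<Longrightarrow> inv_into (carrier E) j (g r) = r \<odot>\<^bsub>E\<^esub> e"
    using E * unfolding baer_def by blast
  have "g r = r \<odot>\<^bsub>transport j E\<^esub> j e" if "r \<in> I" for r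
  proof -
    interpret L: rmodule R "regular_module R"
      by (rule rmodule.intro, rule regular_module, rule module_cring[OF baer_module[OF E]])
    have r: "r \<in> carrier R" using L.submodule_subset * that by auto
    have "g r \<in> j ` carrier E" using * that mod_map_closed[of R "regular_module R\<lparr>carrier := I\<rparr>"] by fastforce
    then have "g r = j (r \<odot>\<^bsub>E\<^esub> e)" using e(2)[OF that] f_inv_into_f by metis
    then show ?thesis using mod_map_smult[OF transport_map[OF j] r e(1)] by simp
  qed
  then show "\<exists>e\<in>carrier (transport j E). \<forall>r\<in>I. g r = r \<odot>\<^bsub>transport j E\<^esub> e"
    using e(1) by (intro bexI[of _ "j e"]) auto
qed

text \<open>The hull is \<open>\<rat>\<^sup>(\<^sup>A\<^sup>) / K\<close>, where \<open>A = \<int>\<^sup>(\<^sup>A\<^sup>) / K\<close>.\<close>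

lemma divisible_hull:
  fixes A :: "(int, 'n) module" and i :: "'n \<Rightarrow> (nat + 'b) set"
  assumes A: "module int_cring A" and i: "inj_on i (carrier A)"
  shows "\<exists>(D :: (int, (nat + 'b) set) module) e.
    baer int_cring D \<and> mod_map int_cring A D e \<and> inj_on e (carrier A)"
proof -
  let ?V = "rat_span (carrier A)" and ?Z = "int_span (carrier A)"
  interpret A: rmodule int_cring A by (rule rmodule.intro) fact
  interpret V: rmodule int_cring ?V by (rule rmodule.intro rat_span_module)+
  note Z = int_span_submodule[of "carrier A"]
  note ZV = subsetD[OF V.submodule_subset[OF Z]]
  interpret Z: rmodule int_cring "?V\<lparr>carrier := ?Z\<rparr>" by (rule rmodule.intro V.submodule_module Z)+
  \<comment> \<open>The integral relations of A. As K consists of integral combinations, passing to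
    rational coefficients before dividing by K identifies no two elements of A.\<close>
  define K where "K = {f \<in> ?Z. int_eval A f = \<zero>\<^bsub>A\<^esub>}"
  have K: "submodule K int_cring ?V"
    using Z.kernel_submodule[OF A int_eval_map[OF A]] V.submodule_subset[OF Z]
    by (auto simp: K_def Z.submodule_alt V.submodule_alt)
  have Vmsub: "msub int_cring ?V f g = (\<lambda>x. f x - g x)" for f g
    by (simp add: msub_def rat_span_simps)
  have Kiff: "K +>\<^bsub>?V\<^esub> f = K +>\<^bsub>?V\<^esub> g \<longleftrightarrow> int_eval A f = int_eval A g" if "f \<in> ?Z" "g \<in> ?Z" for f g
  proof -
    have c: "int_eval A f \<in> carrier A" "int_eval A g \<in> carrier A"
      using mod_map_closed[OF int_eval_map[OF A]] that by auto
    have "int_eval A (msub int_cring ?V f g) = msub int_cring A (int_eval A f) (int_eval A g)"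
      using Z.mod_map_msub[OF int_eval_map[OF A]] that by simp
    moreover have "K +>\<^bsub>?V\<^esub> f = K +>\<^bsub>?V\<^esub> g \<longleftrightarrow> msub int_cring ?V f g \<in> K"
      using that ZV by (intro V.coset_eq_iff[OF K])
    moreover have "msub int_cring ?V f g \<in> ?Z" using that by (rule V.submodule_msub[OF Z])
    ultimately show ?thesis using A.msub_zero_iff[OF c] by (simp add: K_def)
  qed
  define D where "D = quot_mod ?V K"
  have D: "module int_cring D" unfolding D_def by (rule V.quot_module[OF K])
  interpret D: rmodule int_cring D by (rule rmodule.intro) (rule D)
  note p = V.coset_map[OF K, folded D_def]
  have bD: "baer int_cring D"
  proof (rule divisible_baer[OF D])
    fix n :: int and d assume n: "n \<noteq> 0" and "d \<in> carrier D"
    then obtain f where f: "f \<in> carrier ?V" "d = K +>\<^bsub>?V\<^esub> f" by (auto simp: D_def quot_carrier)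
    let ?g = "\<lambda>x. (1 / of_int n) * f x"
    have g: "?g \<in> carrier ?V" by (rule rat_span_mult_closed[OF f(1)])
    have "n \<odot>\<^bsub>?V\<^esub> ?g = f" using n by (simp add: rat_span_simps)
    then have "n \<odot>\<^bsub>D\<^esub> (K +>\<^bsub>?V\<^esub> ?g) = d" using mod_map_smult[OF p _ g, of n] f(2) by simp
    then show "\<exists>e\<in>carrier D. n \<odot>\<^bsub>D\<^esub> e = d" using mod_map_closed[OF p g] by blast
  qed
  define \<delta> :: "'n \<Rightarrow> 'n \<Rightarrow> rat" where "\<delta> x = (\<lambda>y. if y = x then 1 else 0)" for x
  have \<delta>: "\<delta> x \<in> ?Z" if "x \<in> carrier A" for x
    using that by (auto simp: \<delta>_def int_span_def rat_span_simps)
  have ev\<delta>: "int_eval A (\<delta> x) = x" if "x \<in> carrier A" for x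
  proof -
    have "{y. \<delta> x y \<noteq> 0} = {x}" by (auto simp: \<delta>_def)
    then have "int_eval A (\<delta> x) = finsum A (\<lambda>y. \<lfloor>\<delta> x y\<rfloor> \<odot>\<^bsub>A\<^esub> y) {x}" by (simp add: int_eval_def)
    also have "\<dots> = 1 \<odot>\<^bsub>A\<^esub> x" using that by (simp add: \<delta>_def)
    also have "\<dots> = x" using A.smult_one[OF that] by simp
    finally show ?thesis .
  qed
  \<comment> \<open>Additive because \<delta>(x + y) and \<delta> x + \<delta> y have the same value
    under \<open>int_eval\<close>, hence the same class modulo K.\<close>
  let ?e = "\<lambda>x. K +>\<^bsub>?V\<^esub> \<delta> x"
  have e: "mod_map int_cring A D ?e"
  proof (rule mod_mapI)
    show "?e x \<in> carrier D" if "x \<in> carrier A" for x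
      using mod_map_closed[OF p ZV[OF \<delta>[OF that]]] .
  next
    fix x y assume xy: "x \<in> carrier A" "y \<in> carrier A"
    have "?e (x \<oplus>\<^bsub>A\<^esub> y) = K +>\<^bsub>?V\<^esub> (\<delta> x \<oplus>\<^bsub>?V\<^esub> \<delta> y)"
      using xy \<delta> ev\<delta> V.submodule_add[OF Z] mod_map_add[OF int_eval_map[OF A], of "\<delta> x" "\<delta> y"]
      by (subst Kiff) auto
    then show "?e (x \<oplus>\<^bsub>A\<^esub> y) = ?e x \<oplus>\<^bsub>D\<^esub> ?e y"
      using mod_map_add[OF p] xy ZV \<delta> by simp
  next
    fix k x assume x: "x \<in> carrier A"
    have "?e (k \<odot>\<^bsub>A\<^esub> x) = K +>\<^bsub>?V\<^esub> (k \<odot>\<^bsub>?V\<^esub> \<delta> x)"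
      using x \<delta> ev\<delta> V.submodule_smult[OF Z] mod_map_smult[OF int_eval_map[OF A], of k "\<delta> x"]
      by (subst Kiff) auto
    then show "?e (k \<odot>\<^bsub>A\<^esub> x) = k \<odot>\<^bsub>D\<^esub> ?e x"
      using mod_map_smult[OF p] x ZV \<delta> by simp
  qed
  have einj: "inj_on ?e (carrier A)"
    by (rule inj_onI) (use Kiff \<delta> ev\<delta> in metis)
  obtain enc :: "(nat + 'b) set list \<Rightarrow> (nat + 'b) set" where enc: "inj enc"
    using inj_set_lists by blast
  \<comment> \<open>Size control for D: a class is coded by a chosen representative, this by a list
    of its nonzero coefficients, and each list entry by the code \<open>i\<close> of the basis
    element together with the number of a rational.\<close>
  define rep where "rep C = (SOME f. f \<in> carrier ?V \<and> C = K +>\<^bsub>?V\<^esub> f)" for C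
  have rep: "rep C \<in> carrier ?V \<and> C = K +>\<^bsub>?V\<^esub> rep C" if "C \<in> carrier D" for C
  proof -
    have "\<exists>f. f \<in> carrier ?V \<and> C = K +>\<^bsub>?V\<^esub> f" using that by (auto simp: D_def quot_carrier)
    then show ?thesis unfolding rep_def by (rule someI_ex)
  qed
  define graph where "graph f = (SOME xs. set xs = (\<lambda>x. (x, f x :: rat)) ` {x. f x \<noteq> 0})" for f :: "'n \<Rightarrow> rat"
  have graph: "set (graph f) = (\<lambda>x. (x, f x)) ` {x. f x \<noteq> 0}" if "f \<in> carrier ?V" for f
  proof -
    have "\<exists>xs. set xs = (\<lambda>x. (x, f x)) ` {x. f x \<noteq> 0}"
      using that by (intro finite_list) (simp add: rat_span_simps)
    then show ?thesis unfolding graph_def by (rule someI_ex)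
  qed
  define code where "code p = enc [i (fst p), {Inl (to_nat (snd p))}]" for p :: "'n \<times> rat"
  have code: "inj_on code (carrier A \<times> UNIV)"
    using inj_onD[OF i] by (auto simp: inj_on_def code_def inj_eq[OF enc])
  define j where "j C = enc (map code (graph (rep C)))" for C
  have j: "inj_on j (carrier D)"
  proof (rule inj_onI)
    fix C C' assume C: "C \<in> carrier D" "C' \<in> carrier D" "j C = j C'"
    have sub: "set (graph (rep C)) \<union> set (graph (rep C')) \<subseteq> carrier A \<times> UNIV"
      using graph rep C by (auto simp: rat_span_simps)
    have "map code (graph (rep C)) = map code (graph (rep C'))"
      using C enc by (simp add: j_def inj_eq)
    then have "graph (rep C) = graph (rep C')"
      by (rule map_inj_on[OF _ inj_on_subset[OF code sub]])
    then have "set (graph (rep C)) = set (graph (rep C'))" by simp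
    then have eq: "(\<lambda>x. (x, rep C x)) ` {x. rep C x \<noteq> 0} = (\<lambda>x. (x, rep C' x)) ` {x. rep C' x \<noteq> 0}"
      unfolding graph[OF conjunct1[OF rep[OF C(1)]]] graph[OF conjunct1[OF rep[OF C(2)]]] .
    have g1: "rep C x = rep C' x" if "rep C x \<noteq> 0" for x
    proof -
      have "(x, rep C x) \<in> (\<lambda>x. (x, rep C x)) ` {x. rep C x \<noteq> 0}" using that by blast
      then show ?thesis unfolding eq by auto
    qed
    have g2: "rep C x = rep C' x" if "rep C' x \<noteq> 0" for x
    proof -
      have "(x, rep C' x) \<in> (\<lambda>x. (x, rep C' x)) ` {x. rep C' x \<noteq> 0}" using that by blast
      then show ?thesis unfolding eq[symmetric] by auto
    qed
    have "rep C x = rep C' x" for x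
      using g1[of x] g2[of x] by argo
    then have "rep C = rep C'" by blast
    then show "C = C'" using rep[OF C(1)] rep[OF C(2)] by simp
  qed
  have "mod_map int_cring A (transport j D) (\<lambda>x. j (?e x))"
    by (rule mod_map_comp[OF e transport_map[OF j]])
  moreover have "inj_on (\<lambda>x. j (?e x)) (carrier A)"
    using comp_inj_on[OF einj inj_on_subset[OF j]] mod_map_closed[OF e] by (auto simp: o_def)
  ultimately show ?thesis using transport_baer[OF bD j] by blast
qed

section \<open>Existence of injective resolutions\<close>

text \<open>Restriction of scalars along the unique ring homomorphism from the integers\<close>

definition int_restrict :: "('a, 'r) ring_scheme \<Rightarrow> ('a, 'm) module \<Rightarrow> (int, 'm) module"
  where "int_restrict R M =
    \<lparr>carrier = carrier M, monoid.mult = undefined, monoid.one = undefined,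
     ring.zero = \<zero>\<^bsub>M\<^esub>, ring.add = ring.add M,
     module.smult = (\<lambda>k x. (add_pow R k \<one>\<^bsub>R\<^esub>) \<odot>\<^bsub>M\<^esub> x)\<rparr>"

lemma int_restrict_simps [simp]:
  "carrier (int_restrict R M) = carrier M" "\<zero>\<^bsub>int_restrict R M\<^esub> = \<zero>\<^bsub>M\<^esub>"
  "x \<oplus>\<^bsub>int_restrict R M\<^esub> y = x \<oplus>\<^bsub>M\<^esub> y"
  "k \<odot>\<^bsub>int_restrict R M\<^esub> x = (add_pow R k \<one>\<^bsub>R\<^esub>) \<odot>\<^bsub>M\<^esub> x"
  by (simp_all add: int_restrict_def)

lemma (in ring) int_embed:
  shows "add_pow R (k::int) \<one> \<in> carrier R" "add_pow R (0::int) \<one> = \<zero>" "add_pow R (1::int) \<one> = \<one>"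
    "add_pow R (k + l) \<one> = add_pow R k \<one> \<oplus> add_pow R l \<one>"
    "add_pow R (k * l) \<one> = add_pow R k \<one> \<otimes> add_pow R l \<one>"
proof -
  show "add_pow R k \<one> \<in> carrier R" for k :: int by simp
  show "add_pow R (0::int) \<one> = \<zero>" by (simp add: add_pow_def)
  show "add_pow R (1::int) \<one> = \<one>" by (simp add: add.int_pow_1)
  show "add_pow R (k + l) \<one> = add_pow R k \<one> \<oplus> add_pow R l \<one>"
    by (simp add: add.int_pow_mult)
  have "add_pow R k \<one> \<otimes> add_pow R l \<one> = add_pow R k (add_pow R l \<one>)"
    using add_pow_ldistr_int[of \<one> "add_pow R l \<one>" k] by simp
  then show "add_pow R (k * l) \<one> = add_pow R k \<one> \<otimes> add_pow R l \<one>"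
    by (simp add: add.int_pow_pow mult.commute)
qed

lemma int_restrict_module:
  assumes "module R M" shows "module int_cring (int_restrict R M)"
proof -
  interpret rmodule R M by (rule rmodule.intro) fact
  show ?thesis
    by (rule moduleI') (auto simp: int_cring R.int_embed smult_l_distr smult_r_distr smult_assoc1 M.a_ac)
qed

lemma int_restrict_map:
  assumes "module R M" "mod_map R M N f"
  shows "mod_map int_cring (int_restrict R M) (int_restrict R N) f"
proof -
  interpret rmodule R M by (rule rmodule.intro) fact
  show ?thesis using assms(2) R.int_embed(1) by (simp add: mod_map_def)
qed

section \<open>Coinduced modules and embeddings into injective modules\<close>

definition coinduced :: "('a, 'r) ring_scheme \<Rightarrow> (int, 'd) module \<Rightarrow> ('a, 'a \<Rightarrow> 'd) module"
  where "coinduced R D = (let H = Hom_mod int_cring (int_restrict R (regular_module R)) D in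
    \<lparr>carrier = carrier H, monoid.mult = undefined, monoid.one = undefined,
     ring.zero = \<zero>\<^bsub>H\<^esub>, ring.add = ring.add H,
     module.smult = (\<lambda>r f. \<lambda>s\<in>carrier R. f (s \<otimes>\<^bsub>R\<^esub> r))\<rparr>)"

lemma coinduced_simps:
  "carrier (coinduced R D) = mod_hom int_cring (int_restrict R (regular_module R)) D"
  "\<zero>\<^bsub>coinduced R D\<^esub> = (\<lambda>s\<in>carrier R. \<zero>\<^bsub>D\<^esub>)"
  "f \<oplus>\<^bsub>coinduced R D\<^esub> g = (\<lambda>s\<in>carrier R. f s \<oplus>\<^bsub>D\<^esub> g s)"
  "r \<odot>\<^bsub>coinduced R D\<^esub> f = (\<lambda>s\<in>carrier R. f (s \<otimes>\<^bsub>R\<^esub> r))"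
  by (simp_all add: coinduced_def Let_def Hom_simps)

lemma coinduced_module:
  assumes R: "cring R" and D: "module int_cring D"
  shows "module R (coinduced R D)"
proof -
  interpret R: cring R by fact
  interpret D: rmodule int_cring D by (rule rmodule.intro) fact
  have L: "module int_cring (int_restrict R (regular_module R))"
    by (rule int_restrict_module[OF regular_module[OF R]])
  have H: "module int_cring (Hom_mod int_cring (int_restrict R (regular_module R)) D)"
    by (rule Hom_module[OF L D])
  interpret H: rmodule int_cring "Hom_mod int_cring (int_restrict R (regular_module R)) D"
    by (rule rmodule.intro) (rule H)
  let ?C = "coinduced R D"
  have eqI: "f = g" if "f \<in> carrier ?C" "g \<in> carrier ?C" "\<And>s. s \<in> carrier R \<Longrightarrow> f s = g s" for f g
    using mod_hom_eqI[of f int_cring "int_restrict R (regular_module R)" D g] that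
    by (simp add: coinduced_simps)
  have cl: "f s \<in> carrier D" if "f \<in> carrier ?C" "s \<in> carrier R" for f s
    using mod_map_closed[OF mod_hom_map, of f int_cring "int_restrict R (regular_module R)" D s] that
    by (simp add: coinduced_simps)
  have ad: "f (s \<oplus>\<^bsub>R\<^esub> t) = f s \<oplus>\<^bsub>D\<^esub> f t" if "f \<in> carrier ?C" "s \<in> carrier R" "t \<in> carrier R" for f s t
    using mod_map_add[OF mod_hom_map, of f int_cring "int_restrict R (regular_module R)" D s t] that
    by (simp add: coinduced_simps)
  have z: "f \<zero>\<^bsub>R\<^esub> = \<zero>\<^bsub>D\<^esub>" if "f \<in> carrier ?C" for f
    using module.axioms rmodule.mod_map_zero[OF rmodule.intro[OF L] D mod_hom_map, of f] that
    by (simp add: coinduced_simps)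
  have zC: "\<zero>\<^bsub>?C\<^esub> \<in> carrier ?C" using H.M.zero_closed by (simp add: coinduced_simps Hom_simps)
  have aC: "f \<oplus>\<^bsub>?C\<^esub> g \<in> carrier ?C" if "f \<in> carrier ?C" "g \<in> carrier ?C" for f g
    using H.M.a_closed[of f g] that by (simp add: coinduced_simps Hom_simps)
  have sC: "r \<odot>\<^bsub>?C\<^esub> f \<in> carrier ?C" if r: "r \<in> carrier R" and f: "f \<in> carrier ?C" for r f
  proof -
    have "mod_map R (regular_module R) (regular_module R) (\<lambda>s. s \<otimes>\<^bsub>R\<^esub> r)"
      using r by (auto simp: mod_map_def R.l_distr R.m_assoc)
    from int_restrict_map[OF regular_module[OF R] this]
    have "mod_map int_cring (int_restrict R (regular_module R)) D (\<lambda>s. f (s \<otimes>\<^bsub>R\<^esub> r))"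
      by (rule mod_map_comp) (use f in \<open>simp add: coinduced_simps mod_hom_map\<close>)
    from restrict_mod_hom[OF L this] show ?thesis by (simp add: coinduced_simps)
  qed
  show ?thesis
  proof (rule moduleI'[OF R zC aC sC])
    show "(f \<oplus>\<^bsub>?C\<^esub> g) \<oplus>\<^bsub>?C\<^esub> h = f \<oplus>\<^bsub>?C\<^esub> (g \<oplus>\<^bsub>?C\<^esub> h)"
      if "f \<in> carrier ?C" "g \<in> carrier ?C" "h \<in> carrier ?C" for f g h
      by (rule eqI, (intro aC zC sC that R.a_closed R.m_closed R.one_closed R.zero_closed)+,
        use that cl ad z in \<open>simp add: coinduced_simps(3) D.M.a_assoc\<close>)
    show "f \<oplus>\<^bsub>?C\<^esub> g = g \<oplus>\<^bsub>?C\<^esub> f" if "f \<in> carrier ?C" "g \<in> carrier ?C" for f g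
      by (rule eqI, (intro aC zC sC that R.a_closed R.m_closed R.one_closed R.zero_closed)+,
        use that cl ad z in \<open>simp add: coinduced_simps(3) D.M.a_comm\<close>)
    show "\<zero>\<^bsub>?C\<^esub> \<oplus>\<^bsub>?C\<^esub> f = f" if "f \<in> carrier ?C" for f
      by (rule eqI, (intro aC zC sC that R.a_closed R.m_closed R.one_closed R.zero_closed)+,
        use that cl ad z in \<open>simp add: coinduced_simps(2,3)\<close>)
    show "(a \<oplus>\<^bsub>R\<^esub> b) \<odot>\<^bsub>?C\<^esub> f = a \<odot>\<^bsub>?C\<^esub> f \<oplus>\<^bsub>?C\<^esub> b \<odot>\<^bsub>?C\<^esub> f"
      if "a \<in> carrier R" "b \<in> carrier R" "f \<in> carrier ?C" for a b f
      by (rule eqI, (intro aC zC sC that R.a_closed R.m_closed R.one_closed R.zero_closed)+,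
        use that cl ad z in \<open>simp add: coinduced_simps(3,4) R.r_distr\<close>)
    show "a \<odot>\<^bsub>?C\<^esub> (f \<oplus>\<^bsub>?C\<^esub> g) = a \<odot>\<^bsub>?C\<^esub> f \<oplus>\<^bsub>?C\<^esub> a \<odot>\<^bsub>?C\<^esub> g"
      if "a \<in> carrier R" "f \<in> carrier ?C" "g \<in> carrier ?C" for a f g
      by (rule eqI, (intro aC zC sC that R.a_closed R.m_closed R.one_closed R.zero_closed)+,
        use that cl ad z in \<open>simp add: coinduced_simps(3,4)\<close>)
    show "(a \<otimes>\<^bsub>R\<^esub> b) \<odot>\<^bsub>?C\<^esub> f = a \<odot>\<^bsub>?C\<^esub> (b \<odot>\<^bsub>?C\<^esub> f)"
      if "a \<in> carrier R" "b \<in> carrier R" "f \<in> carrier ?C" for a b f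
      by (rule eqI, (intro aC zC sC that R.a_closed R.m_closed R.one_closed R.zero_closed)+,
        use that cl ad z in \<open>simp add: coinduced_simps(4) R.m_assoc\<close>)
    show "\<one>\<^bsub>R\<^esub> \<odot>\<^bsub>?C\<^esub> f = f" if "f \<in> carrier ?C" for f
      by (rule eqI, (intro aC zC sC that R.a_closed R.m_closed R.one_closed R.zero_closed)+,
        use that cl ad z in \<open>simp add: coinduced_simps(4)\<close>)
    show "\<zero>\<^bsub>R\<^esub> \<odot>\<^bsub>?C\<^esub> f = \<zero>\<^bsub>?C\<^esub>" if "f \<in> carrier ?C" for f
      by (rule eqI, (intro aC zC sC that R.a_closed R.m_closed R.one_closed R.zero_closed)+,
        use that cl ad z in \<open>simp add: coinduced_simps(2,4)\<close>)
  qed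
qed

text \<open>Coinduction is right adjoint to restriction of scalars. A linear map g on I corresponds
  to the additive map sending r to \<open>g r\<close> at 1; it extends to R because D is injective
  over the integers, and the extension is the element sought.\<close>

lemma coinduced_baer:
  assumes R: "cring R" and D: "baer int_cring D"
  shows "baer R (coinduced R D)"
  unfolding baer_def
proof (intro conjI allI impI coinduced_module R baer_module[OF D])
  interpret R: cring R by fact
  let ?L = "int_restrict R (regular_module R)"
  have L: "module int_cring ?L" by (rule int_restrict_module[OF regular_module[OF R]])
  interpret L: rmodule int_cring ?L by (rule rmodule.intro) (rule L)
  interpret M: rmodule R "regular_module R" by (rule rmodule.intro) (rule regular_module[OF R])
  fix I g assume *: "submodule I R (regular_module R) \<and>
    mod_map R (regular_module R\<lparr>carrier := I\<rparr>) (coinduced R D) g"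
  then have I: "submodule I R (regular_module R)"
    and g: "mod_map R (regular_module R\<lparr>carrier := I\<rparr>) (coinduced R D) g" by auto
  note IR = subsetD[OF M.submodule_subset[OF I]]
  have gI: "g r \<in> mod_hom int_cring ?L D" if "r \<in> I" for r
    using mod_map_closed[OF g] that by (simp add: coinduced_simps)
  have gs: "g r s = g (s \<otimes>\<^bsub>R\<^esub> r) \<one>\<^bsub>R\<^esub>" if "r \<in> I" "s \<in> carrier R" for r s
    using mod_map_smult[OF g that(2), of r] that by (simp add: coinduced_simps)
  have I': "submodule I int_cring ?L"
    using I R.int_embed(1) by (simp add: L.submodule_alt M.submodule_alt)
  have "mod_map int_cring (?L\<lparr>carrier := I\<rparr>) D (\<lambda>r. g r \<one>\<^bsub>R\<^esub>)"
  proof (rule mod_mapI; simp)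
    show "g r \<one>\<^bsub>R\<^esub> \<in> carrier D" if "r \<in> I" for r
      using mod_map_closed[OF mod_hom_map[OF gI[OF that]]] by simp
    show "g (r \<oplus>\<^bsub>R\<^esub> s) \<one>\<^bsub>R\<^esub> = g r \<one>\<^bsub>R\<^esub> \<oplus>\<^bsub>D\<^esub> g s \<one>\<^bsub>R\<^esub>" if "r \<in> I" "s \<in> I" for r s
      using mod_map_add[OF g] that by (simp add: coinduced_simps)
    show "g (add_pow R k \<one>\<^bsub>R\<^esub> \<otimes>\<^bsub>R\<^esub> r) \<one>\<^bsub>R\<^esub> = k \<odot>\<^bsub>D\<^esub> g r \<one>\<^bsub>R\<^esub>" if "r \<in> I" for k r
      using gs[OF that, of "add_pow R k \<one>\<^bsub>R\<^esub>"] mod_map_smult[OF mod_hom_map[OF gI[OF that]], of k "\<one>\<^bsub>R\<^esub>"]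
        R.int_embed(1) by simp
  qed
  from baer_extend[OF D L I' this] obtain h where h: "mod_map int_cring ?L D h"
    "\<And>r. r \<in> I \<Longrightarrow> h r = g r \<one>\<^bsub>R\<^esub>" by blast
  let ?h = "restrict h (carrier R)"
  have hC: "?h \<in> carrier (coinduced R D)"
    using restrict_mod_hom[OF L h(1)] by (simp add: coinduced_simps)
  have "g r = r \<odot>\<^bsub>coinduced R D\<^esub> ?h" if r: "r \<in> I" for r
  proof (rule mod_hom_eqI[OF gI[OF r]])
    have rR: "r \<in> carrier R" using IR[OF r] by simp
    show "r \<odot>\<^bsub>coinduced R D\<^esub> ?h \<in> mod_hom int_cring ?L D"
      using module.smult_closed[OF coinduced_module[OF R baer_module[OF D]] rR hC]
      by (simp add: coinduced_simps)
    fix s assume "s \<in> carrier ?L"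
    then have s: "s \<in> carrier R" by simp
    have "s \<otimes>\<^bsub>R\<^esub> r \<in> I" using M.submodule_smult[OF I s r] by simp
    then show "g r s = (r \<odot>\<^bsub>coinduced R D\<^esub> ?h) s"
      using gs[OF r s] h(2) s rR by (simp add: coinduced_simps)
  qed
  with hC show "\<exists>e\<in>carrier (coinduced R D). \<forall>r\<in>I. g r = r \<odot>\<^bsub>coinduced R D\<^esub> e" by blast
qed

text \<open>N may live over any type, as long as its carrier injects into \<open>large\<close>. This
  freedom is used when N is a quotient, whose elements are cosets.\<close>

lemma injective_embedding:
  fixes N :: "('a, 'n) module" and j :: "'n \<Rightarrow> ('a, 'x) large"
  assumes N: "module R N" and j: "inj_on j (carrier N)"
  shows "\<exists>(E :: ('a, ('a, 'x) large) module) e.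
    injective_module R E \<and> mod_map R N E e \<and> inj_on e (carrier N)"
proof -
  have R: "cring R" by (rule module_cring[OF N])
  interpret N: rmodule R N by (rule rmodule.intro) fact
  obtain D :: "(int, ('a, 'x) large) module" and \<epsilon> where D: "baer int_cring D"
    and \<epsilon>: "mod_map int_cring (int_restrict R N) D \<epsilon>" "inj_on \<epsilon> (carrier N)"
    using divisible_hull[OF int_restrict_module[OF N], of j] j by auto
  let ?L = "int_restrict R (regular_module R)" and ?C = "coinduced R D"
  have L: "module int_cring ?L" by (rule int_restrict_module[OF regular_module[OF R]])
  \<comment> \<open>The adjoint of the additive embedding \<epsilon>. Evaluation at 1 returns
    \<open>\<epsilon> x\<close>, hence injectivity.\<close>
  define h where "h x = (\<lambda>s\<in>carrier R. \<epsilon> (s \<odot>\<^bsub>N\<^esub> x))" for x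
  have hC: "h x \<in> carrier ?C" if x: "x \<in> carrier N" for x
  proof -
    have "mod_map R (regular_module R) N (\<lambda>s. s \<odot>\<^bsub>N\<^esub> x)"
      using x by (auto simp: mod_map_def N.smult_l_distr N.smult_assoc1)
    from restrict_mod_hom[OF L mod_map_comp[OF int_restrict_map[OF regular_module[OF R] this] \<epsilon>(1)]]
    show ?thesis by (simp add: coinduced_simps h_def)
  qed
  have C: "module R ?C" by (rule coinduced_module[OF R baer_module[OF D]])
  interpret C: rmodule R ?C by (rule rmodule.intro) (rule C)
  have h: "mod_map R N ?C h"
  proof (rule mod_mapI[OF hC])
    show "h (x \<oplus>\<^bsub>N\<^esub> y) = h x \<oplus>\<^bsub>?C\<^esub> h y" if "x \<in> carrier N" "y \<in> carrier N" for x y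
      using that mod_map_add[OF \<epsilon>(1)] by (auto simp: h_def coinduced_simps N.smult_r_distr fun_eq_iff)
    show "h (r \<odot>\<^bsub>N\<^esub> x) = r \<odot>\<^bsub>?C\<^esub> h x" if "r \<in> carrier R" "x \<in> carrier N" for r x
      using that by (auto simp: h_def coinduced_simps N.smult_assoc1 fun_eq_iff)
  qed
  have hinj: "inj_on h (carrier N)"
  proof (rule inj_onI)
    fix x y assume xy: "x \<in> carrier N" "y \<in> carrier N" "h x = h y"
    then have "h x \<one>\<^bsub>R\<^esub> = h y \<one>\<^bsub>R\<^esub>" by simp
    then have "\<epsilon> x = \<epsilon> y" using xy by (simp add: h_def)
    then show "x = y" using inj_onD[OF \<epsilon>(2)] xy by blast
  qed
  obtain k :: "(nat + 'a + 'x) \<times> (nat + 'a + 'x) \<Rightarrow> nat + 'a + 'x" where k: "inj k"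
    using inj_prod_infinite[OF infinite_sum] by blast
  \<comment> \<open>A set-valued function is coded as the set of pairs of an argument and a member
    of its value, and k codes the pairs; so Hom(R, D) fits into \<open>large\<close>.\<close>
  define \<iota> :: "('a \<Rightarrow> ('a, 'x) large) \<Rightarrow> ('a, 'x) large"
    where "\<iota> f = {k (Inr (Inl a), w) | a w. w \<in> f a}" for f
  have "inj \<iota>"
  proof (rule injI)
    fix f g assume eq: "\<iota> f = \<iota> g"
    have mem: "w \<in> f a \<longleftrightarrow> k (Inr (Inl a), w) \<in> \<iota> f" for f a w
      by (auto simp: \<iota>_def inj_eq[OF k])
    show "f = g" using mem[of _ f] mem[of _ g] eq by blast
  qed
  then have \<iota>: "inj_on \<iota> (carrier ?C)" by (rule inj_on_subset) simp
  have "injective_module R (transport \<iota> ?C)"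
    by (intro baer_imp_injective_module transport_baer coinduced_baer R D \<iota>)
  moreover have "mod_map R N (transport \<iota> ?C) (\<lambda>x. \<iota> (h x))"
    by (rule mod_map_comp[OF h transport_map[OF \<iota>]])
  moreover have "inj_on (\<lambda>x. \<iota> (h x)) (carrier N)"
    using comp_inj_on[OF hinj inj_on_subset[OF \<iota>]] hC by (auto simp: o_def)
  ultimately show ?thesis by blast
qed

text \<open>An embedding of E / S into an injective module gives a map with kernel exactly S. In a
  resolution S is the image of the preceding map.\<close>

lemma injective_resolution_step:
  fixes E :: "('a, ('a, 'x) large) module"
  assumes E: "module R E" and S: "submodule S R E"
  shows "\<exists>(E' :: ('a, ('a, 'x) large) module) d.
    injective_module R E' \<and> d \<in> mod_hom R E E' \<and> a_kernel E E' d = S"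
proof -
  interpret E: rmodule R E by (rule rmodule.intro) fact
  have Q: "module R (quot_mod E S)" by (rule E.quot_module[OF S])
  interpret Q: rmodule R "quot_mod E S" by (rule rmodule.intro) (rule Q)
  \<comment> \<open>A coset is coded by a representative in E, so E / S needs no larger type than
    E.\<close>
  define j where "j C = inv_into (carrier E) (\<lambda>x. S +>\<^bsub>E\<^esub> x) C" for C
  have "inj_on j (carrier (quot_mod E S))"
    unfolding j_def quot_carrier by (rule inj_on_inv_into) simp
  from injective_embedding[OF Q this] obtain E' :: "('a, ('a, 'x) large) module" and e
    where E': "injective_module R E'" and e: "mod_map R (quot_mod E S) E' e"
      "inj_on e (carrier (quot_mod E S))" by blast
  have E'm: "module R E'" using E' by (simp add: injective_module_def)
  let ?d = "\<lambda>x. e (S +>\<^bsub>E\<^esub> x)"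
  have d: "mod_map R E E' ?d" by (rule mod_map_comp[OF E.coset_map[OF S] e(1)])
  have "?d x = \<zero>\<^bsub>E'\<^esub> \<longleftrightarrow> x \<in> S" if x: "x \<in> carrier E" for x
  proof -
    have "?d x = \<zero>\<^bsub>E'\<^esub> \<longleftrightarrow> e (S +>\<^bsub>E\<^esub> x) = e \<zero>\<^bsub>quot_mod E S\<^esub>"
      using Q.mod_map_zero[OF E'm e(1)] by simp
    also have "\<dots> \<longleftrightarrow> S +>\<^bsub>E\<^esub> x = \<zero>\<^bsub>quot_mod E S\<^esub>"
      using inj_on_eq_iff[OF e(2)] mod_map_closed[OF E.coset_map[OF S] x] Q.M.zero_closed by blast
    finally show ?thesis using E.coset_zero_iff[OF S x] by simp
  qed
  then have "a_kernel E E' (restrict ?d (carrier E)) = S"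
    using E.submodule_subset[OF S] by (auto simp: a_kernel_eq)
  then show ?thesis using E' restrict_mod_hom[OF E d] by blast
qed

lemma injective_resolution_exists:
  fixes Y :: "('a, 'x) module"
  assumes Y: "module R Y"
  shows "\<exists>(E :: nat \<Rightarrow> ('a, ('a, 'x) large) module) d aug. injective_resolution R Y E d aug"
proof -
  interpret Y: rmodule R Y by (rule rmodule.intro) fact
  have "inj_on (\<lambda>y :: 'x. {Inr (Inr y)} :: ('a, 'x) large) (carrier Y)" by (simp add: inj_on_def)
  from injective_embedding[OF Y this] obtain E0 :: "('a, ('a, 'x) large) module" and aug
    where E0: "injective_module R E0" and aug: "mod_map R Y E0 aug" "inj_on aug (carrier Y)" by blast
  \<comment> \<open>The state of the recursion pairs the current term with the submodule that the
    next differential must have as its kernel; the clause for n = 0 pins down the start.\<close>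
  define P where "P n x \<longleftrightarrow> injective_module R (fst x) \<and> submodule (snd x) R (fst x) \<and>
      (n = 0 \<longrightarrow> x = (E0, aug ` carrier Y))"
    for n :: nat and x :: "('a, ('a, 'x) large) module \<times> ('a, 'x) large set"
  define Q where "Q x y d \<longleftrightarrow> d \<in> mod_hom R (fst x) (fst y) \<and> a_kernel (fst x) (fst y) d = snd x \<and>
      snd y = d ` carrier (fst x)"
    for x y :: "('a, ('a, 'x) large) module \<times> ('a, 'x) large set" and d
  have "\<exists>f. \<forall>n. P n (f n) \<and> (\<exists>d. Q (f n) (f (Suc n)) d)"
  proof (rule dependent_nat_choice)
    have "submodule (aug ` carrier Y) R E0"
      using E0 aug by (intro Y.image_submodule) (simp_all add: injective_module_def)
    then show "\<exists>x. P 0 x" using E0 by (auto simp: P_def)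
  next
    fix x n assume P: "P n x"
    have E: "module R (fst x)" and S: "submodule (snd x) R (fst x)"
      using P by (auto simp: P_def injective_module_def)
    interpret E: rmodule R "fst x" by (rule rmodule.intro) (rule E)
    from injective_resolution_step[OF E S] obtain E' :: "('a, ('a, 'x) large) module" and d
      where E': "injective_module R E'" "d \<in> mod_hom R (fst x) E'" "a_kernel (fst x) E' d = snd x"
      by blast
    have "submodule (d ` carrier (fst x)) R E'"
      using E' by (intro E.image_submodule) (simp_all add: injective_module_def mod_hom_map)
    then show "\<exists>y. P (Suc n) y \<and> (\<exists>d. Q x y d)"
      using E' by (intro exI[of _ "(E', d ` carrier (fst x))"]) (auto simp: P_def Q_def)
  qed
  then obtain f where f: "\<And>n. P n (f n)" "\<forall>n. \<exists>d. Q (f n) (f (Suc n)) d" by blast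
  from choice[OF f(2)] obtain d where d: "\<And>n. Q (f n) (f (Suc n)) (d n)" by blast
  have f0: "f 0 = (E0, aug ` carrier Y)" using f(1)[of 0] by (simp add: P_def)
  have "injective_resolution R Y (\<lambda>n. fst (f n)) d (restrict aug (carrier Y))"
    unfolding injective_resolution_def
  proof (intro conjI allI)
    show "injective_module R (fst (f n))" for n using f(1) by (simp add: P_def)
    show "d n \<in> mod_hom R (fst (f n)) (fst (f (Suc n)))" for n using d by (simp add: Q_def)
    show "restrict aug (carrier Y) \<in> mod_hom R Y (fst (f 0))"
      using restrict_mod_hom[OF Y aug(1)] by (simp add: f0)
    show "inj_on (restrict aug (carrier Y)) (carrier Y)" using aug(2) by (simp add: inj_on_def)
    show "restrict aug (carrier Y) ` carrier Y = a_kernel (fst (f 0)) (fst (f 1)) (d 0)"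
      using d[of 0] by (simp add: Q_def f0)
    show "d n ` carrier (fst (f n)) = a_kernel (fst (f (Suc n))) (fst (f (Suc (Suc n)))) (d (Suc n))" for n
      using d[of n] d[of "Suc n"] by (simp add: Q_def)
  qed
  then show ?thesis by (intro exI)
qed

lemma inj_res_resolution:
  fixes Y :: "('a, 'x) module"
  assumes "module R Y"
  shows "\<exists>aug. injective_resolution R Y (inj_obj R Y) (inj_diff R Y) aug"
proof -
  have "\<exists>p :: (nat \<Rightarrow> ('a, ('a, 'x) large) module) \<times> (nat \<Rightarrow> ('a, 'x) large \<Rightarrow> ('a, 'x) large). case p of (E, d) \<Rightarrow> \<exists>aug. injective_resolution R Y E d aug"
    using injective_resolution_exists[OF assms] by auto
  then have "case inj_res R Y of (E, d) \<Rightarrow> \<exists>aug. injective_resolution R Y E d aug"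
    unfolding inj_res_def by (rule someI_ex)
  then show ?thesis by (simp add: inj_obj_def inj_diff_def split: prod.splits)
qed

section \<open>Powers of ideals in Noetherian rings\<close>

lemma ideal_prod_subset:
  assumes "\<And>x y. x \<in> I \<Longrightarrow> y \<in> J \<Longrightarrow> x \<otimes>\<^bsub>R\<^esub> y \<in> K" "\<And>x y. x \<in> K \<Longrightarrow> y \<in> K \<Longrightarrow> x \<oplus>\<^bsub>R\<^esub> y \<in> K"
  shows "ideal_prod R I J \<subseteq> K"
proof
  fix z assume "z \<in> ideal_prod R I J"
  then show "z \<in> K" by (induction rule: ideal_prod.induct) (use assms in auto)
qed

lemma ideals_set_simps [simp]:
  "\<one>\<^bsub>ideals_set R\<^esub> = carrier R" "I \<otimes>\<^bsub>ideals_set R\<^esub> J = ideal_prod R I J"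
  by (simp_all add: ideals_set_def)

lemma ideal_pow_0: "ideal_pow R I 0 = carrier R"
  by (simp add: nat_pow_def ideals_set_def)

lemma ideal_pow_Suc: "ideal_pow R I (Suc n) = ideal_prod R (ideal_pow R I n) I"
  by (simp add: nat_pow_def ideals_set_def)

context cring begin

lemma ideal_pow_ideal: "ideal I R \<Longrightarrow> ideal (ideal_pow R I n) R"
  by (induction n) (auto simp: ideal_pow_Suc oneideal intro: ideal_prod_is_ideal)

lemma ideal_pow_Suc_subset: "ideal I R \<Longrightarrow> ideal_pow R I (Suc n) \<subseteq> ideal_pow R I n"
  using ideal_prod_inter[OF ideal_pow_ideal, of I I n] by (auto simp: ideal_pow_Suc)

lemma ideal_pow_antimono: "ideal I R \<Longrightarrow> m \<le> n \<Longrightarrow> ideal_pow R I n \<subseteq> ideal_pow R I m"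
  by (rule lift_Suc_antimono_le[of "ideal_pow R I", OF ideal_pow_Suc_subset])

lemma ideal_add_closed: "ideal I R \<Longrightarrow> x \<in> I \<Longrightarrow> y \<in> I \<Longrightarrow> x \<oplus> y \<in> I"
  by (meson additive_subgroup.a_closed ideal.axioms(1))

text \<open>Split the last factor of a product from I + J. A summand from I is treated with the
  claim for (k - 1, l), a summand from J with the claim for (k, l - 1).\<close>

lemma ideal_add_ideal_pow:
  assumes I: "ideal I R" and J: "ideal J R"
  shows "ideal_pow R (I <+>\<^bsub>R\<^esub> J) (k + l) \<subseteq> ideal_pow R I k <+>\<^bsub>R\<^esub> ideal_pow R J l"
proof (induction "k + l" arbitrary: k l rule: less_induct)
  case less
  have idI: "ideal (ideal_pow R I k) R" and idJ: "ideal (ideal_pow R J l) R" for k l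
    using I J by (auto intro: ideal_pow_ideal)
  have idS: "ideal (ideal_pow R I k <+>\<^bsub>R\<^esub> ideal_pow R J l) R" for k l
    by (rule add_ideals[OF idI idJ])
  have incl1: "x \<in> ideal_pow R I k <+>\<^bsub>R\<^esub> ideal_pow R J l" if "x \<in> ideal_pow R I k" for x k l
    using that ideal.Icarr[OF idI that] additive_subgroup.zero_closed[OF ideal.axioms(1)[OF idJ]]
    by (force simp: set_add_def')
  have incl2: "x \<in> ideal_pow R I k <+>\<^bsub>R\<^esub> ideal_pow R J l" if "x \<in> ideal_pow R J l" for x k l
    using that ideal.Icarr[OF idJ that] additive_subgroup.zero_closed[OF ideal.axioms(1)[OF idI]]
    by (force simp: set_add_def')
  show ?case
  proof (cases "k = 0 \<or> l = 0")
    case True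
    have "x \<in> ideal_pow R I k <+>\<^bsub>R\<^esub> ideal_pow R J l"
      if "x \<in> ideal_pow R (I <+>\<^bsub>R\<^esub> J) (k + l)" for x
    proof -
      have "x \<in> carrier R" by (rule ideal.Icarr[OF ideal_pow_ideal[OF add_ideals[OF I J]] that])
      then show ?thesis using True incl1[of x k l] incl2[of x l k] ideal_pow_0[of R] by metis
    qed
    then show ?thesis by blast
  next
    case False
    then obtain k' l' where kl: "k = Suc k'" "l = Suc l'" by (auto simp: gr0_conv_Suc)
    define m where "m = k' + l"
    have m: "k + l = Suc m" "m = k + l'" by (simp_all add: kl m_def)
    have xy: "x \<otimes> y \<in> ideal_pow R I k <+>\<^bsub>R\<^esub> ideal_pow R J l"
      if x: "x \<in> ideal_pow R (I <+>\<^bsub>R\<^esub> J) m" and y: "y \<in> I <+>\<^bsub>R\<^esub> J" for x y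
    proof -
      obtain i j where ij: "i \<in> I" "j \<in> J" "y = i \<oplus> j" using y by (auto simp: set_add_def')
      have c: "i \<in> carrier R" "j \<in> carrier R" "x \<in> carrier R"
        using ij ideal.Icarr[OF I] ideal.Icarr[OF J]
          ideal.Icarr[OF ideal_pow_ideal[OF add_ideals[OF I J]] x] by auto
      have "x \<in> ideal_pow R I k' <+>\<^bsub>R\<^esub> ideal_pow R J l" using less[of k' l] x m m_def by auto
      then obtain u v where uv: "u \<in> ideal_pow R I k'" "v \<in> ideal_pow R J l" "x = u \<oplus> v"
        by (auto simp: set_add_def')
      have "x \<otimes> i = u \<otimes> i \<oplus> v \<otimes> i"
        using uv c ideal.Icarr[OF idI uv(1)] ideal.Icarr[OF idJ uv(2)] by (simp add: l_distr)
      moreover have "u \<otimes> i \<in> ideal_pow R I k"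
        using uv ij by (simp add: kl ideal_pow_Suc ideal_prod.prod)
      moreover have "v \<otimes> i \<in> ideal_pow R J l" using uv c by (intro ideal.I_r_closed[OF idJ])
      ultimately have xi: "x \<otimes> i \<in> ideal_pow R I k <+>\<^bsub>R\<^esub> ideal_pow R J l" by (auto simp: set_add_def')
      have "x \<in> ideal_pow R I k <+>\<^bsub>R\<^esub> ideal_pow R J l'" using less[of k l'] x m by auto
      then obtain s t where st: "s \<in> ideal_pow R I k" "t \<in> ideal_pow R J l'" "x = s \<oplus> t"
        by (auto simp: set_add_def')
      have "x \<otimes> j = s \<otimes> j \<oplus> t \<otimes> j"
        using st c ideal.Icarr[OF idI st(1)] ideal.Icarr[OF idJ st(2)] by (simp add: l_distr)
      moreover have "t \<otimes> j \<in> ideal_pow R J l"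
        using st ij by (simp add: kl ideal_pow_Suc ideal_prod.prod)
      moreover have "s \<otimes> j \<in> ideal_pow R I k" using st c by (intro ideal.I_r_closed[OF idI])
      ultimately have xj: "x \<otimes> j \<in> ideal_pow R I k <+>\<^bsub>R\<^esub> ideal_pow R J l" by (auto simp: set_add_def')
      show ?thesis using ideal_add_closed[OF idS xi xj] c by (simp add: ij r_distr)
    qed
    have "ideal_prod R (ideal_pow R (I <+>\<^bsub>R\<^esub> J) m) (I <+>\<^bsub>R\<^esub> J) \<subseteq> ideal_pow R I k <+>\<^bsub>R\<^esub> ideal_pow R J l"
      by (rule ideal_prod_subset[OF xy ideal_add_closed[OF idS]])
    then show ?thesis by (simp add: m(1))
  qed
qed

lemma principal_pow_subset:
  assumes x: "x \<in> carrier R" and Q: "ideal Q R" and xQ: "x [^] (n::nat) \<in> Q"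
  shows "ideal_pow R (PIdl x) n \<subseteq> Q"
proof -
  have "ideal_pow R (PIdl x) n \<subseteq> PIdl (x [^] n)" for n :: nat
  proof (induction n)
    case 0 show ?case by (force simp: cgenideal_def)
  next
    case (Suc n)
    have id: "ideal (PIdl (x [^] Suc n)) R" using x by (intro cgenideal_ideal) auto
    show ?case
      unfolding ideal_pow_Suc
    proof (rule ideal_prod_subset)
      fix y z assume "y \<in> ideal_pow R (PIdl x) n" "z \<in> PIdl x"
      then obtain r s where "r \<in> carrier R" "y = r \<otimes> x [^] n" "s \<in> carrier R" "z = s \<otimes> x"
        using Suc by (auto simp: cgenideal_def)
      then have "y \<otimes> z = (r \<otimes> s) \<otimes> x [^] Suc n" "r \<otimes> s \<in> carrier R"
        using x by (auto simp: m_ac)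
      then show "y \<otimes> z \<in> PIdl (x [^] Suc n)" unfolding cgenideal_def by blast
    qed (rule ideal_add_closed[OF id])
  qed
  also have "PIdl (x [^] n) \<subseteq> Q" using Q xQ by (rule cgenideal_minimal)
  finally show ?thesis .
qed

end

section \<open>Maximal members of families of ideals, and the weak Artin-Rees lemma\<close>

lemma (in noetherian_ring) ideal_maximal:
  assumes "\<S> \<noteq> {}" "\<And>I. I \<in> \<S> \<Longrightarrow> ideal I R"
  shows "\<exists>Q\<in>\<S>. \<forall>I\<in>\<S>. Q \<subseteq> I \<longrightarrow> I = Q"
proof (rule subset_Zorn_nonempty[OF assms(1)])
  fix C assume C: "C \<noteq> {}" "subset.chain \<S> C"
  then have sub: "C \<subseteq> \<S>" by (simp add: pred_on.chain_def)
  then have "C \<subseteq> {I. ideal I R}" using assms(2) by auto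
  then have "subset.chain {I. ideal I R} C" using C(2) by (simp add: pred_on.chain_def)
  from ideal_chain_is_trivial[OF C(1) this] show "\<Union>C \<in> \<S>" using sub by (rule rev_subsetD)
qed

text \<open>A maximal J among the ideals inside I with a power in Q absorbs every x in I: if J^k and
  x^n lie in Q, then so does (J + (x))^(k + n), by \<open>ideal_add_ideal_pow\<close>.\<close>

lemma ideal_pow_subset_if_nil:
  assumes "cring R" "noetherian_ring R" and I: "ideal I R" and Q: "ideal Q R"
    and nil: "\<And>x. x \<in> I \<Longrightarrow> \<exists>n::nat. x [^]\<^bsub>R\<^esub> n \<in> Q"
  shows "\<exists>k. ideal_pow R I k \<subseteq> Q"
proof -
  interpret cring R by fact
  interpret noetherian_ring R by fact
  define S where "S = {J. ideal J R \<and> J \<subseteq> I \<and> (\<exists>k. ideal_pow R J k \<subseteq> Q)}"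
  have "ideal_pow R {\<zero>\<^bsub>R\<^esub>} 1 \<subseteq> Q"
    unfolding One_nat_def ideal_pow_Suc
    by (rule ideal_prod_subset)
      (use Q in \<open>auto intro: ideal_add_closed simp: additive_subgroup.zero_closed[OF ideal.axioms(1)]\<close>)
  then have "\<exists>k. ideal_pow R {\<zero>\<^bsub>R\<^esub>} k \<subseteq> Q" by (rule exI)
  then have "{\<zero>\<^bsub>R\<^esub>} \<in> S"
    using I zeroideal by (auto simp: S_def additive_subgroup.zero_closed[OF ideal.axioms(1)])
  then have "\<exists>J\<in>S. \<forall>K\<in>S. J \<subseteq> K \<longrightarrow> K = J"
    by (intro ideal_maximal) (auto simp: S_def)
  then obtain J where JS: "J \<in> S" and max: "\<forall>K\<in>S. J \<subseteq> K \<longrightarrow> K = J" by (rule bexE)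
  have J: "ideal J R" "J \<subseteq> I" "\<exists>k. ideal_pow R J k \<subseteq> Q" using JS by (simp_all add: S_def)
  have "I \<subseteq> J"
  proof
    fix x assume x: "x \<in> I"
    have xR: "x \<in> carrier R" by (rule ideal.Icarr[OF I x])
    obtain k n where k: "ideal_pow R J k \<subseteq> Q" and n: "x [^]\<^bsub>R\<^esub> (n::nat) \<in> Q" using J nil[OF x] by blast
    let ?K = "J <+>\<^bsub>R\<^esub> (PIdl\<^bsub>R\<^esub> x)"
    have P: "ideal (PIdl\<^bsub>R\<^esub> x) R" by (rule cgenideal_ideal[OF xR])
    have K: "ideal ?K R" by (rule add_ideals[OF J(1) P])
    have PI: "PIdl\<^bsub>R\<^esub> x \<subseteq> I" by (rule cgenideal_minimal[OF I x])
    have "?K \<subseteq> I" using J(2) PI ideal_add_closed[OF I] by (auto simp: set_add_def')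
    moreover have "ideal_pow R ?K (k + n) \<subseteq> Q"
      using ideal_add_ideal_pow[OF J(1) P, of k n] k principal_pow_subset[OF xR Q n] ideal_add_closed[OF Q]
      by (fastforce simp: set_add_def')
    ultimately have KS: "?K \<in> S" using K unfolding S_def by blast
    have JK: "J \<subseteq> ?K"
    proof
      fix y assume y: "y \<in> J"
      have "y = y \<oplus>\<^bsub>R\<^esub> \<zero>\<^bsub>R\<^esub>" using ideal.Icarr[OF J(1) y] by simp
      then show "y \<in> ?K"
        using y additive_subgroup.zero_closed[OF ideal.axioms(1)[OF P]] unfolding set_add_def' by blast
    qed
    from max KS JK have "?K = J" by blast
    moreover have "x \<in> ?K"
      using cgenideal_self[OF xR] xR additive_subgroup.zero_closed[OF ideal.axioms(1)[OF J(1)]]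
      by (force simp: set_add_def')
    ultimately show "x \<in> J" by simp
  qed
  then have "I = J" using J(2) by blast
  then show ?thesis using J(3) by simp
qed

text \<open>A weak form of the Artin--Rees lemma. An ideal \<open>Q\<close> maximal among those with
  \<open>Q \<inter> b = J\<close> contains a power of every \<open>x\<close> in \<open>a\<close>: for large \<open>t\<close>, where \<open>(Q : x^t)\<close> is
  stationary, \<open>Q + (x^t)\<close> still meets \<open>b\<close> in \<open>J\<close>.\<close>

lemma weak_Artin_Rees:
  assumes "cring R" "noetherian_ring R" and a: "ideal a R" and b: "ideal b R" and J: "ideal J R"
    and Jb: "J \<subseteq> b" and ab: "\<And>r y. r \<in> ideal_pow R a n \<Longrightarrow> y \<in> b \<Longrightarrow> r \<otimes>\<^bsub>R\<^esub> y \<in> J"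
  shows "\<exists>k. ideal_pow R a k \<inter> b \<subseteq> J"
proof -
  interpret cring R by fact
  interpret noetherian_ring R by fact
  define S where "S = {Q. ideal Q R \<and> Q \<inter> b = J}"
  have "J \<in> S" using J Jb by (auto simp: S_def)
  then have "\<exists>Q\<in>S. \<forall>K\<in>S. Q \<subseteq> K \<longrightarrow> K = Q"
    by (intro ideal_maximal) (auto simp: S_def)
  then obtain Q where QS: "Q \<in> S" and max: "\<forall>K\<in>S. Q \<subseteq> K \<longrightarrow> K = Q" by (rule bexE)
  have Q: "ideal Q R" "Q \<inter> b = J" using QS by (simp_all add: S_def)
  have "\<exists>t::nat. x [^]\<^bsub>R\<^esub> t \<in> Q" if x: "x \<in> a" for x
  proof -
    have xR: "x \<in> carrier R" by (rule ideal.Icarr[OF a x])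
    define col where "col t = {r \<in> carrier R. x [^]\<^bsub>R\<^esub> t \<otimes>\<^bsub>R\<^esub> r \<in> Q}" for t :: nat
    have col: "ideal (col t) R" for t
    proof -
      interpret L: rmodule R "regular_module R" by (rule rmodule.intro) (rule regular_module, fact)
      have QL: "submodule Q R (regular_module R)" using Q(1) submodule_regular_ideal assms(1) by blast
      have "submodule (col t) R (regular_module R)"
        unfolding L.submodule_alt col_def
        using xR L.submodule_zero[OF QL] L.submodule_add[OF QL] L.submodule_smult[OF QL]
        by (auto simp: r_distr m_lcomm[of "x [^]\<^bsub>R\<^esub> t"])
      then show ?thesis using submodule_regular_ideal assms(1) by blast
    qed
    have colSuc: "col t \<subseteq> col (Suc t)" for t
    proof
      fix r assume "r \<in> col t"
      then have r: "r \<in> carrier R" "x [^]\<^bsub>R\<^esub> t \<otimes>\<^bsub>R\<^esub> r \<in> Q" by (auto simp: col_def)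
      have "x [^]\<^bsub>R\<^esub> Suc t \<otimes>\<^bsub>R\<^esub> r = x \<otimes>\<^bsub>R\<^esub> (x [^]\<^bsub>R\<^esub> t \<otimes>\<^bsub>R\<^esub> r)"
        using xR r by (simp add: m_ac)
      then show "r \<in> col (Suc t)" using ideal.I_l_closed[OF Q(1) r(2) xR] r by (simp add: col_def)
    qed
    have colmono: "col s \<subseteq> col t" if "s \<le> t" for s t
      using colSuc that by (rule lift_Suc_mono_le)
    have "\<exists>C\<in>range col. \<forall>K\<in>range col. C \<subseteq> K \<longrightarrow> K = C"
      by (rule ideal_maximal) (auto simp: col)
    then obtain t0 where t0: "\<And>t. col t0 \<subseteq> col t \<Longrightarrow> col t = col t0" by auto
    \<comment> \<open>Beyond t0 the ideals (Q : x^t) are stationary; beyond n the power x^t lies in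
      a^n and so carries b into J.\<close>
    define t where "t = max t0 n"
    have stat: "col (s + t) = col t" for s
      using t0[of "s + t"] t0[of t] colmono[of t0 "s + t"] colmono[of t0 t] by (simp add: t_def)
    have xt: "x [^]\<^bsub>R\<^esub> t \<in> carrier R" using xR by simp
    let ?P = "PIdl\<^bsub>R\<^esub> (x [^]\<^bsub>R\<^esub> t)"
    have P: "ideal ?P R" by (rule cgenideal_ideal[OF xt])
    let ?K = "Q <+>\<^bsub>R\<^esub> ?P"
    have K: "ideal ?K R" by (rule add_ideals[OF Q(1) P])
    have QK: "Q \<subseteq> ?K"
    proof
      fix y assume y: "y \<in> Q"
      have "y = y \<oplus>\<^bsub>R\<^esub> \<zero>\<^bsub>R\<^esub>" using ideal.Icarr[OF Q(1) y] by simp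
      then show "y \<in> ?K"
        using y additive_subgroup.zero_closed[OF ideal.axioms(1)[OF P]] unfolding set_add_def' by blast
    qed
    have "x [^]\<^bsub>R\<^esub> m \<in> ideal_pow R a m" for m :: nat
      by (induction m) (auto simp: ideal_pow_Suc intro: ideal_prod.prod x)
    then have xn: "x [^]\<^bsub>R\<^esub> t \<in> ideal_pow R a n"
      using ideal_pow_antimono[OF a, of n t] by (auto simp: t_def)
    have "?K \<inter> b \<subseteq> J"
    proof
      fix y assume "y \<in> ?K \<inter> b"
      then obtain q r where y: "y \<in> b" and q: "q \<in> Q" and r: "r \<in> carrier R"
        and yq: "y = q \<oplus>\<^bsub>R\<^esub> r \<otimes>\<^bsub>R\<^esub> x [^]\<^bsub>R\<^esub> t"
        by (auto simp: set_add_def' cgenideal_def)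
      have qR: "q \<in> carrier R" by (rule ideal.Icarr[OF Q(1) q])
      have "x [^]\<^bsub>R\<^esub> t \<otimes>\<^bsub>R\<^esub> y \<in> J" by (rule ab[OF xn y])
      then have 1: "x [^]\<^bsub>R\<^esub> t \<otimes>\<^bsub>R\<^esub> y \<in> Q" using Q(2) by blast
      have 2: "\<ominus>\<^bsub>R\<^esub> (x [^]\<^bsub>R\<^esub> t) \<otimes>\<^bsub>R\<^esub> q \<in> Q" using ideal.I_l_closed[OF Q(1) q] xt by simp
      \<comment> \<open>Multiply y = q + r x^t by x^t. Both x^t y and x^t q lie in Q, so x^(2t) r
        does, and stationarity brings this down to x^t r.\<close>
      have "x [^]\<^bsub>R\<^esub> (t + t) \<otimes>\<^bsub>R\<^esub> r = x [^]\<^bsub>R\<^esub> t \<otimes>\<^bsub>R\<^esub> y \<oplus>\<^bsub>R\<^esub> \<ominus>\<^bsub>R\<^esub> (x [^]\<^bsub>R\<^esub> t) \<otimes>\<^bsub>R\<^esub> q"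
        using xt qR r unfolding yq nat_pow_mult[OF xR, symmetric] by algebra
      then have "r \<in> col (t + t)" using ideal_add_closed[OF Q(1) 1 2] r by (simp add: col_def)
      then have "x [^]\<^bsub>R\<^esub> t \<otimes>\<^bsub>R\<^esub> r \<in> Q" using stat by (auto simp: col_def)
      then have "y \<in> Q" using ideal_add_closed[OF Q(1) q] xt r by (simp add: yq m_comm)
      then show "y \<in> J" using y Q(2) by blast
    qed
    then have "?K \<in> S" using K QK Q(2) unfolding S_def by blast
    with max QK have "?K = Q" by blast
    moreover have "x [^]\<^bsub>R\<^esub> t \<in> ?K"
      using cgenideal_self[OF xt] xt additive_subgroup.zero_closed[OF ideal.axioms(1)[OF Q(1)]]
      by (force simp: set_add_def')
    ultimately show ?thesis by blast
  qed
  from ideal_pow_subset_if_nil[OF assms(1,2) a Q(1) this] show ?thesis using Q(2) by blast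
qed

section \<open>Torsion submodules\<close>

context rmodule begin

lemma torsion_mono:
  assumes "ideal a R" "m \<le> n" "\<forall>r\<in>ideal_pow R a m. r \<odot>\<^bsub>M\<^esub> x = \<zero>\<^bsub>M\<^esub>"
  shows "\<forall>r\<in>ideal_pow R a n. r \<odot>\<^bsub>M\<^esub> x = \<zero>\<^bsub>M\<^esub>"
  using R.ideal_pow_antimono[OF assms(1,2)] assms(3) by blast

lemma killed_submodule:
  assumes a: "ideal a R"
  shows "submodule {x \<in> carrier M. \<forall>r\<in>ideal_pow R a n. r \<odot>\<^bsub>M\<^esub> x = \<zero>\<^bsub>M\<^esub>} R M"
  unfolding submodule_alt
proof (intro conjI ballI CollectI)
  have c: "r \<in> carrier R" if "r \<in> ideal_pow R a n" for r
    using ideal.Icarr[OF R.ideal_pow_ideal[OF a] that] .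
  let ?K = "{x \<in> carrier M. \<forall>r\<in>ideal_pow R a n. r \<odot>\<^bsub>M\<^esub> x = \<zero>\<^bsub>M\<^esub>}"
  show "s \<odot>\<^bsub>M\<^esub> (r \<odot>\<^bsub>M\<^esub> x) = \<zero>\<^bsub>M\<^esub>" if "r \<in> carrier R" "x \<in> ?K" "s \<in> ideal_pow R a n" for r s x
  proof -
    have "s \<odot>\<^bsub>M\<^esub> (r \<odot>\<^bsub>M\<^esub> x) = (r \<otimes> s) \<odot>\<^bsub>M\<^esub> x"
      using that c by (simp add: smult_assoc1[symmetric] R.m_comm)
    also have "\<dots> = r \<odot>\<^bsub>M\<^esub> (s \<odot>\<^bsub>M\<^esub> x)" using that c by (simp add: smult_assoc1)
    finally show ?thesis using that by simp
  qed
qed (use ideal.Icarr[OF R.ideal_pow_ideal[OF a]] in \<open>auto simp: smult_r_distr\<close>)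

lemma torsion_submodule:
  assumes a: "ideal a R"
  shows "submodule (torsion R a M) R M"
proof -
  have *: "\<exists>n. (\<forall>r\<in>ideal_pow R a n. r \<odot>\<^bsub>M\<^esub> x = \<zero>\<^bsub>M\<^esub>) \<and> (\<forall>r\<in>ideal_pow R a n. r \<odot>\<^bsub>M\<^esub> y = \<zero>\<^bsub>M\<^esub>)"
    if xy: "x \<in> torsion R a M" "y \<in> torsion R a M" for x y
  proof -
    obtain m n where "\<forall>r\<in>ideal_pow R a m. r \<odot>\<^bsub>M\<^esub> x = \<zero>\<^bsub>M\<^esub>" "\<forall>r\<in>ideal_pow R a n. r \<odot>\<^bsub>M\<^esub> y = \<zero>\<^bsub>M\<^esub>"
      using xy by (auto simp: torsion_def)
    then show ?thesis
      using torsion_mono[OF a, of m "max m n" x] torsion_mono[OF a, of n "max m n" y]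
      by (intro exI[of _ "max m n"] conjI) simp_all
  qed
  show ?thesis
    unfolding submodule_alt
  proof (intro conjI ballI)
    show "torsion R a M \<subseteq> carrier M" by (auto simp: torsion_def)
    show "\<zero>\<^bsub>M\<^esub> \<in> torsion R a M"
      using submodule_zero[OF killed_submodule[OF a, of 0]]
      unfolding torsion_def by (intro CollectI conjI exI[of _ 0]) simp_all
  next
    fix x y assume xy: "x \<in> torsion R a M" "y \<in> torsion R a M"
    from *[OF xy] obtain n where "\<forall>r\<in>ideal_pow R a n. r \<odot>\<^bsub>M\<^esub> x = \<zero>\<^bsub>M\<^esub>"
      "\<forall>r\<in>ideal_pow R a n. r \<odot>\<^bsub>M\<^esub> y = \<zero>\<^bsub>M\<^esub>" by (elim exE conjE)
    then show "x \<oplus>\<^bsub>M\<^esub> y \<in> torsion R a M"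
      using submodule_add[OF killed_submodule[OF a, of n], of x y] xy
      unfolding torsion_def by (intro CollectI conjI exI[of _ n]) simp_all
  next
    fix r x assume r: "r \<in> carrier R" and x: "x \<in> torsion R a M"
    then obtain n where "\<forall>r\<in>ideal_pow R a n. r \<odot>\<^bsub>M\<^esub> x = \<zero>\<^bsub>M\<^esub>"
      unfolding torsion_def by (elim CollectE conjE exE)
    then show "r \<odot>\<^bsub>M\<^esub> x \<in> torsion R a M"
      using submodule_smult[OF killed_submodule[OF a, of n] r, of x] x
      unfolding torsion_def by (intro CollectI conjI exI[of _ n]) simp_all
  qed
qed

lemma torsion_map:
  assumes a: "ideal a R" and N: "module R N" and f: "mod_map R M N f" and x: "x \<in> torsion R a M"
  shows "f x \<in> torsion R a N"
proof -
  obtain n where n: "\<forall>r\<in>ideal_pow R a n. r \<odot>\<^bsub>M\<^esub> x = \<zero>\<^bsub>M\<^esub>" and xM: "x \<in> carrier M"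
    using x by (auto simp: torsion_def)
  have "r \<odot>\<^bsub>N\<^esub> f x = \<zero>\<^bsub>N\<^esub>" if r: "r \<in> ideal_pow R a n" for r
    using mod_map_smult[OF f ideal.Icarr[OF R.ideal_pow_ideal[OF a] r] xM] n r mod_map_zero[OF N f] by simp
  then show ?thesis using mod_map_closed[OF f xM] by (auto simp: torsion_def)
qed

lemma gen_submodule_minimal: "submodule N R M \<Longrightarrow> S \<subseteq> N \<Longrightarrow> gen_submodule R M S \<subseteq> N"
  by (auto simp: gen_submodule_def)

lemma fin_gen_torsion_bound:
  assumes a: "ideal a R" and M: "fin_gen R M" and E: "module R E"
    and f: "mod_map R M E f" "\<And>x. x \<in> carrier M \<Longrightarrow> f x \<in> torsion R a E"
  shows "\<exists>n. \<forall>x\<in>carrier M. \<forall>r\<in>ideal_pow R a n. r \<odot>\<^bsub>E\<^esub> f x = \<zero>\<^bsub>E\<^esub>"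
proof -
  interpret E: rmodule R E by (rule rmodule.intro) fact
  obtain S where S: "S \<subseteq> carrier M" "finite S" "gen_submodule R M S = carrier M"
    using M by (auto simp: fin_gen_def)
  have "\<forall>x\<in>S. \<exists>n. \<forall>r\<in>ideal_pow R a n. r \<odot>\<^bsub>E\<^esub> f x = \<zero>\<^bsub>E\<^esub>"
    using f(2) S(1) by (auto simp: torsion_def)
  then obtain n where n: "\<And>x. x \<in> S \<Longrightarrow> \<forall>r\<in>ideal_pow R a (n x). r \<odot>\<^bsub>E\<^esub> f x = \<zero>\<^bsub>E\<^esub>" by metis
  \<comment> \<open>0 is inserted so that \<open>Max\<close> is taken of a nonempty set even when S
    is empty.\<close>
  define m where "m = Max (insert 0 (n ` S))"
  have "n x \<le> m" if "x \<in> S" for x using that S(2) by (auto simp: m_def)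
  then have m: "\<forall>r\<in>ideal_pow R a m. r \<odot>\<^bsub>E\<^esub> f x = \<zero>\<^bsub>E\<^esub>" if "x \<in> S" for x
    using E.torsion_mono[OF a _ n[OF that]] that by blast
  let ?K = "{x \<in> carrier E. \<forall>r\<in>ideal_pow R a m. r \<odot>\<^bsub>E\<^esub> x = \<zero>\<^bsub>E\<^esub>}"
  have K: "submodule ?K R E" by (rule E.killed_submodule[OF a])
  have "submodule {x \<in> carrier M. f x \<in> ?K} R M"
    unfolding submodule_alt
  proof (intro conjI ballI)
    show "\<zero>\<^bsub>M\<^esub> \<in> {x \<in> carrier M. f x \<in> ?K}"
      using E.submodule_zero[OF K] mod_map_zero[OF E f(1)] by simp
    show "x \<oplus>\<^bsub>M\<^esub> y \<in> {x \<in> carrier M. f x \<in> ?K}"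
      if "x \<in> {x \<in> carrier M. f x \<in> ?K}" "y \<in> {x \<in> carrier M. f x \<in> ?K}" for x y
      using that E.submodule_add[OF K, of "f x" "f y"] mod_map_add[OF f(1)] by simp
    show "r \<odot>\<^bsub>M\<^esub> x \<in> {x \<in> carrier M. f x \<in> ?K}"
      if "r \<in> carrier R" "x \<in> {x \<in> carrier M. f x \<in> ?K}" for r x
      using that E.submodule_smult[OF K, of r "f x"] mod_map_smult[OF f(1)] by simp
  qed auto
  moreover have "S \<subseteq> {x \<in> carrier M. f x \<in> ?K}"
    using m S(1) mod_map_closed[OF f(1)] by auto
  ultimately have "gen_submodule R M S \<subseteq> {x \<in> carrier M. f x \<in> ?K}"
    by (rule gen_submodule_minimal)
  then show ?thesis unfolding S(3) by (intro exI[of _ m]) (auto dest!: subsetD)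
qed

end

section \<open>Torsion submodules of injective modules over a Noetherian ring\<close>

lemma noetherian_ideal_fin_gen:
  assumes R: "cring R" "noetherian_ring R" and I: "submodule I R (regular_module R)"
  shows "fin_gen R (regular_module R\<lparr>carrier := I\<rparr>)"
proof -
  interpret cring R by fact
  interpret noetherian_ring R by fact
  interpret L: rmodule R "regular_module R" by (rule rmodule.intro) (rule regular_module[OF R(1)])
  interpret I: rmodule R "regular_module R\<lparr>carrier := I\<rparr>"
    by (rule rmodule.intro) (rule L.submodule_module[OF I])
  have "ideal I R" using I submodule_regular_ideal[OF R(1)] by blast
  from finetely_gen[OF this] obtain A where A: "A \<subseteq> carrier R" "finite A" "I = Idl\<^bsub>R\<^esub> A" by blast
  have AI: "A \<subseteq> I" using A genideal_self by blast
  have "I \<subseteq> N" if N: "submodule N R (regular_module R\<lparr>carrier := I\<rparr>)" "A \<subseteq> N" for N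
  proof -
    have "submodule N R (regular_module R)"
      using N(1) L.submodule_subset[OF I] by (auto simp: L.submodule_alt I.submodule_alt)
    then have "ideal N R" using submodule_regular_ideal[OF R(1)] by blast
    then show ?thesis using genideal_minimal N(2) A(3) by blast
  qed
  moreover have "submodule I R (regular_module R\<lparr>carrier := I\<rparr>)"
    using I.carrier_is_submodule by simp
  ultimately have "gen_submodule R (regular_module R\<lparr>carrier := I\<rparr>) A = I"
    using AI unfolding gen_submodule_def by blast
  then show ?thesis using A AI by (auto simp: fin_gen_def)
qed

text \<open>Let h map an ideal I to the torsion, and let a^n kill its values, so that a^n I lies in
  the kernel J. \<open>weak_Artin_Rees\<close> gives k with a^k \<inter> I inside J; so h factors
  through the image of I in R / a^k and extends from there to a map into E.\<close>

theorem torsion_baer: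
  assumes R: "cring R" "noetherian_ring R" and a: "ideal a R" and E: "baer R E"
  shows "baer R (E\<lparr>carrier := torsion R a E\<rparr>)"
  unfolding baer_def
proof (intro conjI allI impI)
  interpret cring R by fact
  interpret L: rmodule R "regular_module R" by (rule rmodule.intro) (rule regular_module[OF R(1)])
  interpret E: rmodule R E by (rule rmodule.intro) (rule baer_module[OF E])
  have T: "submodule (torsion R a E) R E" by (rule E.torsion_submodule[OF a])
  show "module R (E\<lparr>carrier := torsion R a E\<rparr>)" by (rule E.submodule_module[OF T])
  fix I h assume *: "submodule I R (regular_module R) \<and>
    mod_map R (regular_module R\<lparr>carrier := I\<rparr>) (E\<lparr>carrier := torsion R a E\<rparr>) h"
  then have I: "submodule I R (regular_module R)" by simp
  have IM: "module R (regular_module R\<lparr>carrier := I\<rparr>)" by (rule L.submodule_module[OF I])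
  interpret I: rmodule R "regular_module R\<lparr>carrier := I\<rparr>" by (rule rmodule.intro) (rule IM)
  note IR = subsetD[OF L.submodule_subset[OF I]]
  have hT: "h x \<in> torsion R a E" if "x \<in> I" for x
    using mod_map_closed[OF conjunct2[OF *], of x] that by simp
  have h: "mod_map R (regular_module R\<lparr>carrier := I\<rparr>) E h"
    using * mod_map_from_carrier E.submodule_subset[OF T] by blast
  obtain n where n: "\<And>x r. x \<in> I \<Longrightarrow> r \<in> ideal_pow R a n \<Longrightarrow> r \<odot>\<^bsub>E\<^esub> h x = \<zero>\<^bsub>E\<^esub>"
    using I.fin_gen_torsion_bound[OF a noetherian_ideal_fin_gen[OF R I] baer_module[OF E] h] hT by auto
  define J where "J = {x \<in> I. h x = \<zero>\<^bsub>E\<^esub>}"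
  have "submodule J R (regular_module R\<lparr>carrier := I\<rparr>)"
    using I.kernel_submodule[OF baer_module[OF E] h] by (simp add: J_def)
  then have "submodule J R (regular_module R)"
    using L.submodule_subset[OF I] by (auto simp: L.submodule_alt I.submodule_alt)
  then have J: "ideal J R" using submodule_regular_ideal[OF R(1)] by blast
  have id: "ideal I R" using I submodule_regular_ideal[OF R(1)] by blast
  have "\<exists>k. ideal_pow R a k \<inter> I \<subseteq> J"
  proof (rule weak_Artin_Rees[OF R a id J])
    show "J \<subseteq> I" by (auto simp: J_def)
    fix r y assume r: "r \<in> ideal_pow R a n" and y: "y \<in> I"
    have rR: "r \<in> carrier R" by (rule ideal.Icarr[OF ideal_pow_ideal[OF a] r])
    have "h (r \<otimes>\<^bsub>R\<^esub> y) = r \<odot>\<^bsub>E\<^esub> h y" using mod_map_smult[OF h rR] y by simp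
    then show "r \<otimes>\<^bsub>R\<^esub> y \<in> J" using n[OF y r] L.submodule_smult[OF I rR y] by (simp add: J_def)
  qed
  then obtain k where k: "ideal_pow R a k \<inter> I \<subseteq> J" by blast
  let ?A = "ideal_pow R a k" and ?L = "regular_module R"
  have A: "submodule ?A R ?L" using submodule_regular_ideal[OF R(1)] ideal_pow_ideal[OF a] by blast
  have Q: "module R (quot_mod ?L ?A)" by (rule L.quot_module[OF A])
  note c = L.coset_map[OF A]
  have "\<exists>g. mod_map R (quot_mod ?L ?A) E g \<and> (\<forall>x\<in>carrier (?L\<lparr>carrier := I\<rparr>). g (?A +>\<^bsub>?L\<^esub> x) = h x)"
  proof (rule baer_extend_along[OF E IM Q mod_map_restrict_carrier[OF c] h])
    show "I \<subseteq> carrier ?L" by (rule L.submodule_subset[OF I])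
    fix x assume "x \<in> carrier (?L\<lparr>carrier := I\<rparr>)" "?A +>\<^bsub>?L\<^esub> x = \<zero>\<^bsub>quot_mod ?L ?A\<^esub>"
    then have "x \<in> I" "x \<in> ?A" using L.coset_zero_iff[OF A IR] by auto
    then show "h x = \<zero>\<^bsub>E\<^esub>" using k by (auto simp: J_def)
  qed
  then obtain g where g: "mod_map R (quot_mod ?L ?A) E g" and gx: "\<And>x. x \<in> I \<Longrightarrow> g (?A +>\<^bsub>?L\<^esub> x) = h x"
    by auto
  note gc = mod_map_comp[OF c g]
  \<comment> \<open>The class of 1 in R / a^k is killed by a^k, hence so is its image. This is why
    the extension takes values in the torsion.\<close>
  let ?e = "g (?A +>\<^bsub>?L\<^esub> \<one>\<^bsub>R\<^esub>)"
  have e: "?e \<in> carrier E" using mod_map_closed[OF gc] by simp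
  have ge: "g (?A +>\<^bsub>?L\<^esub> r) = r \<odot>\<^bsub>E\<^esub> ?e" if "r \<in> carrier R" for r
    using mod_map_smult[OF gc that, of "\<one>\<^bsub>R\<^esub>"] that by simp
  have "r \<odot>\<^bsub>E\<^esub> ?e = \<zero>\<^bsub>E\<^esub>" if r: "r \<in> ?A" for r
  proof -
    have rR: "r \<in> carrier R" by (rule ideal.Icarr[OF ideal_pow_ideal[OF a] r])
    have "?A +>\<^bsub>?L\<^esub> r = \<zero>\<^bsub>quot_mod ?L ?A\<^esub>" using L.coset_zero_iff[OF A] rR r by simp
    then show ?thesis
      using ge[OF rR] rmodule.mod_map_zero[OF rmodule.intro[OF Q] baer_module[OF E] g] by simp
  qed
  then have "?e \<in> torsion R a E" using e by (auto simp: torsion_def)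
  moreover have "h r = r \<odot>\<^bsub>E\<^esub> ?e" if "r \<in> I" for r using gx[OF that] ge[of r] IR[OF that] by simp
  ultimately show "\<exists>e\<in>carrier (E\<lparr>carrier := torsion R a E\<rparr>). \<forall>r\<in>I. h r = r \<odot>\<^bsub>E\<lparr>carrier := torsion R a E\<rparr>\<^esub> e"
    by auto
qed

section \<open>Maps into a complex of injective modules\<close>

text \<open>The cohomology of Hom(N, C) is handled through functions that are unconstrained off the
  carrier, so that they can be composed, restricted and corrected freely. Extensional functions and
  cosets return only with \<open>Ext\<close>.\<close>

definition cocycle ::
    "('a, 'r) ring_scheme \<Rightarrow> ('a, 'n) module \<Rightarrow> (nat \<Rightarrow> ('a, 'c) module) \<Rightarrow> (nat \<Rightarrow> 'c \<Rightarrow> 'c) \<Rightarrow>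
     nat \<Rightarrow> ('n \<Rightarrow> 'c) \<Rightarrow> bool"
  where "cocycle R N C d i f \<longleftrightarrow>
    mod_map R N (C i) f \<and> (\<forall>x\<in>carrier N. d i (f x) = \<zero>\<^bsub>C (Suc i)\<^esub>)"

definition coboundary ::
    "('a, 'r) ring_scheme \<Rightarrow> ('a, 'n) module \<Rightarrow> (nat \<Rightarrow> ('a, 'c) module) \<Rightarrow> (nat \<Rightarrow> 'c \<Rightarrow> 'c) \<Rightarrow>
     nat \<Rightarrow> ('n \<Rightarrow> 'c) \<Rightarrow> bool"
  where "coboundary R N C d i f \<longleftrightarrow> (case i of 0 \<Rightarrow> \<forall>x\<in>carrier N. f x = \<zero>\<^bsub>C 0\<^esub>
    | Suc j \<Rightarrow> \<exists>k. mod_map R N (C j) k \<and> (\<forall>x\<in>carrier N. f x = d j (k x)))"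

text \<open>In degree 0, where \<open>coboundaries\<close> is zero, this says that d 0 has zero
  kernel.\<close>

definition exact_at :: "(nat \<Rightarrow> ('a, 'c) module) \<Rightarrow> (nat \<Rightarrow> 'c \<Rightarrow> 'c) \<Rightarrow> nat \<Rightarrow> bool"
  where "exact_at C d i \<longleftrightarrow> (\<forall>x\<in>carrier (C i). d i x = \<zero>\<^bsub>C (Suc i)\<^esub> \<longrightarrow> x \<in> coboundaries C d i)"

definition Hom_exact_at ::
    "('a, 'r) ring_scheme \<Rightarrow> ('a, 'n) module \<Rightarrow> (nat \<Rightarrow> ('a, 'c) module) \<Rightarrow> (nat \<Rightarrow> 'c \<Rightarrow> 'c) \<Rightarrow> nat \<Rightarrow> bool"
  where "Hom_exact_at R N C d i \<longleftrightarrow> (\<forall>f. cocycle R N C d i f \<longrightarrow> coboundary R N C d i f)"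

lemma coboundaries_simps [simp]:
  "coboundaries C d 0 = {\<zero>\<^bsub>C 0\<^esub>}" "coboundaries C d (Suc j) = d j ` carrier (C j)"
  by (simp_all add: coboundaries_def)

lemma coboundary_simps:
  "coboundary R N C d 0 f \<longleftrightarrow> (\<forall>x\<in>carrier N. f x = \<zero>\<^bsub>C 0\<^esub>)"
  "coboundary R N C d (Suc j) f \<longleftrightarrow> (\<exists>k. mod_map R N (C j) k \<and> (\<forall>x\<in>carrier N. f x = d j (k x)))"
  by (simp_all add: coboundary_def)

lemma coboundary_cong:
  "(\<And>x. x \<in> carrier N \<Longrightarrow> f x = g x) \<Longrightarrow> coboundary R N C d i f \<longleftrightarrow> coboundary R N C d i g"
  by (cases i) (simp_all add: coboundary_simps)

lemma coboundary_comp: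
  "coboundary R N C d i f \<Longrightarrow> mod_map R P N q \<Longrightarrow> coboundary R P C d i (\<lambda>x. f (q x))"
  by (cases i) (force simp: coboundary_simps mod_map_closed dest: mod_map_comp)+

lemma cocycle_comp:
  "cocycle R N C d i f \<Longrightarrow> mod_map R P N q \<Longrightarrow> cocycle R P C d i (\<lambda>x. f (q x))"
  by (auto simp: cocycle_def mod_map_closed intro: mod_map_comp)

lemma mod_map_incl: "S \<subseteq> carrier P \<Longrightarrow> mod_map R (P\<lparr>carrier := S\<rparr>) P (\<lambda>x. x)"
  by (rule mod_map_restrict_carrier[OF mod_map_id])

text \<open>\<open>projective_module R N\<close> itself is not transported along the isomorphism \<open>q\<close>, because its test
  modules depend on the type of \<open>N\<close>.\<close>

lemma projective_lift_iso:
  assumes P: "projective_module R P" and N: "module R N" and q: "mod_map R P N q" "q ` carrier P = carrier N"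
    and inj: "\<And>x. x \<in> carrier P \<Longrightarrow> q x = \<zero>\<^bsub>N\<^esub> \<Longrightarrow> x = \<zero>\<^bsub>P\<^esub>"
    and A: "module R A" and B: "module R B"
    and s: "mod_map R A B s" and g: "mod_map R N B g" and sur: "\<And>x. x \<in> carrier N \<Longrightarrow> g x \<in> s ` carrier A"
  shows "\<exists>h. mod_map R N A h \<and> (\<forall>x\<in>carrier N. s (h x) = g x)"
proof -
  have PM: "module R P" using P by (simp add: projective_module_def)
  interpret P: rmodule R P by (rule rmodule.intro) (rule PM)
  obtain h where h: "mod_map R P A h" "\<And>x. x \<in> carrier P \<Longrightarrow> s (h x) = g (q x)"
    using projective_lift[OF P A B s mod_map_comp[OF q(1) g]] sur mod_map_closed[OF q(1)] by blast
  have "\<exists>k. mod_map R N A k \<and> (\<forall>x\<in>carrier P. k (q x) = h x)"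
  proof (rule mod_map_factor_kernel[OF PM A N q h(1)])
    show "h x = \<zero>\<^bsub>A\<^esub>" if "x \<in> carrier P" "q x = \<zero>\<^bsub>N\<^esub>" for x
      using inj[OF that] P.mod_map_zero[OF A h(1)] by simp
  qed
  then obtain k where k: "mod_map R N A k" "\<And>x. x \<in> carrier P \<Longrightarrow> k (q x) = h x" by blast
  have "s (k y) = g y" if y: "y \<in> carrier N" for y
  proof -
    obtain x where "x \<in> carrier P" "y = q x" using y unfolding q(2)[symmetric] by blast
    then show ?thesis using k(2) h(2) by simp
  qed
  with k(1) show ?thesis by blast
qed

text \<open>Two predicates are needed because M and its syzygies live over different types, and a
  predicate variable has only one type. The index j counts the length of the resolution that
  remains.\<close>

lemma projective_resolution_induct:
  fixes M :: "('a, 'm) module" and P :: "nat \<Rightarrow> ('a, 'p) module"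
    and T :: "nat \<Rightarrow> ('a, 'p) module \<Rightarrow> bool" and T' :: "nat \<Rightarrow> ('a, 'm) module \<Rightarrow> bool"
  assumes M: "module R M" and res: "projective_resolution R M P d aug" and len: "\<And>k. k > n \<Longrightarrow> zero_mod (P k)"
    and base: "\<And>N (Q :: ('a, 'p) module) q. module R N \<Longrightarrow> projective_module R Q \<Longrightarrow> mod_map R Q N q \<Longrightarrow>
      q ` carrier Q = carrier N \<Longrightarrow> (\<And>x. x \<in> carrier Q \<Longrightarrow> q x = \<zero>\<^bsub>N\<^esub> \<Longrightarrow> x = \<zero>\<^bsub>Q\<^esub>) \<Longrightarrow> T 0 N"
    and step: "\<And>N (Q :: ('a, 'p) module) q j. module R N \<Longrightarrow> projective_module R Q \<Longrightarrow> mod_map R Q N q \<Longrightarrow>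
      q ` carrier Q = carrier N \<Longrightarrow> T j (Q\<lparr>carrier := {x \<in> carrier Q. q x = \<zero>\<^bsub>N\<^esub>}\<rparr>) \<Longrightarrow> T (Suc j) N"
    and base': "\<And>(Q :: ('a, 'p) module) q. projective_module R Q \<Longrightarrow> mod_map R Q M q \<Longrightarrow>
      q ` carrier Q = carrier M \<Longrightarrow> (\<And>x. x \<in> carrier Q \<Longrightarrow> q x = \<zero>\<^bsub>M\<^esub> \<Longrightarrow> x = \<zero>\<^bsub>Q\<^esub>) \<Longrightarrow> T' 0 M"
    and step': "\<And>(Q :: ('a, 'p) module) q j. projective_module R Q \<Longrightarrow> mod_map R Q M q \<Longrightarrow>
      q ` carrier Q = carrier M \<Longrightarrow> T j (Q\<lparr>carrier := {x \<in> carrier Q. q x = \<zero>\<^bsub>M\<^esub>}\<rparr>) \<Longrightarrow> T' (Suc j) M"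
  shows "T' n M"
proof -
  have P: "projective_module R (P k)" and d: "mod_map R (P (Suc k)) (P k) (d k)"
    and dd: "d (Suc k) ` carrier (P (Suc (Suc k))) = {x \<in> carrier (P (Suc k)). d k x = \<zero>\<^bsub>P k\<^esub>}" for k
    using res by (auto simp: projective_resolution_def a_kernel_eq dest: mod_hom_map)
  have aug: "mod_map R (P 0) M aug" "aug ` carrier (P 0) = carrier M"
    and d0: "d 0 ` carrier (P 1) = {x \<in> carrier (P 0). aug x = \<zero>\<^bsub>M\<^esub>}"
    using res by (auto simp: projective_resolution_def a_kernel_eq dest: mod_hom_map)
  have PM: "module R (P k)" for k using P[of k] by (simp add: projective_module_def)
  have z: "d k ` carrier (P (Suc k)) = {\<zero>\<^bsub>P k\<^esub>}" if "Suc k > n" for k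
    using len[OF that] rmodule.mod_map_zero[OF rmodule.intro[OF PM] PM d, of k] by (simp add: zero_mod_def)
  \<comment> \<open>The image of d k is covered by P (k + 1) and has a resolution of length j = n -
    k - 1. For j = 0 the cover is an isomorphism, since P (n + 1) is zero.\<close>
  have claim: "T j (P k\<lparr>carrier := d k ` carrier (P (Suc k))\<rparr>)" if "Suc k + j = n" for j k
    using that
  proof (induction j arbitrary: k)
    case 0
    let ?N = "P k\<lparr>carrier := d k ` carrier (P (Suc k))\<rparr>"
    interpret Pk: rmodule R "P k" by (rule rmodule.intro) (rule PM)
    interpret Pk': rmodule R "P (Suc k)" by (rule rmodule.intro) (rule PM)
    have dk: "mod_map R (P (Suc k)) ?N (d k)" by (rule mod_map_into_carrierI[OF d]) simp
    show ?case
    proof (rule base[OF _ P dk])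
      show "module R ?N" by (rule Pk.submodule_module[OF Pk'.image_submodule[OF PM d]])
      show "x = \<zero>\<^bsub>P (Suc k)\<^esub>" if "x \<in> carrier (P (Suc k))" "d k x = \<zero>\<^bsub>?N\<^esub>" for x
      proof -
        have "x \<in> d (Suc k) ` carrier (P (Suc (Suc k)))" unfolding dd[of k] using that by simp
        then show ?thesis using z[of "Suc k"] 0 by simp
      qed
    qed simp
  next
    case (Suc j)
    let ?N = "P k\<lparr>carrier := d k ` carrier (P (Suc k))\<rparr>"
    interpret Pk: rmodule R "P k" by (rule rmodule.intro) (rule PM)
    interpret Pk': rmodule R "P (Suc k)" by (rule rmodule.intro) (rule PM)
    have dk: "mod_map R (P (Suc k)) ?N (d k)" by (rule mod_map_into_carrierI[OF d]) simp
    show ?case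
    proof (rule step[OF _ P dk])
      show "module R ?N" by (rule Pk.submodule_module[OF Pk'.image_submodule[OF PM d]])
      show "T j (P (Suc k)\<lparr>carrier := {x \<in> carrier (P (Suc k)). d k x = \<zero>\<^bsub>?N\<^esub>}\<rparr>)"
        using Suc.IH[of "Suc k"] Suc.prems unfolding dd[of k] by simp
    qed simp
  qed
  show ?thesis
  proof (cases n)
    case 0
    have "x = \<zero>\<^bsub>P 0\<^esub>" if "x \<in> carrier (P 0)" "aug x = \<zero>\<^bsub>M\<^esub>" for x
    proof -
      have "x \<in> d 0 ` carrier (P 1)" unfolding d0 using that by simp
      then show ?thesis using z[of 0] 0 by simp
    qed
    then show ?thesis unfolding 0 by (rule base'[OF P aug])
  next
    case (Suc m)
    then show ?thesis using step'[OF P aug, of m] claim[of 0 m] d0 by simp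
  qed
qed

text \<open>Instances are the resolution of Y, its torsion subcomplex, and the resolution of the
  local cohomology module. Exactness is left out because the torsion subcomplex may have
  cohomology.\<close>

locale injective_complex =
  fixes R :: "('a, 'r) ring_scheme" and C :: "nat \<Rightarrow> ('a, 'c) module" and d :: "nat \<Rightarrow> 'c \<Rightarrow> 'c"
  assumes baer: "baer R (C n)" and diff: "mod_map R (C n) (C (Suc n)) (d n)"
    and diff_diff: "x \<in> carrier (C n) \<Longrightarrow> d (Suc n) (d n x) = \<zero>\<^bsub>C (Suc (Suc n))\<^esub>"
begin

lemma Cmod: "module R (C n)" by (rule baer_module[OF baer])

lemma Cr: "rmodule R (C n)" by (rule rmodule.intro) (rule Cmod)

lemma diff_zero: "d n \<zero>\<^bsub>C n\<^esub> = \<zero>\<^bsub>C (Suc n)\<^esub>"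
  by (rule rmodule.mod_map_zero[OF Cr Cmod diff])

lemma diff_msub: "x \<in> carrier (C n) \<Longrightarrow> y \<in> carrier (C n) \<Longrightarrow>
    d n (msub R (C n) x y) = msub R (C (Suc n)) (d n x) (d n y)"
  by (rule rmodule.mod_map_msub[OF Cr diff])

lemma coboundary_diff:
  assumes "coboundary R N C d i f" "x \<in> carrier N"
  shows "d i (f x) = \<zero>\<^bsub>C (Suc i)\<^esub>"
  using assms by (cases i) (auto simp: coboundary_simps diff_zero diff_diff mod_map_closed)

text \<open>A primitive of w is extended, not w itself, so the extension is again a coboundary. In
  degree 0 a coboundary is zero and extends by zero.\<close>

lemma coboundary_extend:
  assumes P: "module R P" and K: "submodule K R P"
    and w: "coboundary R (P\<lparr>carrier := K\<rparr>) C d i w"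
  shows "\<exists>w'. mod_map R P (C i) w' \<and> coboundary R P C d i w' \<and> (\<forall>x\<in>K. w' x = w x)"
proof (cases i)
  case 0
  interpret C: rmodule R "C i" by (rule Cr)
  show ?thesis
    using w 0 C.mod_map_zero_map[of P] by (intro exI[of _ "\<lambda>x. \<zero>\<^bsub>C i\<^esub>"]) (simp add: coboundary_simps)
next
  case (Suc j)
  obtain k where k: "mod_map R (P\<lparr>carrier := K\<rparr>) (C j) k" "\<And>x. x \<in> K \<Longrightarrow> w x = d j (k x)"
    using w by (auto simp: Suc coboundary_simps)
  from baer_extend[OF baer P K k(1)] obtain k' where k': "mod_map R P (C j) k'" "\<And>x. x \<in> K \<Longrightarrow> k' x = k x"
    by blast
  show ?thesis
    using k' k(2) mod_map_comp[OF k'(1) diff]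
    by (intro exI[of _ "\<lambda>x. d j (k' x)"]) (auto simp: Suc coboundary_simps)
qed

text \<open>Projectivity turns primitives chosen point by point into a linear one. P enters as a
  cover with zero kernel, because the last syzygy is only isomorphic to a term of the
  resolution.\<close>

lemma coboundary_pointwise:
  assumes P: "projective_module R P" "module R N" "mod_map R P N q" "q ` carrier P = carrier N"
      "\<And>x. x \<in> carrier P \<Longrightarrow> q x = \<zero>\<^bsub>N\<^esub> \<Longrightarrow> x = \<zero>\<^bsub>P\<^esub>"
    and f: "mod_map R N (C i) f" "\<And>x. x \<in> carrier N \<Longrightarrow> f x \<in> coboundaries C d i"
  shows "coboundary R N C d i f"
proof (cases i)
  case 0 then show ?thesis using f(2) by (simp add: coboundary_simps)
next
  case (Suc j)
  then show ?thesis
    using projective_lift_iso[OF P Cmod Cmod diff[of j], of f] f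
    by (simp add: coboundary_simps) metis
qed

lemma Hom_exact_base:
  assumes P: "projective_module R P" "module R N" "mod_map R P N q" "q ` carrier P = carrier N"
      "\<And>x. x \<in> carrier P \<Longrightarrow> q x = \<zero>\<^bsub>N\<^esub> \<Longrightarrow> x = \<zero>\<^bsub>P\<^esub>"
    and ex: "exact_at C d i"
  shows "Hom_exact_at R N C d i"
  unfolding Hom_exact_at_def
proof (intro allI impI)
  fix f assume f: "cocycle R N C d i f"
  show "coboundary R N C d i f"
    by (rule coboundary_pointwise[OF P])
      (use f ex in \<open>auto simp: cocycle_def exact_at_def mod_map_closed\<close>)
qed

lemma Hom_exact_projective:
  assumes P: "projective_module R P" and ex: "exact_at C d i"
  shows "Hom_exact_at R P C d i"
proof -
  have "module R P" using P by (simp add: projective_module_def)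
  then show ?thesis by (rule Hom_exact_base[OF P _ mod_map_id _ _ ex]) simp_all
qed

text \<open>With K the kernel of q, the connecting homomorphism of 0 -> K -> P -> N -> 0 sends the
  class of u on K to the class of f, up to sign. This is how degrees are lowered.\<close>

lemma cocycle_kernel:
  assumes "module R P" "mod_map R P N q" and f: "cocycle R N C d (Suc i) f" and u: "mod_map R P (C i) u"
    and fu: "\<And>x. x \<in> carrier P \<Longrightarrow> f (q x) = d i (u x)" and N: "module R N"
  shows "cocycle R (P\<lparr>carrier := {x \<in> carrier P. q x = \<zero>\<^bsub>N\<^esub>}\<rparr>) C d i u"
proof -
  have "f \<zero>\<^bsub>N\<^esub> = \<zero>\<^bsub>C (Suc i)\<^esub>"
    using f by (intro rmodule.mod_map_zero[OF rmodule.intro[OF N] Cmod]) (simp add: cocycle_def)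
  then show ?thesis
    using fu[symmetric] by (auto simp: cocycle_def intro: mod_map_restrict_carrier[OF u])
qed

text \<open>The primitive u of f q need not descend to N. On K it is a coboundary, which extends to
  a coboundary w on P; then u - w has the same differential as u, vanishes on K, and
  descends.\<close>

lemma Hom_exact_step:
  assumes N: "module R N" and P: "projective_module R P" and q: "mod_map R P N q" "q ` carrier P = carrier N"
    and K: "Hom_exact_at R (P\<lparr>carrier := {x \<in> carrier P. q x = \<zero>\<^bsub>N\<^esub>}\<rparr>) C d i"
    and ex: "exact_at C d (Suc i)"
  shows "Hom_exact_at R N C d (Suc i)"
  unfolding Hom_exact_at_def
proof (intro allI impI)
  let ?K = "{x \<in> carrier P. q x = \<zero>\<^bsub>N\<^esub>}"
  have PM: "module R P" using P by (simp add: projective_module_def)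
  interpret P: rmodule R P by (rule rmodule.intro) (rule PM)
  interpret C: rmodule R "C i" by (rule Cr)
  have KP: "submodule ?K R P" by (rule P.kernel_submodule[OF N q(1)])
  fix f assume f: "cocycle R N C d (Suc i) f"
  then have "coboundary R P C d (Suc i) (\<lambda>x. f (q x))"
    using Hom_exact_projective[OF P ex] cocycle_comp[OF f q(1)] by (simp add: Hom_exact_at_def)
  then obtain u where u: "mod_map R P (C i) u" "\<And>x. x \<in> carrier P \<Longrightarrow> f (q x) = d i (u x)"
    by (auto simp: coboundary_simps)
  have "coboundary R (P\<lparr>carrier := ?K\<rparr>) C d i u"
    using K cocycle_kernel[OF PM q(1) f u N] by (simp add: Hom_exact_at_def)
  from coboundary_extend[OF PM KP this] obtain w where w: "mod_map R P (C i) w"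
    "coboundary R P C d i w" "\<And>x. x \<in> ?K \<Longrightarrow> w x = u x" by blast
  note c = mod_map_closed[OF u(1)] mod_map_closed[OF w(1)]
  have "\<exists>k. mod_map R N (C i) k \<and> (\<forall>x\<in>carrier P. k (q x) = msub R (C i) (u x) (w x))"
    by (rule mod_map_factor_kernel[OF PM Cmod N q C.mod_map_msub_map[OF u(1) w(1)]])
      (use w(3) c in auto)
  then obtain k where k: "mod_map R N (C i) k" "\<And>x. x \<in> carrier P \<Longrightarrow> k (q x) = msub R (C i) (u x) (w x)"
    by blast
  have "f y = d i (k y)" if y: "y \<in> carrier N" for y
  proof -
    obtain x where x: "x \<in> carrier P" "y = q x" using y unfolding q(2)[symmetric] by blast
    have "d i (k y) = msub R (C (Suc i)) (d i (u x)) \<zero>\<^bsub>C (Suc i)\<^esub>"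
      using x k(2) c coboundary_diff[OF w(2)] by (simp add: diff_msub)
    also have "\<dots> = d i (u x)"
      using rmodule.msub_zero[OF Cr mod_map_closed[OF diff c(1)[OF x(1)]]] .
    finally show ?thesis using u(2) x by simp
  qed
  with k(1) show "coboundary R N C d (Suc i) f" by (auto simp: coboundary_simps)
qed

lemma Hom_exact_zero:
  "exact_at C d 0 \<Longrightarrow> Hom_exact_at R N C d 0"
  by (auto simp: Hom_exact_at_def exact_at_def cocycle_def coboundary_simps mod_map_closed)

text \<open>If i >= s + n, all shifts stay in degrees >= s. If s = 0, the shifts may reach degree 0
  before the resolution ends, but there exactness passes to Hom(N, C) for every N; so all degrees
  are covered.\<close>

theorem Hom_exact_above:
  assumes M: "module R M" and res: "projective_resolution R M P D aug" and len: "\<And>k. k > n \<Longrightarrow> zero_mod (P k)"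
    and ex: "\<And>i. i \<ge> s \<Longrightarrow> exact_at C d i" and i: "i \<ge> s + n \<or> s = 0"
  shows "Hom_exact_at R M C d i"
proof -
  have "\<forall>i. i \<ge> s + n \<or> s = 0 \<longrightarrow> Hom_exact_at R M C d i"
  proof (rule projective_resolution_induct[OF M res len,
      where T = "\<lambda>j N. \<forall>i. i \<ge> s + j \<or> s = 0 \<longrightarrow> Hom_exact_at R N C d i" and T' = "\<lambda>j N. \<forall>i. i \<ge> s + j \<or> s = 0 \<longrightarrow> Hom_exact_at R N C d i"])
    fix Q :: "('a, 'e) module" and q j
    assume Q: "projective_module R Q" "mod_map R Q M q" "q ` carrier Q = carrier M"
      and IH: "\<forall>i. i \<ge> s + j \<or> s = 0 \<longrightarrow> Hom_exact_at R (Q\<lparr>carrier := {x \<in> carrier Q. q x = \<zero>\<^bsub>M\<^esub>}\<rparr>) C d i"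
    show "\<forall>i. i \<ge> s + Suc j \<or> s = 0 \<longrightarrow> Hom_exact_at R M C d i"
    proof (intro allI impI)
      fix i assume i: "i \<ge> s + Suc j \<or> s = 0"
      show "Hom_exact_at R M C d i"
      proof (cases i)
        case 0
        then show ?thesis using i ex by (simp add: Hom_exact_zero)
      next
        case (Suc i')
        then show ?thesis using Hom_exact_step[OF M Q, of i'] IH ex[of "Suc i'"] i by auto
      qed
    qed
  next
    fix N Q :: "('a, 'e) module" and q j
    assume N: "module R N" and Q: "projective_module R Q" "mod_map R Q N q" "q ` carrier Q = carrier N"
      and IH: "\<forall>i. i \<ge> s + j \<or> s = 0 \<longrightarrow> Hom_exact_at R (Q\<lparr>carrier := {x \<in> carrier Q. q x = \<zero>\<^bsub>N\<^esub>}\<rparr>) C d i"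
    show "\<forall>i. i \<ge> s + Suc j \<or> s = 0 \<longrightarrow> Hom_exact_at R N C d i"
    proof (intro allI impI)
      fix i assume i: "i \<ge> s + Suc j \<or> s = 0"
      show "Hom_exact_at R N C d i"
      proof (cases i)
        case 0
        then show ?thesis using i ex by (simp add: Hom_exact_zero)
      next
        case (Suc i')
        then show ?thesis using Hom_exact_step[OF N Q, of i'] IH ex[of "Suc i'"] i by auto
      qed
    qed
  next
    fix N Q :: "('a, 'e) module" and q
    assume Q: "module R N" "projective_module R Q" "mod_map R Q N q" "q ` carrier Q = carrier N"
      "\<And>x. x \<in> carrier Q \<Longrightarrow> q x = \<zero>\<^bsub>N\<^esub> \<Longrightarrow> x = \<zero>\<^bsub>Q\<^esub>"
    show "\<forall>i. i \<ge> s + 0 \<or> s = 0 \<longrightarrow> Hom_exact_at R N C d i"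
      using Hom_exact_base[OF Q(2,1,3,4,5) ex] by auto
  next
    fix Q :: "('a, 'e) module" and q
    assume Q: "projective_module R Q" "mod_map R Q M q" "q ` carrier Q = carrier M"
      "\<And>x. x \<in> carrier Q \<Longrightarrow> q x = \<zero>\<^bsub>M\<^esub> \<Longrightarrow> x = \<zero>\<^bsub>Q\<^esub>"
    show "\<forall>i. i \<ge> s + 0 \<or> s = 0 \<longrightarrow> Hom_exact_at R M C d i"
      using Hom_exact_base[OF Q(1) M Q(2,3,4) ex] by auto
  qed
  with i show ?thesis by blast
qed

end

section \<open>Comparison of complexes\<close>

text \<open>The last three assumptions say that \<phi> 0 induces an isomorphism from H^c(C) to
  H^0(I). In higher degrees both complexes are exact; below c nothing is assumed about the
  cohomology of C.\<close>

locale complex_comparison =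
  C: injective_complex R C dC + I: injective_complex R I dI
  for R :: "('a, 'r) ring_scheme" and C :: "nat \<Rightarrow> ('a, 'c) module" and dC
    and I :: "nat \<Rightarrow> ('a, 'e) module" and dI +
  fixes c :: nat and \<phi> :: "nat \<Rightarrow> 'c \<Rightarrow> 'e"
  assumes phi: "mod_map R (C (c + p)) (I p) (\<phi> p)"
    and phi_diff: "x \<in> carrier (C (c + p)) \<Longrightarrow> dI p (\<phi> p x) = \<phi> (Suc p) (dC (c + p) x)"
    and C_exact: "i > c \<Longrightarrow> exact_at C dC i"
    and I_exact: "exact_at I dI (Suc p)"
    and phi_onto: "y \<in> carrier (I 0) \<Longrightarrow> dI 0 y = \<zero>\<^bsub>I 1\<^esub> \<Longrightarrow>
      \<exists>z\<in>carrier (C c). dC c z = \<zero>\<^bsub>C (Suc c)\<^esub> \<and> \<phi> 0 z = y"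
    and phi_kernel: "z \<in> carrier (C c) \<Longrightarrow> dC c z = \<zero>\<^bsub>C (Suc c)\<^esub> \<Longrightarrow> \<phi> 0 z = \<zero>\<^bsub>I 0\<^esub> \<Longrightarrow>
      z \<in> coboundaries C dC c"
    and phi_coboundary: "z \<in> coboundaries C dC c \<Longrightarrow> \<phi> 0 z = \<zero>\<^bsub>I 0\<^esub>"
begin

text \<open>Surjectivity and injectivity of the map that \<open>\<phi>\<close> induces from the cohomology of \<open>Hom(N, C)\<close>
  in degree \<open>c + p\<close> to the cohomology of \<open>Hom(N, I)\<close> in degree \<open>p\<close>\<close>

definition cohom_surj :: "nat \<Rightarrow> ('a, 'n) module \<Rightarrow> bool"
  where "cohom_surj p N \<longleftrightarrow> (\<forall>g. cocycle R N I dI p g \<longrightarrow>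
    (\<exists>f. cocycle R N C dC (c + p) f \<and> coboundary R N I dI p (\<lambda>x. msub R (I p) (g x) (\<phi> p (f x)))))"

definition cohom_inj :: "nat \<Rightarrow> ('a, 'n) module \<Rightarrow> bool"
  where "cohom_inj p N \<longleftrightarrow> (\<forall>f. cocycle R N C dC (c + p) f \<longrightarrow>
    coboundary R N I dI p (\<lambda>x. \<phi> p (f x)) \<longrightarrow> coboundary R N C dC (c + p) f)"

text \<open>By \<open>phi_onto\<close> the cycles of degree c map onto the kernel of dI 0, and
  projectivity lifts g through this surjection.\<close>

lemma cohom_surj_base:
  assumes P: "projective_module R P" "module R N" "mod_map R P N q" "q ` carrier P = carrier N"
      "\<And>x. x \<in> carrier P \<Longrightarrow> q x = \<zero>\<^bsub>N\<^esub> \<Longrightarrow> x = \<zero>\<^bsub>P\<^esub>"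
  shows "cohom_surj 0 N"
  unfolding cohom_surj_def
proof (intro allI impI)
  interpret Cc: rmodule R "C c" by (rule C.Cr)
  interpret I0: rmodule R "I 0" by (rule I.Cr)
  fix g assume g: "cocycle R N I dI 0 g"
  let ?Z = "{x \<in> carrier (C c). dC c x = \<zero>\<^bsub>C (Suc c)\<^esub>}"
  have Z: "submodule ?Z R (C c)" by (rule Cc.kernel_submodule[OF C.Cmod C.diff])
  have phi0: "mod_map R (C c\<lparr>carrier := ?Z\<rparr>) (I 0) (\<phi> 0)"
    using phi[of 0] by (intro mod_map_restrict_carrier) auto
  have g': "mod_map R N (I 0) g" using g by (simp add: cocycle_def)
  have "\<exists>h. mod_map R N (C c\<lparr>carrier := ?Z\<rparr>) h \<and> (\<forall>x\<in>carrier N. \<phi> 0 (h x) = g x)"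
  proof (rule projective_lift_iso[OF P Cc.submodule_module[OF Z] I.Cmod phi0 g'])
    fix x assume x: "x \<in> carrier N"
    have "g x \<in> carrier (I 0)" "dI 0 (g x) = \<zero>\<^bsub>I 1\<^esub>"
      using g x by (auto simp: cocycle_def mod_map_closed)
    from phi_onto[OF this] obtain z where "z \<in> ?Z" "\<phi> 0 z = g x" by blast
    then show "g x \<in> \<phi> 0 ` carrier (C c\<lparr>carrier := ?Z\<rparr>)" by (intro image_eqI[of _ _ z]) simp_all
  qed
  then obtain f where f: "mod_map R N (C c\<lparr>carrier := ?Z\<rparr>) f" "\<And>x. x \<in> carrier N \<Longrightarrow> \<phi> 0 (f x) = g x"
    by blast
  have "mod_map R N (C c) f" by (rule mod_map_from_carrier[OF f(1)]) auto
  moreover have "dC c (f x) = \<zero>\<^bsub>C (Suc c)\<^esub>" if "x \<in> carrier N" for x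
    using mod_map_closed[OF f(1) that] by simp
  ultimately show "\<exists>f. cocycle R N C dC (c + 0) f \<and>
      coboundary R N I dI 0 (\<lambda>x. msub R (I 0) (g x) (\<phi> 0 (f x)))"
    using f(2) mod_map_closed[OF g'] by (intro exI[of _ f]) (simp add: cocycle_def coboundary_simps)
qed

lemma cohom_inj_base:
  assumes P: "projective_module R P" "module R N" "mod_map R P N q" "q ` carrier P = carrier N"
      "\<And>x. x \<in> carrier P \<Longrightarrow> q x = \<zero>\<^bsub>N\<^esub> \<Longrightarrow> x = \<zero>\<^bsub>P\<^esub>"
  shows "cohom_inj 0 N"
  unfolding cohom_inj_def
proof (intro allI impI)
  fix f assume f: "cocycle R N C dC (c + 0) f" "coboundary R N I dI 0 (\<lambda>x. \<phi> 0 (f x))"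
  show "coboundary R N C dC (c + 0) f"
    by (rule C.coboundary_pointwise[OF P])
      (use f phi_kernel in \<open>auto simp: cocycle_def coboundary_simps mod_map_closed\<close>)
qed

lemma phi_zero: "\<phi> p \<zero>\<^bsub>C (c + p)\<^esub> = \<zero>\<^bsub>I p\<^esub>"
  by (rule rmodule.mod_map_zero[OF C.Cr I.Cmod phi])

text \<open>For p > 0 every cocycle on P with values in I is a coboundary, so f = 0 serves. The
  injectivity step relies on this in all degrees p.\<close>

lemma cohom_surj_projective:
  assumes P: "projective_module R P"
  shows "cohom_surj p P"
proof (cases p)
  case 0
  have "module R P" using P by (simp add: projective_module_def)
  then have "cohom_surj 0 P" by (rule cohom_surj_base[OF P _ mod_map_id]) simp_all
  then show ?thesis by (simp add: 0)
next
  case (Suc p')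
  interpret Cp: rmodule R "C (c + p)" by (rule C.Cr)
  interpret Ip: rmodule R "I p" by (rule I.Cr)
  show ?thesis
    unfolding cohom_surj_def
  proof (intro allI impI)
    fix g assume g: "cocycle R P I dI p g"
    then have "coboundary R P I dI p g"
      using I.Hom_exact_projective[OF P I_exact] by (simp add: Hom_exact_at_def Suc)
    moreover have "msub R (I p) (g x) (\<phi> p \<zero>\<^bsub>C (c + p)\<^esub>) = g x" if "x \<in> carrier P" for x
      unfolding phi_zero using g that by (intro Ip.msub_zero) (auto simp: cocycle_def mod_map_closed)
    ultimately have "coboundary R P I dI p (\<lambda>x. msub R (I p) (g x) (\<phi> p \<zero>\<^bsub>C (c + p)\<^esub>))"
      by (subst coboundary_cong)
    moreover have "cocycle R P C dC (c + p) (\<lambda>x. \<zero>\<^bsub>C (c + p)\<^esub>)"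
      using Cp.mod_map_zero_map[of P] by (simp add: cocycle_def C.diff_zero)
    ultimately show "\<exists>f. cocycle R P C dC (c + p) f \<and>
        coboundary R P I dI p (\<lambda>x. msub R (I p) (g x) (\<phi> p (f x)))" by blast
  qed
qed

text \<open>The class of g is carried down to K, represented there through \<phi> by a cocycle v,
  and brought back up by extending v to P and applying the differential.\<close>

lemma cohom_surj_step:
  assumes N: "module R N" and P: "projective_module R P" and q: "mod_map R P N q" "q ` carrier P = carrier N"
    and K: "cohom_surj p (P\<lparr>carrier := {x \<in> carrier P. q x = \<zero>\<^bsub>N\<^esub>}\<rparr>)"
  shows "cohom_surj (Suc p) N"
  unfolding cohom_surj_def
proof (intro allI impI)
  let ?K = "{x \<in> carrier P. q x = \<zero>\<^bsub>N\<^esub>}" and ?i = "c + p"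
  have PM: "module R P" using P by (simp add: projective_module_def)
  interpret P: rmodule R P by (rule rmodule.intro) (rule PM)
  interpret Ip: rmodule R "I p" by (rule I.Cr)
  interpret Ip': rmodule R "I (Suc p)" by (rule I.Cr)
  interpret Ci: rmodule R "C ?i" by (rule C.Cr)
  have KP: "submodule ?K R P" by (rule P.kernel_submodule[OF N q(1)])
  fix g assume g: "cocycle R N I dI (Suc p) g"
  then have "coboundary R P I dI (Suc p) (\<lambda>x. g (q x))"
    using I.Hom_exact_projective[OF P I_exact] cocycle_comp[OF g q(1)] by (simp add: Hom_exact_at_def)
  then obtain u where u: "mod_map R P (I p) u" "\<And>x. x \<in> carrier P \<Longrightarrow> g (q x) = dI p (u x)"
    by (auto simp: coboundary_simps)
  from K I.cocycle_kernel[OF PM q(1) g u N] obtain v where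
    v: "cocycle R (P\<lparr>carrier := ?K\<rparr>) C dC ?i v"
      "coboundary R (P\<lparr>carrier := ?K\<rparr>) I dI p (\<lambda>x. msub R (I p) (u x) (\<phi> p (v x)))"
    unfolding cohom_surj_def by blast
  from I.coboundary_extend[OF PM KP v(2)] obtain w where w: "mod_map R P (I p) w"
    "coboundary R P I dI p w" "\<And>x. x \<in> ?K \<Longrightarrow> w x = msub R (I p) (u x) (\<phi> p (v x))" by blast
  have "mod_map R (P\<lparr>carrier := ?K\<rparr>) (C ?i) v" using v(1) by (simp add: cocycle_def)
  from baer_extend[OF C.baer PM KP this] obtain v' where
    v': "mod_map R P (C ?i) v'" "\<And>x. x \<in> ?K \<Longrightarrow> v' x = v x" by blast
  \<comment> \<open>The differential of v' vanishes on K because v is a cocycle there. The map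
    induced on N is the cocycle sought.\<close>
  have "\<exists>f. mod_map R N (C (Suc ?i)) f \<and> (\<forall>x\<in>carrier P. f (q x) = dC ?i (v' x))"
    by (rule mod_map_factor_kernel[OF PM C.Cmod N q mod_map_comp[OF v'(1) C.diff]])
      (use v' v(1) in \<open>auto simp: cocycle_def\<close>)
  then obtain f where f: "mod_map R N (C (Suc ?i)) f" "\<And>x. x \<in> carrier P \<Longrightarrow> f (q x) = dC ?i (v' x)"
    by blast
  note phv = mod_map_comp[OF v'(1) phi]
  note c = mod_map_closed[OF u(1)] mod_map_closed[OF w(1)] mod_map_closed[OF v'(1)] mod_map_closed[OF phv]
    mod_map_closed[OF I.diff] mod_map_closed[OF C.diff]
  \<comment> \<open>On K the correction w equals u - \<phi> v', so \<open>?t\<close> descends to N.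
    As w has zero differential, the induced map is a primitive of the difference between g and
    \<phi> f.\<close>
  let ?t = "\<lambda>x. msub R (I p) (msub R (I p) (u x) (\<phi> p (v' x))) (w x)"
  have t: "mod_map R P (I p) ?t"
    by (intro Ip.mod_map_msub_map u w phv)
  have "\<exists>k. mod_map R N (I p) k \<and> (\<forall>x\<in>carrier P. k (q x) = ?t x)"
  proof (rule mod_map_factor_kernel[OF PM I.Cmod N q t])
    fix x assume x: "x \<in> carrier P" "q x = \<zero>\<^bsub>N\<^esub>"
    then have "w x = msub R (I p) (u x) (\<phi> p (v' x))" using w(3) v'(2) by simp
    then show "?t x = \<zero>\<^bsub>I p\<^esub>" using c x by simp
  qed
  then obtain k where k: "mod_map R N (I p) k" "\<And>x. x \<in> carrier P \<Longrightarrow> k (q x) = ?t x" by blast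
  have "cocycle R N C dC (c + Suc p) f"
    using f q(2) v'(1) C.diff_diff[of _ ?i] mod_map_closed[OF v'(1)]
    by (auto simp: cocycle_def image_iff set_eq_iff) metis
  moreover have "msub R (I (Suc p)) (g y) (\<phi> (Suc p) (f y)) = dI p (k y)" if y: "y \<in> carrier N" for y
  proof -
    obtain x where x: "x \<in> carrier P" "y = q x" using y unfolding q(2)[symmetric] by blast
    have "dI p (k y) = msub R (I (Suc p)) (msub R (I (Suc p)) (dI p (u x)) (dI p (\<phi> p (v' x)))) (dI p (w x))"
      using x c by (simp add: k(2) I.diff_msub)
    also have "\<dots> = msub R (I (Suc p)) (g y) (\<phi> (Suc p) (f y))"
      using x c by (simp add: I.coboundary_diff[OF w(2)] u(2) f(2) phi_diff[symmetric])
    finally show ?thesis by simp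
  qed
  ultimately show "\<exists>f. cocycle R N C dC (c + Suc p) f \<and>
      coboundary R N I dI (Suc p) (\<lambda>x. msub R (I (Suc p)) (g x) (\<phi> (Suc p) (f x)))"
    using k(1) by (auto simp: coboundary_simps)
qed

text \<open>A primitive u of f q restricts to a cocycle on K, but \<phi> u need not be a coboundary
  there. The defect e = \<phi> u - h q is a cocycle on P, and surjectivity for the projective module
  P supplies a cocycle s that repairs u, much as in the five lemma.\<close>

lemma cohom_inj_step:
  assumes N: "module R N" and P: "projective_module R P" and q: "mod_map R P N q" "q ` carrier P = carrier N"
    and K: "cohom_inj p (P\<lparr>carrier := {x \<in> carrier P. q x = \<zero>\<^bsub>N\<^esub>}\<rparr>)"
  shows "cohom_inj (Suc p) N"
  unfolding cohom_inj_def
proof (intro allI impI)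
  let ?K = "{x \<in> carrier P. q x = \<zero>\<^bsub>N\<^esub>}" and ?i = "c + p"
  let ?KM = "P\<lparr>carrier := ?K\<rparr>"
  have PM: "module R P" using P by (simp add: projective_module_def)
  interpret P: rmodule R P by (rule rmodule.intro) (rule PM)
  interpret Ip: rmodule R "I p" by (rule I.Cr)
  interpret Ci: rmodule R "C ?i" by (rule C.Cr)
  interpret Ci': rmodule R "C (Suc ?i)" by (rule C.Cr)
  have KP: "submodule ?K R P" by (rule P.kernel_submodule[OF N q(1)])
  have incl: "mod_map R ?KM P (\<lambda>x. x)" by (rule mod_map_incl) auto
  fix f assume f: "cocycle R N C dC (c + Suc p) f"
    and "coboundary R N I dI (Suc p) (\<lambda>x. \<phi> (Suc p) (f x))"
  then obtain h where h: "mod_map R N (I p) h" "\<And>y. y \<in> carrier N \<Longrightarrow> \<phi> (Suc p) (f y) = dI p (h y)"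
    by (auto simp: coboundary_simps)
  have f': "cocycle R N C dC (Suc ?i) f" using f by simp
  then have "coboundary R P C dC (Suc ?i) (\<lambda>x. f (q x))"
    using C.Hom_exact_projective[OF P C_exact] cocycle_comp[OF f' q(1)] by (simp add: Hom_exact_at_def)
  then obtain u where u: "mod_map R P (C ?i) u" "\<And>x. x \<in> carrier P \<Longrightarrow> f (q x) = dC ?i (u x)"
    by (auto simp: coboundary_simps)
  note qc = mod_map_closed[OF q(1)]
  note phu = mod_map_comp[OF u(1) phi] and hq = mod_map_comp[OF q(1) h(1)]
  let ?e = "\<lambda>x. msub R (I p) (\<phi> p (u x)) (h (q x))"
  have e: "mod_map R P (I p) ?e" by (rule Ip.mod_map_msub_map[OF phu hq])
  have "dI p (?e x) = \<zero>\<^bsub>I (Suc p)\<^esub>" if x: "x \<in> carrier P" for x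
  proof -
    have "dI p (\<phi> p (u x)) = dI p (h (q x))"
      using x u mod_map_closed[OF u(1)] h(2)[OF qc[OF x]] by (simp add: phi_diff)
    then show ?thesis
      using mod_map_closed[OF phu x] mod_map_closed[OF hq x] mod_map_closed[OF I.diff]
      by (simp add: I.diff_msub rmodule.msub_self[OF I.Cr])
  qed
  then have "cocycle R P I dI p ?e" using e by (simp add: cocycle_def)
  then obtain s where s: "cocycle R P C dC ?i s"
    "coboundary R P I dI p (\<lambda>x. msub R (I p) (?e x) (\<phi> p (s x)))"
    using cohom_surj_projective[OF P, of p] unfolding cohom_surj_def by blast
  have sm: "mod_map R P (C ?i) s" using s(1) by (simp add: cocycle_def)
  \<comment> \<open>Subtracting the cocycle s does not change the differential. On K the term h q
    vanishes, so \<phi> u1 equals e - \<phi> s there, which is a coboundary, and the hypothesis on K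
    applies.\<close>
  let ?u1 = "\<lambda>x. msub R (C ?i) (u x) (s x)"
  have u1: "mod_map R P (C ?i) ?u1" by (rule Ci.mod_map_msub_map[OF u(1) sm])
  have du1: "f (q x) = dC ?i (?u1 x)" if "x \<in> carrier P" for x
    using that u s(1) mod_map_closed[OF u(1)] mod_map_closed[OF sm] mod_map_closed[OF C.diff]
    by (simp add: C.diff_msub cocycle_def)
  have "coboundary R ?KM I dI p (\<lambda>x. msub R (I p) (?e x) (\<phi> p (s x)))"
    by (rule coboundary_comp[OF s(2) incl])
  moreover have "msub R (I p) (?e x) (\<phi> p (s x)) = \<phi> p (?u1 x)" if "x \<in> carrier ?KM" for x
    using that mod_map_closed[OF u(1)] mod_map_closed[OF sm] mod_map_closed[OF phu]
      rmodule.mod_map_zero[OF rmodule.intro[OF N] I.Cmod h(1)]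
    by (simp add: rmodule.mod_map_msub[OF C.Cr phi])
  ultimately have "coboundary R ?KM I dI p (\<lambda>x. \<phi> p (?u1 x))"
    using coboundary_cong[of ?KM "\<lambda>x. msub R (I p) (?e x) (\<phi> p (s x))" "\<lambda>x. \<phi> p (?u1 x)" R I dI p] by blast
  moreover have "cocycle R ?KM C dC ?i ?u1"
    by (rule C.cocycle_kernel[OF PM q(1) f' u1 du1 N])
  ultimately have "coboundary R ?KM C dC ?i ?u1" using K unfolding cohom_inj_def by blast
  from C.coboundary_extend[OF PM KP this] obtain w where w: "mod_map R P (C ?i) w"
    "coboundary R P C dC ?i w" "\<And>x. x \<in> ?K \<Longrightarrow> w x = ?u1 x" by blast
  note c = mod_map_closed[OF u1] mod_map_closed[OF w(1)] mod_map_closed[OF C.diff]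
  have "\<exists>k. mod_map R N (C ?i) k \<and> (\<forall>x\<in>carrier P. k (q x) = msub R (C ?i) (?u1 x) (w x))"
    by (rule mod_map_factor_kernel[OF PM C.Cmod N q Ci.mod_map_msub_map[OF u1 w(1)]])
      (use w(3) c in auto)
  then obtain k where k: "mod_map R N (C ?i) k"
    "\<And>x. x \<in> carrier P \<Longrightarrow> k (q x) = msub R (C ?i) (?u1 x) (w x)" by blast
  have "f y = dC ?i (k y)" if y: "y \<in> carrier N" for y
  proof -
    obtain x where x: "x \<in> carrier P" "y = q x" using y unfolding q(2)[symmetric] by blast
    have "dC ?i (k y) = msub R (C (Suc ?i)) (dC ?i (?u1 x)) (dC ?i (w x))"
      unfolding x(2) k(2)[OF x(1)] by (rule C.diff_msub[OF c(1,2)[OF x(1)]])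
    also have "\<dots> = dC ?i (?u1 x)"
      using c(3)[OF c(1)[OF x(1)]] C.coboundary_diff[OF w(2) x(1)] by simp
    finally show ?thesis using du1 x by simp
  qed
  with k(1) show "coboundary R N C dC (c + Suc p) f" by (auto simp: coboundary_simps)
qed

theorem cohom_bijective:
  assumes M: "module R M" and res: "projective_resolution R M P D aug" and len: "\<And>k. k > n \<Longrightarrow> zero_mod (P k)"
  shows "cohom_surj n M \<and> cohom_inj n M"
  by (rule projective_resolution_induct[OF M res len,
      where T = "\<lambda>j N. cohom_surj j N \<and> cohom_inj j N" and T' = "\<lambda>j N. cohom_surj j N \<and> cohom_inj j N"])
    (use M in \<open>auto intro: cohom_surj_base cohom_inj_base cohom_surj_step cohom_inj_step\<close>)

end

section \<open>Direct limits\<close>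

lemma dl_trans_add: "dl_trans \<phi> n (k + l) x = dl_trans \<phi> (n + k) l (dl_trans \<phi> n k x)"
  by (induction l) (simp_all add: add.assoc)

text \<open>The elementary test for a direct limit: the maps to L are compatible and jointly onto,
  and what they kill dies at a later stage. Here L will be an Ext module or the zero module.\<close>

locale limit_cocone =
  fixes R :: "('a, 'r) ring_scheme" and G :: "nat \<Rightarrow> ('a, 'g) module" and \<phi> :: "nat \<Rightarrow> 'g \<Rightarrow> 'g"
    and L :: "('a, 'l) module" and \<theta> :: "nat \<Rightarrow> 'g \<Rightarrow> 'l"
  assumes G: "module R (G n)" and phi: "mod_map R (G n) (G (Suc n)) (\<phi> n)"
    and L: "module R L" and theta: "mod_map R (G n) L (\<theta> n)"
    and theta_phi: "x \<in> carrier (G n) \<Longrightarrow> \<theta> (Suc n) (\<phi> n x) = \<theta> n x"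
    and theta_kernel: "x \<in> carrier (G n) \<Longrightarrow> \<theta> n x = \<zero>\<^bsub>L\<^esub> \<Longrightarrow> \<exists>k. dl_trans \<phi> n k x = \<zero>\<^bsub>G (n + k)\<^esub>"
    and theta_onto: "l \<in> carrier L \<Longrightarrow> \<exists>n x. x \<in> carrier (G n) \<and> \<theta> n x = l"
begin

lemma trans_map: "mod_map R (G n) (G (n + k)) (dl_trans \<phi> n k)"
proof (induction k)
  case 0
  have "dl_trans \<phi> n 0 = (\<lambda>x. x)" by (simp add: fun_eq_iff)
  then show ?case by (simp add: mod_map_id)
next
  case (Suc k)
  have "dl_trans \<phi> n (Suc k) = (\<lambda>x. \<phi> (n + k) (dl_trans \<phi> n k x))" by (simp add: fun_eq_iff)
  then show ?case using mod_map_comp[OF Suc phi] by simp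
qed

lemma theta_trans: "x \<in> carrier (G n) \<Longrightarrow> \<theta> (n + k) (dl_trans \<phi> n k x) = \<theta> n x"
  by (induction k) (simp_all add: theta_phi mod_map_closed[OF trans_map])

text \<open>The equivalence class in \<open>direct_limit\<close> that corresponds to l.\<close>

definition fibre :: "'l \<Rightarrow> (nat \<times> 'g) set"
  where "fibre l = {(n, x). x \<in> carrier (G n) \<and> \<theta> n x = l}"

lemma dl_rel_iff:
  "((n, x), (m, y)) \<in> dl_rel G \<phi> \<longleftrightarrow> x \<in> carrier (G n) \<and> y \<in> carrier (G m) \<and> \<theta> n x = \<theta> m y"
proof
  assume "((n, x), (m, y)) \<in> dl_rel G \<phi>"
  then obtain k l where "x \<in> carrier (G n)" "y \<in> carrier (G m)" "n + k = m + l"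
    "dl_trans \<phi> n k x = dl_trans \<phi> m l y" by (auto simp: dl_rel_def)
  then show "x \<in> carrier (G n) \<and> y \<in> carrier (G m) \<and> \<theta> n x = \<theta> m y"
    using theta_trans[of x n k] theta_trans[of y m l] by simp
next
  assume a: "x \<in> carrier (G n) \<and> y \<in> carrier (G m) \<and> \<theta> n x = \<theta> m y"
  interpret G: rmodule R "G (n + m)" by (rule rmodule.intro) (rule G)
  interpret L: rmodule R L by (rule rmodule.intro) (rule L)
  let ?x = "dl_trans \<phi> n m x" and ?y = "dl_trans \<phi> m n y"
  have mn: "m + n = n + m" by simp
  have c: "?x \<in> carrier (G (n + m))" "?y \<in> carrier (G (n + m))"
    using a mod_map_closed[OF trans_map, of x n m] mod_map_closed[OF trans_map, of y m n]
    unfolding mn by simp_all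
  have "\<theta> (n + m) ?x = \<theta> (n + m) ?y"
    using a theta_trans[of x n m] theta_trans[of y m n] unfolding mn by simp
  then have "\<theta> (n + m) (msub R (G (n + m)) ?x ?y) = \<zero>\<^bsub>L\<^esub>"
    using mod_map_closed[OF theta c(2)] by (simp only: G.mod_map_msub[OF theta c] L.msub_self)
  then obtain k where "dl_trans \<phi> (n + m) k (msub R (G (n + m)) ?x ?y) = \<zero>\<^bsub>G (n + m + k)\<^esub>"
    using theta_kernel[OF G.msub_closed[OF c]] by blast
  then have "dl_trans \<phi> (n + m) k ?x = dl_trans \<phi> (n + m) k ?y"
    using rmodule.msub_zero_iff[OF rmodule.intro[OF G] mod_map_closed[OF trans_map c(1)] mod_map_closed[OF trans_map c(2)]]
    by (simp only: G.mod_map_msub[OF trans_map c])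
  then have "dl_trans \<phi> n (m + k) x = dl_trans \<phi> m (n + k) y"
    unfolding dl_trans_add mn .
  moreover have "n + (m + k) = m + (n + k)" by simp
  ultimately show "((n, x), (m, y)) \<in> dl_rel G \<phi>"
    using a unfolding dl_rel_def by blast
qed

lemma dl_rel_class: "x \<in> carrier (G n) \<Longrightarrow> dl_rel G \<phi> `` {(n, x)} = fibre (\<theta> n x)"
  by (auto simp: fibre_def dl_rel_iff)

lemma fibre_nonempty: "l \<in> carrier L \<Longrightarrow> fibre l \<noteq> {}"
  using theta_onto by (fastforce simp: fibre_def)

lemma fibre_inj: "inj_on fibre (carrier L)"
proof (rule inj_onI)
  fix l l' assume "l \<in> carrier L" "l' \<in> carrier L" and eq: "fibre l = fibre l'"
  then obtain n x where "(n, x) \<in> fibre l" using fibre_nonempty by fastforce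
  then show "l = l'" using eq unfolding fibre_def by blast
qed

lemma limit_carrier: "carrier (direct_limit G \<phi>) = fibre ` carrier L"
proof
  show "carrier (direct_limit G \<phi>) \<subseteq> fibre ` carrier L"
    using mod_map_closed[OF theta] by (auto simp: direct_limit_def quotient_def dl_rel_class)
  show "fibre ` carrier L \<subseteq> carrier (direct_limit G \<phi>)"
  proof
    fix F assume "F \<in> fibre ` carrier L"
    then obtain l where l: "l \<in> carrier L" "F = fibre l" by blast
    then obtain n x where "x \<in> carrier (G n)" "\<theta> n x = l" using theta_onto by blast
    then have "F = dl_rel G \<phi> `` {(n, x)}" "(n, x) \<in> (SIGMA n:UNIV. carrier (G n))"
      using l by (auto simp: dl_rel_class)
    then show "F \<in> carrier (direct_limit G \<phi>)" by (auto simp: direct_limit_def quotient_def)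
  qed
qed

lemma limit_zero: "\<zero>\<^bsub>direct_limit G \<phi>\<^esub> = fibre \<zero>\<^bsub>L\<^esub>"
proof -
  interpret G: rmodule R "G 0" by (rule rmodule.intro) (rule G)
  show ?thesis using G.mod_map_zero[OF L theta] by (simp add: direct_limit_def dl_rel_class)
qed

lemma UN_eq_constant: "S \<noteq> {} \<Longrightarrow> (\<And>p. p \<in> S \<Longrightarrow> h p = c) \<Longrightarrow> (\<Union>p\<in>S. h p) = c"
  by auto

lemma fibre_map: "mod_map R L (direct_limit G \<phi>) fibre"
proof (rule mod_mapI)
  fix l l' assume l: "l \<in> carrier L" "l' \<in> carrier L"
  interpret L: rmodule R L by (rule rmodule.intro) (rule L)
  have "dl_rel G \<phi> `` {(n + m, dl_trans \<phi> n m x \<oplus>\<^bsub>G (n + m)\<^esub> dl_trans \<phi> m n y)} = fibre (l \<oplus>\<^bsub>L\<^esub> l')"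
    if "(n, x) \<in> fibre l" "(m, y) \<in> fibre l'" for n x m y
  proof -
    interpret G: rmodule R "G (n + m)" by (rule rmodule.intro) (rule G)
    let ?x = "dl_trans \<phi> n m x" and ?y = "dl_trans \<phi> m n y"
    have mn: "m + n = n + m" by simp
    have c: "?x \<in> carrier (G (n + m))" "?y \<in> carrier (G (n + m))"
      using that mod_map_closed[OF trans_map, of x n m] mod_map_closed[OF trans_map, of y m n]
      unfolding mn by (simp_all add: fibre_def)
    have "\<theta> (n + m) ?x = l" "\<theta> (n + m) ?y = l'"
      using that theta_trans[of x n m] theta_trans[of y m n] unfolding mn by (simp_all add: fibre_def)
    then have "\<theta> (n + m) (?x \<oplus>\<^bsub>G (n + m)\<^esub> ?y) = l \<oplus>\<^bsub>L\<^esub> l'"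
      by (simp only: mod_map_add[OF theta c])
    then show ?thesis using c by (simp add: dl_rel_class)
  qed
  then have "(\<Union>(n, x)\<in>fibre l. \<Union>(m, y)\<in>fibre l'.
      dl_rel G \<phi> `` {(n + m, dl_trans \<phi> n m x \<oplus>\<^bsub>G (n + m)\<^esub> dl_trans \<phi> m n y)}) = fibre (l \<oplus>\<^bsub>L\<^esub> l')"
    by (intro UN_eq_constant fibre_nonempty l; (clarify, intro UN_eq_constant fibre_nonempty l; clarify)?) blast
  then show "fibre (l \<oplus>\<^bsub>L\<^esub> l') = fibre l \<oplus>\<^bsub>direct_limit G \<phi>\<^esub> fibre l'"
    by (simp add: direct_limit_def)
next
  fix r l assume l: "r \<in> carrier R" "l \<in> carrier L"
  have "dl_rel G \<phi> `` {(n, r \<odot>\<^bsub>G n\<^esub> x)} = fibre (r \<odot>\<^bsub>L\<^esub> l)" if "(n, x) \<in> fibre l" for n x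
  proof -
    have x: "x \<in> carrier (G n)" "\<theta> n x = l" using that by (simp_all add: fibre_def)
    show ?thesis
      using dl_rel_class[OF module.smult_closed[OF G l(1) x(1)]] mod_map_smult[OF theta l(1) x(1)] x(2)
      by simp
  qed
  then have "(\<Union>(n, x)\<in>fibre l. dl_rel G \<phi> `` {(n, r \<odot>\<^bsub>G n\<^esub> x)}) = fibre (r \<odot>\<^bsub>L\<^esub> l)"
    by (intro UN_eq_constant fibre_nonempty l; clarify) blast
  then show "fibre (r \<odot>\<^bsub>L\<^esub> l) = r \<odot>\<^bsub>direct_limit G \<phi>\<^esub> fibre l"
    by (simp add: direct_limit_def)
qed (simp add: limit_carrier)

lemma limit_isomorphic: "mod_isomorphic R (direct_limit G \<phi>) L"
proof -
  interpret L: rmodule R L by (rule rmodule.intro) (rule L)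
  let ?D = "direct_limit G \<phi>" and ?g = "inv_into (carrier L) fibre"
  have inv: "?g (fibre l) = l" if "l \<in> carrier L" for l using fibre_inj that by simp
  have "module R ?D"
    by (rule module_image[OF L fibre_map]) (simp_all add: limit_carrier limit_zero)
  moreover have "mod_map R ?D L ?g"
  proof (rule mod_mapI)
    show "?g F \<in> carrier L" if "F \<in> carrier ?D" for F using that by (auto simp: limit_carrier inv)
    show "?g (F \<oplus>\<^bsub>?D\<^esub> F') = ?g F \<oplus>\<^bsub>L\<^esub> ?g F'" if "F \<in> carrier ?D" "F' \<in> carrier ?D" for F F'
      using that by (auto simp: limit_carrier inv simp flip: mod_map_add[OF fibre_map])
    show "?g (r \<odot>\<^bsub>?D\<^esub> F) = r \<odot>\<^bsub>L\<^esub> ?g F" if "r \<in> carrier R" "F \<in> carrier ?D" for r F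
      using that by (auto simp: limit_carrier inv simp flip: mod_map_smult[OF fibre_map])
  qed
  ultimately have "restrict ?g (carrier ?D) \<in> mod_hom R ?D L" by (rule restrict_mod_hom)
  moreover have "bij_betw (restrict ?g (carrier ?D)) (carrier ?D) (carrier L)"
  proof -
    have "bij_betw (restrict ?g (carrier ?D)) (carrier ?D) (carrier L) \<longleftrightarrow> bij_betw ?g (carrier ?D) (carrier L)"
      by (rule bij_betw_cong) simp
    then show ?thesis
      using bij_betw_inv_into[OF inj_on_imp_bij_betw[OF fibre_inj]] by (simp add: limit_carrier)
  qed
  ultimately show ?thesis unfolding mod_isomorphic_def by blast
qed

end

lemma direct_limit_zero:
  assumes G: "\<And>n. module R (G n)" and phi: "\<And>n. mod_map R (G n) (G (Suc n)) (\<phi> n)"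
    and nil: "\<And>n x. x \<in> carrier (G n) \<Longrightarrow> \<exists>k. dl_trans \<phi> n k x = \<zero>\<^bsub>G (n + k)\<^esub>"
  shows "zero_mod (direct_limit G \<phi>)"
proof -
  interpret G0: rmodule R "G 0" by (rule rmodule.intro) (rule G)
  \<comment> \<open>A zero module over a type at hand, to serve as the limit.\<close>
  let ?L = "G 0\<lparr>carrier := {\<zero>\<^bsub>G 0\<^esub>}\<rparr>"
  have L: "module R ?L" by (rule G0.submodule_module[OF G0.zero_submodule])
  interpret L: rmodule R ?L by (rule rmodule.intro) (rule L)
  interpret limit_cocone R G \<phi> ?L "\<lambda>n x. \<zero>\<^bsub>G 0\<^esub>"
  proof (rule limit_cocone.intro)
    show "mod_map R (G n) ?L (\<lambda>x. \<zero>\<^bsub>G 0\<^esub>)" for n using L.mod_map_zero_map[of "G n"] by simp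
    fix l assume "l \<in> carrier ?L"
    then show "\<exists>n x. x \<in> carrier (G n) \<and> \<zero>\<^bsub>G 0\<^esub> = l" by auto
  qed (use G phi L nil in auto)
  show ?thesis by (simp add: zero_mod_def limit_carrier limit_zero)
qed

section \<open>Cocycles and Ext modules\<close>

text \<open>Cocycles are cut down to extensional functions, so that maps agreeing on N are equal
  elements and the operations are those of \<open>Hom_mod\<close>.\<close>

definition cocycle_mod ::
    "('a, 'r) ring_scheme \<Rightarrow> ('a, 'n) module \<Rightarrow> (nat \<Rightarrow> ('a, 'c) module) \<Rightarrow> (nat \<Rightarrow> 'c \<Rightarrow> 'c) \<Rightarrow>
     nat \<Rightarrow> ('a, 'n \<Rightarrow> 'c) module"
  where "cocycle_mod R N C d i =
    (Hom_mod R N (C i))\<lparr>carrier := {f \<in> mod_hom R N (C i). cocycle R N C d i f}\<rparr>"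

definition coboundary_set ::
    "('a, 'r) ring_scheme \<Rightarrow> ('a, 'n) module \<Rightarrow> (nat \<Rightarrow> ('a, 'c) module) \<Rightarrow> (nat \<Rightarrow> 'c \<Rightarrow> 'c) \<Rightarrow>
     nat \<Rightarrow> ('n \<Rightarrow> 'c) set"
  where "coboundary_set R N C d i = {f \<in> mod_hom R N (C i). coboundary R N C d i f}"

lemma set_add_carrier_update [simp]: "H <+>\<^bsub>M\<lparr>carrier := S\<rparr>\<^esub> K = H <+>\<^bsub>M\<^esub> K"
  by (simp add: set_add_def')

lemma cocycle_mod_simps [simp]:
  "f \<in> carrier (cocycle_mod R N C d i) \<longleftrightarrow> f \<in> mod_hom R N (C i) \<and> cocycle R N C d i f"
  "\<zero>\<^bsub>cocycle_mod R N C d i\<^esub> = (\<lambda>x\<in>carrier N. \<zero>\<^bsub>C i\<^esub>)"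
  "f \<oplus>\<^bsub>cocycle_mod R N C d i\<^esub> g = (\<lambda>x\<in>carrier N. f x \<oplus>\<^bsub>C i\<^esub> g x)"
  "r \<odot>\<^bsub>cocycle_mod R N C d i\<^esub> f = (\<lambda>x\<in>carrier N. r \<odot>\<^bsub>C i\<^esub> f x)"
  by (simp_all add: cocycle_mod_def Hom_simps)

lemma cocycle_cong:
  assumes "module R N" "\<And>x. x \<in> carrier N \<Longrightarrow> f x = g x"
  shows "cocycle R N C d i f \<longleftrightarrow> cocycle R N C d i g"
  using mod_map_cong[OF assms] assms(2) by (simp add: cocycle_def)

context injective_complex begin

lemma Hom_diff_map:
  assumes N: "module R N"
  shows "mod_map R (Hom_mod R N (C i)) (Hom_mod R N (C (Suc i))) (\<lambda>g. compose (carrier N) (d i) g)"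
proof -
  interpret N: rmodule R N by (rule rmodule.intro) (rule N)
  interpret Ci: rmodule R "C i" by (rule Cr)
  have cl: "f x \<in> carrier (C i)" if "f \<in> mod_hom R N (C i)" "x \<in> carrier N" for f x
    by (rule mod_map_closed[OF mod_hom_map[OF that(1)] that(2)])
  show ?thesis
  proof (rule mod_mapI)
    show "compose (carrier N) (d i) f \<in> carrier (Hom_mod R N (C (Suc i)))"
      if "f \<in> carrier (Hom_mod R N (C i))" for f
      using restrict_mod_hom[OF N mod_map_comp[OF mod_hom_map diff], of f i] that
      by (simp add: compose_def)
  qed (use cl in \<open>auto simp: Hom_simps compose_def mod_map_add[OF diff] mod_map_smult[OF diff] fun_eq_iff\<close>)
qed

lemma Hom_kernel:
  assumes N: "module R N"
  shows "a_kernel (Hom_mod R N (C i)) (Hom_mod R N (C (Suc i))) (\<lambda>g. compose (carrier N) (d i) g) =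
    {f \<in> mod_hom R N (C i). cocycle R N C d i f}"
  by (auto simp: a_kernel_eq Hom_simps compose_def cocycle_def fun_eq_iff dest: mod_hom_map)

lemma Hom_coboundaries:
  assumes N: "module R N"
  shows "coboundaries (\<lambda>n. Hom_mod R N (C n)) (\<lambda>n g. compose (carrier N) (d n) g) i =
    coboundary_set R N C d i"
proof (cases i)
  case 0
  interpret C0: rmodule R "C 0" by (rule Cr)
  have zero: "(\<lambda>x\<in>carrier N. \<zero>\<^bsub>C 0\<^esub>) \<in> mod_hom R N (C 0)"
    by (rule restrict_mod_hom[OF N C0.mod_map_zero_map])
  have "{f \<in> mod_hom R N (C 0). \<forall>x\<in>carrier N. f x = \<zero>\<^bsub>C 0\<^esub>} = {\<lambda>x\<in>carrier N. \<zero>\<^bsub>C 0\<^esub>}"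
  proof (intro equalityI subsetI)
    fix f assume f: "f \<in> {f \<in> mod_hom R N (C 0). \<forall>x\<in>carrier N. f x = \<zero>\<^bsub>C 0\<^esub>}"
    have "f = (\<lambda>x\<in>carrier N. \<zero>\<^bsub>C 0\<^esub>)"
      by (rule mod_hom_eqI[OF _ zero]) (use f in auto)
    then show "f \<in> {\<lambda>x\<in>carrier N. \<zero>\<^bsub>C 0\<^esub>}" by simp
  qed (use zero in simp)
  then show ?thesis
    by (simp add: 0 coboundary_set_def coboundary_simps Hom_simps)
next
  case (Suc j)
  have 1: "compose (carrier N) (d j) k \<in> coboundary_set R N C d (Suc j)" if "k \<in> mod_hom R N (C j)" for k
    using mod_map_closed[OF Hom_diff_map[OF N, of j], of k] that
    by (auto simp: coboundary_set_def coboundary_simps compose_def dest: mod_hom_map)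
  have 2: "f \<in> (\<lambda>g. compose (carrier N) (d j) g) ` mod_hom R N (C j)"
    if f: "f \<in> coboundary_set R N C d (Suc j)" for f
  proof -
    obtain k where k: "mod_map R N (C j) k" "\<And>x. x \<in> carrier N \<Longrightarrow> f x = d j (k x)"
      and fh: "f \<in> mod_hom R N (C (Suc j))"
      using f by (auto simp: coboundary_set_def coboundary_simps)
    have "f = compose (carrier N) (d j) (restrict k (carrier N))"
      using fh k(2) by (intro ext) (auto simp: compose_def mod_hom_iff extensional_def)
    then show ?thesis using restrict_mod_hom[OF N k(1)] by blast
  qed
  show ?thesis using 1 2 by (auto simp: Suc)
qed

lemma cocycle_mod_module:
  assumes N: "module R N"
  shows "module R (cocycle_mod R N C d i)"
proof -
  interpret H: rmodule R "Hom_mod R N (C i)" by (rule rmodule.intro) (rule Hom_module[OF N Cmod])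
  show ?thesis
    using H.submodule_module[OF H.kernel_submodule[OF Hom_module[OF N Cmod] Hom_diff_map[OF N]]]
      Hom_kernel[OF N, of i] by (simp add: cocycle_mod_def a_kernel_eq)
qed

lemma coboundary_set_submodule:
  assumes N: "module R N"
  shows "submodule (coboundary_set R N C d i) R (cocycle_mod R N C d i)"
proof -
  interpret H: rmodule R "Hom_mod R N (C i)" by (rule rmodule.intro) (rule Hom_module[OF N Cmod])
  interpret Z: rmodule R "cocycle_mod R N C d i" by (rule rmodule.intro) (rule cocycle_mod_module[OF N])
  have sub: "coboundary_set R N C d i \<subseteq> {f \<in> mod_hom R N (C i). cocycle R N C d i f}"
    by (auto simp: coboundary_set_def cocycle_def coboundary_diff dest: mod_hom_map)
  have "submodule (coboundary_set R N C d i) R (Hom_mod R N (C i))"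
  proof (cases i)
    case 0
    then show ?thesis using H.zero_submodule Hom_coboundaries[OF N, of 0] by simp
  next
    case (Suc j)
    interpret H': rmodule R "Hom_mod R N (C j)" by (rule rmodule.intro) (rule Hom_module[OF N Cmod])
    show ?thesis
      using H'.image_submodule[OF Hom_module[OF N Cmod] Hom_diff_map[OF N, of j]]
        Hom_coboundaries[OF N, of "Suc j"] by (simp add: Suc)
  qed
  with sub show ?thesis
    by (simp add: H.submodule_alt Z.submodule_alt Hom_simps subset_eq)
qed

lemma cohomology_Hom:
  assumes N: "module R N"
  shows "cohomology (\<lambda>n. Hom_mod R N (C n)) (\<lambda>n g. compose (carrier N) (d n) g) i =
    quot_mod (cocycle_mod R N C d i) (coboundary_set R N C d i)"
  using Hom_kernel[OF N, of i] Hom_coboundaries[OF N, of i] by (simp add: cohomology_def cocycle_mod_def)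

end

section \<open>Ext modules and their transition maps in terms of cocycles\<close>

lemma injective_resolution_complex:
  assumes "injective_resolution R Y E d aug"
  shows "injective_complex R E d" and "exact_at E d (Suc p)"
proof -
  have E: "injective_module R (E n)" and d: "d n \<in> mod_hom R (E n) (E (Suc n))"
    and im: "d n ` carrier (E n) = a_kernel (E (Suc n)) (E (Suc (Suc n))) (d (Suc n))" for n
    using assms by (auto simp: injective_resolution_def)
  show "injective_complex R E d"
  proof
    show "baer R (E n)" for n by (rule injective_module_imp_baer[OF E])
    show "mod_map R (E n) (E (Suc n)) (d n)" for n by (rule mod_hom_map[OF d])
    show "d (Suc n) (d n x) = \<zero>\<^bsub>E (Suc (Suc n))\<^esub>" if "x \<in> carrier (E n)" for n x
      using imageI[OF that, of "d n"] unfolding im by (simp add: a_kernel_eq)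
  qed
  show "exact_at E d (Suc p)"
    using im[of p] by (auto simp: exact_at_def a_kernel_eq set_eq_iff)
qed

lemma inj_complex: "module R Y \<Longrightarrow> injective_complex R (inj_obj R Y) (inj_diff R Y)"
  using inj_res_resolution injective_resolution_complex(1) by blast

lemma Ext_eq:
  assumes N: "module R N" and Y: "module R Y"
  shows "Ext R i N Y = quot_mod (cocycle_mod R N (inj_obj R Y) (inj_diff R Y) i)
    (coboundary_set R N (inj_obj R Y) (inj_diff R Y) i)"
proof -
  have "Hom_obj R N Y = (\<lambda>n. Hom_mod R N (inj_obj R Y n))"
    "Hom_diff R N Y = (\<lambda>n g. compose (carrier N) (inj_diff R Y n) g)"
    by (simp_all add: fun_eq_iff Hom_obj_def Hom_diff_def)
  then show ?thesis
    using injective_complex.cohomology_Hom[OF inj_complex[OF Y] N] by (simp add: Ext_def)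
qed

lemma Ext_map_eq:
  assumes N: "module R N" and Y: "module R Y"
  shows "Ext_map R i N f Y C = coboundary_set R N (inj_obj R Y) (inj_diff R Y) i
    <+>\<^bsub>cocycle_mod R N (inj_obj R Y) (inj_diff R Y) i\<^esub> (\<lambda>g. compose (carrier N) g f) ` C"
proof -
  have "Hom_obj R N Y = (\<lambda>n. Hom_mod R N (inj_obj R Y n))"
    "Hom_diff R N Y = (\<lambda>n g. compose (carrier N) (inj_diff R Y n) g)"
    by (simp_all add: fun_eq_iff Hom_obj_def Hom_diff_def)
  then show ?thesis
    using injective_complex.Hom_coboundaries[OF inj_complex[OF Y] N]
    by (simp add: Ext_map_def cocycle_mod_def)
qed

lemma mod_hom_precompose:
  assumes N: "module R N" and f: "mod_map R N N' f" and g: "g \<in> mod_hom R N' L"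
  shows "compose (carrier N) g f \<in> mod_hom R N L"
  using restrict_mod_hom[OF N mod_map_comp[OF f mod_hom_map[OF g]]] by (simp add: compose_def)

lemma cocycle_mod_precompose:
  assumes N: "module R N" and f: "mod_map R N N' f"
  shows "mod_map R (cocycle_mod R N' C d i) (cocycle_mod R N C d i) (\<lambda>g. compose (carrier N) g f)"
proof (rule mod_mapI)
  interpret N: rmodule R N by (rule rmodule.intro) fact
  fix g assume "g \<in> carrier (cocycle_mod R N' C d i)"
  then have g: "g \<in> mod_hom R N' (C i)" "cocycle R N' C d i g" by auto
  have "cocycle R N C d i (compose (carrier N) g f)"
    using cocycle_comp[OF g(2) f]
    by (subst cocycle_cong[OF N, of _ "\<lambda>x. g (f x)"]) (simp_all add: compose_def)
  then show "compose (carrier N) g f \<in> carrier (cocycle_mod R N C d i)"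
    using mod_hom_precompose[OF N f g(1)] by simp
qed (use mod_map_closed[OF f] in \<open>auto simp: compose_def fun_eq_iff\<close>)

lemma coboundary_set_precompose:
  assumes N: "module R N" and f: "mod_map R N N' f" and g: "g \<in> coboundary_set R N' C d i"
  shows "compose (carrier N) g f \<in> coboundary_set R N C d i"
proof -
  have "coboundary R N C d i (compose (carrier N) g f)"
    using coboundary_comp[OF _ f, of C d i g] g
    by (subst coboundary_cong[of _ _ "\<lambda>x. g (f x)"]) (simp_all add: compose_def coboundary_set_def)
  then show ?thesis using mod_hom_precompose[OF N f, of g "C i"] g by (simp add: coboundary_set_def)
qed

section \<open>The quotients by powers of an ideal\<close>

context rmodule begin

lemma gen_submodule_submodule:
  assumes "S \<subseteq> carrier M" shows "submodule (gen_submodule R M S) R M"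
proof -
  have mem: "x \<in> gen_submodule R M S \<longleftrightarrow> (\<forall>N. submodule N R M \<longrightarrow> S \<subseteq> N \<longrightarrow> x \<in> N)" for x
    by (auto simp: gen_submodule_def)
  have "gen_submodule R M S \<subseteq> carrier M"
    using gen_submodule_minimal[OF carrier_is_submodule assms] .
  then show ?thesis
    unfolding submodule_alt by (simp add: mem submodule_zero submodule_add submodule_smult)
qed

context
  fixes a assumes a: "ideal a R"
begin

lemma pow_gen_subset: "{r \<odot>\<^bsub>M\<^esub> x | r x. r \<in> ideal_pow R a n \<and> x \<in> carrier M} \<subseteq> carrier M"
  using ideal.Icarr[OF R.ideal_pow_ideal[OF a]] by blast

lemma pow_is_submodule: "submodule (pow_submodule R a M n) R M"
  unfolding pow_submodule_def by (rule gen_submodule_submodule[OF pow_gen_subset])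

lemma pow_submoduleI: "r \<in> ideal_pow R a n \<Longrightarrow> x \<in> carrier M \<Longrightarrow> r \<odot>\<^bsub>M\<^esub> x \<in> pow_submodule R a M n"
  unfolding pow_submodule_def gen_submodule_def by blast

lemma pow_submodule_minimal:
  assumes "submodule N R M" "\<And>r x. r \<in> ideal_pow R a n \<Longrightarrow> x \<in> carrier M \<Longrightarrow> r \<odot>\<^bsub>M\<^esub> x \<in> N"
  shows "pow_submodule R a M n \<subseteq> N"
  unfolding pow_submodule_def by (rule gen_submodule_minimal[OF assms(1)]) (use assms(2) in blast)

lemma pow_submodule_Suc: "pow_submodule R a M (Suc n) \<subseteq> pow_submodule R a M n"
  by (rule pow_submodule_minimal[OF pow_is_submodule])
    (use pow_submoduleI R.ideal_pow_Suc_subset[OF a] in blast)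

lemma pow_quot_module: "module R (pow_quot R a M n)"
  unfolding pow_quot_def by (rule quot_module[OF pow_is_submodule])

lemma pow_coset_map: "mod_map R M (pow_quot R a M n) (\<lambda>x. pow_submodule R a M n +>\<^bsub>M\<^esub> x)"
  unfolding pow_quot_def by (rule coset_map[OF pow_is_submodule])

lemma pow_quot_carrier: "carrier (pow_quot R a M n) = (\<lambda>x. pow_submodule R a M n +>\<^bsub>M\<^esub> x) ` carrier M"
  by (simp add: pow_quot_def quot_carrier)

lemma pow_proj_coset:
  assumes "x \<in> carrier M"
  shows "pow_proj R a M n (pow_submodule R a M (Suc n) +>\<^bsub>M\<^esub> x) = pow_submodule R a M n +>\<^bsub>M\<^esub> x"
  using quot_induced_coset[OF module_axioms pow_is_submodule module_axioms pow_is_submodule mod_map_id subsetD[OF pow_submodule_Suc] assms]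
  using assms by (simp add: pow_proj_def pow_quot_carrier)

lemma pow_proj_map: "mod_map R (pow_quot R a M (Suc n)) (pow_quot R a M n) (pow_proj R a M n)"
proof -
  have "mod_map R (pow_quot R a M (Suc n)) (pow_quot R a M n) (\<lambda>C. pow_submodule R a M n <+>\<^bsub>M\<^esub> C)"
    using quot_induced_map[OF module_axioms pow_is_submodule[of "Suc n"] module_axioms pow_is_submodule[of n]
      mod_map_id subsetD[OF pow_submodule_Suc]]
    by (simp add: pow_quot_def)
  then show ?thesis
    by (rule iffD1[OF mod_map_cong[OF pow_quot_module], rotated]) (simp add: pow_proj_def)
qed

lemma pow_quot_torsion:
  assumes E: "module R E" and f: "mod_map R (pow_quot R a M n) E f" and x: "x \<in> carrier M"
  shows "f (pow_submodule R a M n +>\<^bsub>M\<^esub> x) \<in> torsion R a E"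
proof -
  let ?f = "\<lambda>x. f (pow_submodule R a M n +>\<^bsub>M\<^esub> x)"
  have m: "mod_map R M E ?f" by (rule mod_map_comp[OF pow_coset_map f])
  have f0: "f \<zero>\<^bsub>pow_quot R a M n\<^esub> = \<zero>\<^bsub>E\<^esub>"
    by (rule rmodule.mod_map_zero[OF rmodule.intro[OF pow_quot_module] E f])
  have "r \<odot>\<^bsub>E\<^esub> ?f x = \<zero>\<^bsub>E\<^esub>" if r: "r \<in> ideal_pow R a n" for r
  proof -
    have rR: "r \<in> carrier R" by (rule ideal.Icarr[OF R.ideal_pow_ideal[OF a] r])
    have "r \<odot>\<^bsub>E\<^esub> ?f x = ?f (r \<odot>\<^bsub>M\<^esub> x)" using mod_map_smult[OF m rR x] by simp
    also have "pow_submodule R a M n +>\<^bsub>M\<^esub> (r \<odot>\<^bsub>M\<^esub> x) = \<zero>\<^bsub>pow_quot R a M n\<^esub>"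
      using coset_zero_iff[OF pow_is_submodule] pow_submoduleI[OF r x] rR x by (simp add: pow_quot_def)
    finally show ?thesis using f0 by simp
  qed
  then show ?thesis using mod_map_closed[OF m x] by (auto simp: torsion_def)
qed

text \<open>Together with \<open>pow_quot_torsion\<close>: maps from M / a^n M to E correspond to
  maps from M to E whose values are killed by a^n. For finitely generated M these exhaust the maps
  into the torsion of E as n grows.\<close>

lemma pow_quot_factor:
  assumes E: "module R E" and f: "mod_map R M E f"
    and k: "\<And>x r. x \<in> carrier M \<Longrightarrow> r \<in> ideal_pow R a n \<Longrightarrow> r \<odot>\<^bsub>E\<^esub> f x = \<zero>\<^bsub>E\<^esub>"
  shows "\<exists>g. mod_map R (pow_quot R a M n) E g \<and> (\<forall>x\<in>carrier M. g (pow_submodule R a M n +>\<^bsub>M\<^esub> x) = f x)"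
proof (rule mod_map_factor_kernel[OF module_axioms E pow_quot_module pow_coset_map _ f])
  have "pow_submodule R a M n \<subseteq> {x \<in> carrier M. f x = \<zero>\<^bsub>E\<^esub>}"
  proof (rule pow_submodule_minimal[OF kernel_submodule[OF E f]])
    fix r x assume "r \<in> ideal_pow R a n" "x \<in> carrier M"
    then show "r \<odot>\<^bsub>M\<^esub> x \<in> {x \<in> carrier M. f x = \<zero>\<^bsub>E\<^esub>}"
      using k mod_map_smult[OF f] ideal.Icarr[OF R.ideal_pow_ideal[OF a]] by simp
  qed
  then show "f x = \<zero>\<^bsub>E\<^esub>" if "x \<in> carrier M" "pow_submodule R a M n +>\<^bsub>M\<^esub> x = \<zero>\<^bsub>pow_quot R a M n\<^esub>" for x
    using that coset_zero_iff[OF pow_is_submodule that(1)] by (auto simp: pow_quot_def)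
qed (simp add: pow_quot_carrier)

end

end

section \<open>Generalized local cohomology\<close>

lemma (in injective_complex) cycles_submodule:
  "submodule (a_kernel (C i) (C (Suc i)) (d i)) R (C i)"
  using rmodule.kernel_submodule[OF Cr Cmod diff] by (simp add: a_kernel_eq)

lemma (in injective_complex) coboundaries_submodule:
  "submodule (coboundaries C d i) R ((C i)\<lparr>carrier := a_kernel (C i) (C (Suc i)) (d i)\<rparr>)"
proof -
  interpret C: rmodule R "C i" by (rule Cr)
  let ?Z = "(C i)\<lparr>carrier := a_kernel (C i) (C (Suc i)) (d i)\<rparr>"
  interpret Z: rmodule R ?Z by (rule rmodule.intro) (rule C.submodule_module[OF cycles_submodule])
  have "submodule (coboundaries C d i) R (C i)"
  proof (cases i)
    case 0 then show ?thesis using C.zero_submodule by simp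
  next
    case (Suc j) then show ?thesis using rmodule.image_submodule[OF Cr Cmod diff, of j] by simp
  qed
  moreover have "coboundaries C d i \<subseteq> a_kernel (C i) (C (Suc i)) (d i)"
    using rmodule.mod_map_zero[OF Cr Cmod diff, of i] diff_diff mod_map_closed[OF diff] C.M.zero_closed
    by (cases i) (auto simp: a_kernel_eq)
  ultimately show ?thesis by (simp add: C.submodule_alt Z.submodule_alt subset_eq)
qed

lemma (in injective_complex) zero_cohomology_exact:
  assumes "zero_mod (cohomology C d i)" shows "exact_at C d i"
  unfolding exact_at_def
proof (intro ballI impI)
  fix x assume x: "x \<in> carrier (C i)" "d i x = \<zero>\<^bsub>C (Suc i)\<^esub>"
  let ?Z = "(C i)\<lparr>carrier := a_kernel (C i) (C (Suc i)) (d i)\<rparr>"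
  interpret C: rmodule R "C i" by (rule Cr)
  interpret Z: rmodule R ?Z by (rule rmodule.intro) (rule C.submodule_module[OF cycles_submodule])
  have xZ: "x \<in> carrier ?Z" using x by (simp add: a_kernel_eq)
  have "(coboundaries C d i +>\<^bsub>?Z\<^esub> x) \<in> carrier (cohomology C d i)"
    unfolding cohomology_def quot_carrier using xZ by (rule imageI)
  then have "coboundaries C d i +>\<^bsub>?Z\<^esub> x = coboundaries C d i"
    using assms by (simp add: zero_mod_def cohomology_def)
  then show "x \<in> coboundaries C d i" using Z.coset_zero_iff[OF coboundaries_submodule xZ] by simp
qed

text \<open>The exactness of \<open>C\<close> above \<open>c\<close> lets a map on the cycles of degree \<open>c\<close> spread to a map of complexes.\<close>

lemma comparison_map_exists:
  assumes C: "injective_complex R C dC" and I: "injective_complex R I dI"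
    and ex: "\<And>i. i > c \<Longrightarrow> exact_at C dC i"
    and f: "mod_map R (C c) (I 0) f"
    and fz: "\<And>x. x \<in> carrier (C c) \<Longrightarrow> dC c x = \<zero>\<^bsub>C (Suc c)\<^esub> \<Longrightarrow> dI 0 (f x) = \<zero>\<^bsub>I 1\<^esub>"
  shows "\<exists>\<phi>. \<phi> 0 = f \<and> (\<forall>p. mod_map R (C (c + p)) (I p) (\<phi> p)) \<and>
    (\<forall>p. \<forall>x\<in>carrier (C (c + p)). dI p (\<phi> p x) = \<phi> (Suc p) (dC (c + p) x))"
proof -
  interpret C: injective_complex R C dC by fact
  interpret I: injective_complex R I dI by fact
  \<comment> \<open>The last conjunct, that g followed by dI kills the cycles of degree c + p,
    permits the extension along dC. For p = 0 it is \<open>fz\<close>; afterwards it follows from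
    exactness above c.\<close>
  define P where "P p g \<longleftrightarrow> mod_map R (C (c + p)) (I p) g \<and> (p = 0 \<longrightarrow> g = f) \<and>
    (\<forall>x\<in>carrier (C (c + p)). dC (c + p) x = \<zero>\<^bsub>C (Suc (c + p))\<^esub> \<longrightarrow> dI p (g x) = \<zero>\<^bsub>I (Suc p)\<^esub>)" for p g
  define Q where "Q p g h \<longleftrightarrow> (\<forall>x\<in>carrier (C (c + p)). dI p (g x) = h (dC (c + p) x))" for p g h
  have "\<exists>\<phi>. \<forall>p. P p (\<phi> p) \<and> Q p (\<phi> p) (\<phi> (Suc p))"
  proof (rule dependent_nat_choice)
    show "\<exists>g. P 0 g" using f fz by (auto simp: P_def)
  next
    fix g p assume g: "P p g"
    then have gm: "mod_map R (C (c + p)) (I p) g" by (simp add: P_def)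
    have "\<exists>h. mod_map R (C (Suc (c + p))) (I (Suc p)) h \<and> (\<forall>x\<in>carrier (C (c + p)). h (dC (c + p) x) = dI p (g x))"
      by (rule baer_extend_along[OF I.baer C.Cmod C.Cmod C.diff mod_map_comp[OF gm I.diff]])
        (use g in \<open>simp add: P_def\<close>)
    then obtain h where h: "mod_map R (C (Suc (c + p))) (I (Suc p)) h"
      "\<And>x. x \<in> carrier (C (c + p)) \<Longrightarrow> h (dC (c + p) x) = dI p (g x)" by blast
    have "dI (Suc p) (h x) = \<zero>\<^bsub>I (Suc (Suc p))\<^esub>"
      if x: "x \<in> carrier (C (Suc (c + p)))" "dC (Suc (c + p)) x = \<zero>\<^bsub>C (Suc (Suc (c + p)))\<^esub>" for x
    proof -
      obtain y where "y \<in> carrier (C (c + p))" "x = dC (c + p) y"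
        using ex[of "Suc (c + p)"] x by (auto simp: exact_at_def)
      then show ?thesis using h(2) I.diff_diff mod_map_closed[OF gm] by simp
    qed
    then show "\<exists>h. P (Suc p) h \<and> Q p g h" using h by (auto simp: P_def Q_def)
  qed
  then obtain \<phi> where "\<And>p. P p (\<phi> p)" "\<And>p. Q p (\<phi> p) (\<phi> (Suc p))" by blast
  then show ?thesis unfolding P_def Q_def by (intro exI[of _ \<phi>]) auto
qed

section \<open>Generalized local cohomology through maps from M to the torsion complex\<close>

locale local_cohomology_setting =
  fixes R :: "('a, 'r) ring_scheme" and a :: "'a set" and M :: "('a, 'm) module" and Y :: "('a, 'x) module"
  assumes cring: "cring R" and noetherian: "noetherian_ring R" and ideal: "ideal a R"
    and M: "module R M" and fin_gen: "fin_gen R M" and Y: "module R Y"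
begin

abbreviation "E \<equiv> inj_obj R Y"
abbreviation "d \<equiv> inj_diff R Y"
abbreviation "\<Gamma> n \<equiv> (E n)\<lparr>carrier := torsion R a (E n)\<rparr>"
abbreviation "A \<equiv> pow_quot R a M"
abbreviation "\<pi> n x \<equiv> pow_submodule R a M n +>\<^bsub>M\<^esub> x"
abbreviation "Z i n \<equiv> cocycle_mod R (A n) E d i"
abbreviation "B i n \<equiv> coboundary_set R (A n) E d i"
abbreviation "G i n \<equiv> Ext R i (A n) Y"
abbreviation "\<tau> i n \<equiv> Ext_map R i (A (Suc n)) (pow_proj R a M n) Y"

sublocale M: rmodule R M by (rule rmodule.intro) (rule M)

sublocale E: injective_complex R E d by (rule inj_complex[OF Y])

lemma A: "module R (A n)" by (rule M.pow_quot_module[OF ideal])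

lemma A_carrier: "carrier (A n) = \<pi> n ` carrier M" by (rule M.pow_quot_carrier[OF ideal])

lemma pi_map: "mod_map R M (A n) (\<pi> n)" by (rule M.pow_coset_map[OF ideal])

lemma torsion_complex: "injective_complex R \<Gamma> d"
proof
  show "baer R (\<Gamma> n)" for n by (rule torsion_baer[OF cring noetherian ideal E.baer])
  have T: "torsion R a (E n) \<subseteq> carrier (E n)" for n by (auto simp: torsion_def)
  show "mod_map R (\<Gamma> n) (\<Gamma> (Suc n)) (d n)" for n
    by (rule mod_map_into_carrierI[OF mod_map_restrict_carrier[OF E.diff T]])
      (use rmodule.torsion_map[OF E.Cr ideal E.Cmod E.diff] in simp)
  show "d (Suc n) (d n x) = \<zero>\<^bsub>\<Gamma> (Suc (Suc n))\<^esub>" if "x \<in> carrier (\<Gamma> n)" for n x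
    using E.diff_diff[of x n] that T by auto
qed

sublocale \<Gamma>: injective_complex R \<Gamma> d by (rule torsion_complex)

lemma local_cohomology_eq: "local_cohomology R a i Y = cohomology \<Gamma> d i"
  by (simp add: local_cohomology_def)

lemma cocycle_pi:
  assumes "cocycle R (A n) E d i f"
  shows "cocycle R M \<Gamma> d i (\<lambda>x. f (\<pi> n x))"
proof -
  have f: "mod_map R (A n) (E i) f" using assms by (simp add: cocycle_def)
  have "mod_map R M (\<Gamma> i) (\<lambda>x. f (\<pi> n x))"
    by (rule mod_map_into_carrierI[OF mod_map_comp[OF pi_map f]])
      (rule M.pow_quot_torsion[OF ideal E.Cmod f])
  then show ?thesis using cocycle_comp[OF assms pi_map] by (simp add: cocycle_def)
qed

text \<open>The stage m can be taken beyond any given n, so that a primitive defined on M can be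
  compared with a class that starts at stage n.\<close>

lemma torsion_map_factor:
  assumes k: "mod_map R M (\<Gamma> i) k"
  shows "\<exists>m\<ge>n. \<exists>k'. mod_map R (A m) (E i) k' \<and> (\<forall>x\<in>carrier M. k' (\<pi> m x) = k x)"
proof -
  have T: "torsion R a (E i) \<subseteq> carrier (E i)" by (auto simp: torsion_def)
  have kE: "mod_map R M (E i) k" by (rule mod_map_from_carrier[OF k T])
  obtain m where m: "\<forall>x\<in>carrier M. \<forall>r\<in>ideal_pow R a m. r \<odot>\<^bsub>E i\<^esub> k x = \<zero>\<^bsub>E i\<^esub>"
    using M.fin_gen_torsion_bound[OF ideal fin_gen E.Cmod kE] mod_map_closed[OF k] by auto
  let ?m = "max m n"
  have "\<exists>k'. mod_map R (A ?m) (E i) k' \<and> (\<forall>x\<in>carrier M. k' (\<pi> ?m x) = k x)"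
  proof (rule M.pow_quot_factor[OF ideal E.Cmod kE])
    fix x r assume x: "x \<in> carrier M" and r: "r \<in> ideal_pow R a ?m"
    have "r \<in> ideal_pow R a m" using cring.ideal_pow_antimono[OF cring ideal, of m ?m] r by auto
    then show "r \<odot>\<^bsub>E i\<^esub> k x = \<zero>\<^bsub>E i\<^esub>" using m x by blast
  qed
  then show ?thesis by (intro exI[of _ ?m]) simp
qed

lemma Z: "module R (Z i n)" by (rule E.cocycle_mod_module[OF A])

lemma B: "submodule (B i n) R (Z i n)" by (rule E.coboundary_set_submodule[OF A])

lemma G_eq: "G i n = quot_mod (Z i n) (B i n)" by (rule Ext_eq[OF A Y])

lemma G: "module R (G i n)"
  unfolding G_eq by (rule rmodule.quot_module[OF rmodule.intro[OF Z] B])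

lemma tau_eq: "\<tau> i n = (\<lambda>C. B i (Suc n) <+>\<^bsub>Z i (Suc n)\<^esub> (\<lambda>g. compose (carrier (A (Suc n))) g (pow_proj R a M n)) ` C)"
  by (rule ext) (rule Ext_map_eq[OF A Y])

lemma proj_map: "mod_map R (A (Suc n)) (A n) (pow_proj R a M n)"
  by (rule M.pow_proj_map[OF ideal])

lemma tau: "mod_map R (G i n) (G i (Suc n)) (\<tau> i n)"
  unfolding G_eq tau_eq
  by (rule quot_induced_map[OF Z B Z B cocycle_mod_precompose[OF A proj_map]])
    (rule coboundary_set_precompose[OF A proj_map])

lemma tau_coset:
  assumes "f \<in> carrier (Z i n)"
  shows "\<tau> i n (B i n +>\<^bsub>Z i n\<^esub> f) =
    B i (Suc n) +>\<^bsub>Z i (Suc n)\<^esub> compose (carrier (A (Suc n))) f (pow_proj R a M n)"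
  unfolding tau_eq
  by (rule quot_induced_coset[OF Z B Z B cocycle_mod_precompose[OF A proj_map] _ assms])
    (rule coboundary_set_precompose[OF A proj_map])

text \<open>Stages are compared by pulling representatives back to M, where the transition maps
  change nothing.\<close>

lemma trans_coset:
  assumes f: "f \<in> carrier (Z i n)"
  shows "\<exists>g\<in>carrier (Z i (n + k)). dl_trans (\<tau> i) n k (B i n +>\<^bsub>Z i n\<^esub> f) = B i (n + k) +>\<^bsub>Z i (n + k)\<^esub> g \<and>
    (\<forall>x\<in>carrier M. g (\<pi> (n + k) x) = f (\<pi> n x))"
proof (induction k)
  case 0
  then show ?case using f by (intro bexI[of _ f]) simp_all
next
  case (Suc k)
  then obtain g where g: "g \<in> carrier (Z i (n + k))"
    "dl_trans (\<tau> i) n k (B i n +>\<^bsub>Z i n\<^esub> f) = B i (n + k) +>\<^bsub>Z i (n + k)\<^esub> g"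
    "\<And>x. x \<in> carrier M \<Longrightarrow> g (\<pi> (n + k) x) = f (\<pi> n x)" by blast
  let ?h = "compose (carrier (A (Suc (n + k)))) g (pow_proj R a M (n + k))"
  have "?h \<in> carrier (Z i (n + Suc k))"
    using mod_map_closed[OF cocycle_mod_precompose[OF A proj_map] g(1)] by simp
  moreover have "dl_trans (\<tau> i) n (Suc k) (B i n +>\<^bsub>Z i n\<^esub> f) = B i (n + Suc k) +>\<^bsub>Z i (n + Suc k)\<^esub> ?h"
    using tau_coset[OF g(1)] by (simp add: g(2))
  moreover have "?h (\<pi> (n + Suc k) x) = f (\<pi> n x)" if x: "x \<in> carrier M" for x
  proof -
    have "\<pi> (Suc (n + k)) x \<in> carrier (A (Suc (n + k)))" using x by (simp add: A_carrier)
    then have "?h (\<pi> (Suc (n + k)) x) = g (pow_proj R a M (n + k) (\<pi> (Suc (n + k)) x))"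
      by (simp add: compose_def)
    then show ?thesis using M.pow_proj_coset[OF ideal x] g(3)[OF x] by simp
  qed
  ultimately show ?case by blast
qed

text \<open>A primitive of the pulled back cocycle factors through some stage m >= n. It is then a
  primitive of the transported representative, since M maps onto M / a^m M. In degree 0 stage n
  itself serves.\<close>

lemma coboundary_vanishes:
  assumes f: "f \<in> carrier (Z i n)" and cob: "coboundary R M \<Gamma> d i (\<lambda>x. f (\<pi> n x))"
  shows "\<exists>k. dl_trans (\<tau> i) n k (B i n +>\<^bsub>Z i n\<^esub> f) = \<zero>\<^bsub>G i (n + k)\<^esub>"
proof -
  have "\<exists>k. \<forall>g\<in>carrier (Z i (n + k)). (\<forall>x\<in>carrier M. g (\<pi> (n + k) x) = f (\<pi> n x)) \<longrightarrow>
      coboundary R (A (n + k)) E d i g"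
  proof (cases i)
    case 0
    then have "\<forall>g\<in>carrier (Z i (n + 0)). (\<forall>x\<in>carrier M. g (\<pi> (n + 0) x) = f (\<pi> n x)) \<longrightarrow>
        coboundary R (A (n + 0)) E d i g"
      using cob by (auto simp: coboundary_simps A_carrier)
    then show ?thesis by (rule exI)
  next
    case (Suc j)
    then obtain u where u: "mod_map R M (\<Gamma> j) u" "\<And>x. x \<in> carrier M \<Longrightarrow> f (\<pi> n x) = d j (u x)"
      using cob by (auto simp: coboundary_simps)
    obtain m u' where "m \<ge> n" and u': "mod_map R (A m) (E j) u'" "\<And>x. x \<in> carrier M \<Longrightarrow> u' (\<pi> m x) = u x"
      using torsion_map_factor[OF u(1), of n] by blast
    then obtain k where k: "m = n + k" using le_Suc_ex by blast
    have "coboundary R (A (n + k)) E d i g"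
      if "\<forall>x\<in>carrier M. g (\<pi> (n + k) x) = f (\<pi> n x)" for g
      using that u u' by (auto simp: Suc coboundary_simps A_carrier k)
    then show ?thesis by blast
  qed
  then obtain k where k: "\<And>g. g \<in> carrier (Z i (n + k)) \<Longrightarrow> \<forall>x\<in>carrier M. g (\<pi> (n + k) x) = f (\<pi> n x) \<Longrightarrow>
      coboundary R (A (n + k)) E d i g" by blast
  obtain g where g: "g \<in> carrier (Z i (n + k))" "\<forall>x\<in>carrier M. g (\<pi> (n + k) x) = f (\<pi> n x)"
    "dl_trans (\<tau> i) n k (B i n +>\<^bsub>Z i n\<^esub> f) = B i (n + k) +>\<^bsub>Z i (n + k)\<^esub> g"
    using trans_coset[OF f, of k] by blast
  have "g \<in> B i (n + k)" using k[OF g(1,2)] g(1) by (simp add: coboundary_set_def)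
  then have "B i (n + k) +>\<^bsub>Z i (n + k)\<^esub> g = \<zero>\<^bsub>G i (n + k)\<^esub>"
    using rmodule.coset_zero_iff[OF rmodule.intro[OF Z] B g(1)] by (simp add: G_eq)
  then show ?thesis using g(3) by auto
qed

lemma gen_local_cohomology_eq: "gen_local_cohomology R a i M Y = direct_limit (G i) (\<tau> i)"
  by (simp add: gen_local_cohomology_def)

lemma gen_local_cohomology_zero:
  assumes "Hom_exact_at R M \<Gamma> d i"
  shows "zero_mod (gen_local_cohomology R a i M Y)"
  unfolding gen_local_cohomology_eq
proof (rule direct_limit_zero[of R "G i" "\<tau> i", OF G tau])
  fix n x assume "x \<in> carrier (G i n)"
  then obtain f where f: "f \<in> carrier (Z i n)" "x = B i n +>\<^bsub>Z i n\<^esub> f"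
    by (auto simp: G_eq quot_carrier simp del: cocycle_mod_simps)
  have "cocycle R M \<Gamma> d i (\<lambda>x. f (\<pi> n x))" using f(1) by (intro cocycle_pi) simp
  then have "coboundary R M \<Gamma> d i (\<lambda>x. f (\<pi> n x))" using assms by (simp add: Hom_exact_at_def)
  then show "\<exists>k. dl_trans (\<tau> i) n k x = \<zero>\<^bsub>G i (n + k)\<^esub>"
    using coboundary_vanishes[OF f(1)] f(2) by simp
qed

text \<open>The cocone pulls a cocycle back to M and composes it with \<phi> p. Its kernel condition
  comes from \<open>inj\<close> and \<open>coboundary_vanishes\<close>, its surjectivity from
  \<open>surj\<close> and \<open>torsion_map_factor\<close>.\<close>

lemma gen_local_cohomology_Ext:
  fixes H :: "('a, 'h) module"
  assumes H: "module R H" and cmp: "complex_comparison R \<Gamma> d (inj_obj R H) (inj_diff R H) c \<phi>"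
    and surj: "complex_comparison.cohom_surj R \<Gamma> d (inj_obj R H) (inj_diff R H) c \<phi> p M"
    and inj: "complex_comparison.cohom_inj R \<Gamma> d (inj_obj R H) (inj_diff R H) c \<phi> p M"
  shows "mod_isomorphic R (gen_local_cohomology R a (p + c) M Y) (Ext R p M H)"
proof -
  interpret cmp: complex_comparison R \<Gamma> d "inj_obj R H" "inj_diff R H" c \<phi> by fact
  let ?I = "inj_obj R H" and ?dI = "inj_diff R H"
  let ?i = "c + p"
  let ?ZM = "cocycle_mod R M ?I ?dI p" and ?BM = "coboundary_set R M ?I ?dI p"
  have ZM: "module R ?ZM" by (rule cmp.I.cocycle_mod_module[OF M])
  have BM: "submodule ?BM R ?ZM" by (rule cmp.I.coboundary_set_submodule[OF M])
  have L_eq: "Ext R p M H = quot_mod ?ZM ?BM" by (rule Ext_eq[OF M H])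
  interpret ZM: rmodule R ?ZM by (rule rmodule.intro) (rule ZM)
  define \<Theta> where "\<Theta> n f = (\<lambda>x\<in>carrier M. \<phi> p (f (\<pi> n x)))" for n f
  have Gf: "f (\<pi> n x) \<in> carrier (\<Gamma> ?i)" if "f \<in> carrier (Z ?i n)" "x \<in> carrier M" for f n x
    using cocycle_pi[of n ?i f] that mod_map_closed[of R M "\<Gamma> ?i"] by (auto simp: cocycle_def)
  have \<Theta>Z: "\<Theta> n f \<in> carrier ?ZM" if f: "f \<in> carrier (Z ?i n)" for n f
  proof -
    have c: "cocycle R M \<Gamma> d ?i (\<lambda>x. f (\<pi> n x))" using f by (intro cocycle_pi) simp
    then have m: "mod_map R M (?I p) (\<lambda>x. \<phi> p (f (\<pi> n x)))"
      by (intro mod_map_comp[OF _ cmp.phi]) (simp add: cocycle_def)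
    have "?dI p (\<phi> p (f (\<pi> n x))) = \<zero>\<^bsub>?I (Suc p)\<^esub>" if x: "x \<in> carrier M" for x
      using c x cmp.phi_diff[OF Gf[OF f x]] cmp.phi_zero[of "Suc p"] by (simp add: cocycle_def)
    then have "cocycle R M ?I ?dI p (\<Theta> n f)"
      using m by (subst cocycle_cong[OF M, of _ "\<lambda>x. \<phi> p (f (\<pi> n x))"]) (simp_all add: \<Theta>_def cocycle_def)
    then show ?thesis using restrict_mod_hom[OF M m] by (simp add: \<Theta>_def)
  qed
  have \<Theta>: "mod_map R (Z ?i n) ?ZM (\<Theta> n)" for n
  proof (rule mod_mapI[OF \<Theta>Z])
    fix f g assume f: "f \<in> carrier (Z ?i n)" and g: "g \<in> carrier (Z ?i n)"
    show "\<Theta> n (f \<oplus>\<^bsub>Z ?i n\<^esub> g) = \<Theta> n f \<oplus>\<^bsub>?ZM\<^esub> \<Theta> n g"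
    proof (rule ext)
      fix x
      show "\<Theta> n (f \<oplus>\<^bsub>Z ?i n\<^esub> g) x = (\<Theta> n f \<oplus>\<^bsub>?ZM\<^esub> \<Theta> n g) x"
        using mod_map_add[OF cmp.phi Gf[OF f] Gf[OF g], of x x] by (simp add: \<Theta>_def A_carrier)
    qed
  next
    fix r f assume r: "r \<in> carrier R" and f: "f \<in> carrier (Z ?i n)"
    show "\<Theta> n (r \<odot>\<^bsub>Z ?i n\<^esub> f) = r \<odot>\<^bsub>?ZM\<^esub> \<Theta> n f"
    proof (rule ext)
      fix x
      show "\<Theta> n (r \<odot>\<^bsub>Z ?i n\<^esub> f) x = (r \<odot>\<^bsub>?ZM\<^esub> \<Theta> n f) x"
        using mod_map_smult[OF cmp.phi r Gf[OF f], of x] by (simp add: \<Theta>_def A_carrier)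
    qed
  qed
  have \<Theta>cob: "\<Theta> n f \<in> ?BM \<longleftrightarrow> coboundary R M ?I ?dI p (\<lambda>x. \<phi> p (f (\<pi> n x)))"
    if f: "f \<in> carrier (Z ?i n)" for n f
    using \<Theta>Z[OF f] coboundary_cong[of M "\<Theta> n f" "\<lambda>x. \<phi> p (f (\<pi> n x))" R ?I ?dI p]
    by (simp add: coboundary_set_def \<Theta>_def)
  have cob\<phi>: "coboundary R M ?I ?dI p (\<lambda>x. \<phi> p (g x))" if g: "coboundary R M \<Gamma> d ?i g" for g
  proof (cases p)
    \<comment> \<open>In degree c a primitive sits in degree c - 1, where the comparison map is not
      defined; \<open>phi_coboundary\<close> takes care of this.\<close>
    case 0
    have "g x \<in> coboundaries \<Gamma> d c" if "x \<in> carrier M" for x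
    proof (cases c)
      case 0
      then show ?thesis using g that \<open>p = 0\<close> by (simp add: coboundary_simps)
    next
      case (Suc j)
      then obtain k where k: "mod_map R M (\<Gamma> j) k" "\<And>x. x \<in> carrier M \<Longrightarrow> g x = d j (k x)"
        using g \<open>p = 0\<close> by (auto simp: coboundary_simps)
      show ?thesis unfolding Suc coboundaries_simps k(2)[OF that]
        using mod_map_closed[OF k(1) that] by (rule imageI)
    qed
    then show ?thesis using cmp.phi_coboundary by (simp add: 0 coboundary_simps)
  next
    case (Suc q)
    then obtain k where k: "mod_map R M (\<Gamma> (c + q)) k" "\<And>x. x \<in> carrier M \<Longrightarrow> g x = d (c + q) (k x)"
      using g by (auto simp: coboundary_simps)
    have "\<phi> p (g x) = ?dI q (\<phi> q (k x))" if "x \<in> carrier M" for x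
      using cmp.phi_diff[OF mod_map_closed[OF k(1) that]] k(2)[OF that] by (simp add: Suc)
    then show ?thesis
      using mod_map_comp[OF k(1) cmp.phi] by (auto simp: Suc coboundary_simps)
  qed
  have \<Theta>B: "\<Theta> n f \<in> ?BM" if f: "f \<in> B ?i n" for n f
  proof -
    have fZ: "f \<in> carrier (Z ?i n)"
      using rmodule.submodule_subset[OF rmodule.intro[OF Z] B] f by blast
    have "coboundary R M \<Gamma> d ?i (\<lambda>x. f (\<pi> n x))"
    proof (cases ?i)
      case 0
      then show ?thesis using f by (simp add: coboundary_set_def coboundary_simps A_carrier)
    next
      case (Suc j)
      then obtain k where k: "mod_map R (A n) (E j) k" "\<And>x. x \<in> carrier (A n) \<Longrightarrow> f x = d j (k x)"
        using f by (auto simp: coboundary_set_def coboundary_simps)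
      have "mod_map R M (\<Gamma> j) (\<lambda>x. k (\<pi> n x))"
        by (rule mod_map_into_carrierI[OF mod_map_comp[OF pi_map k(1)]])
          (rule M.pow_quot_torsion[OF ideal E.Cmod k(1)])
      then show ?thesis using k(2) by (auto simp: Suc coboundary_simps A_carrier)
    qed
    then show ?thesis using \<Theta>cob[OF fZ] cob\<phi> by simp
  qed
  let ?\<theta> = "\<lambda>n C. ?BM <+>\<^bsub>?ZM\<^esub> \<Theta> n ` C"
  have \<theta>: "mod_map R (G ?i n) (quot_mod ?ZM ?BM) (?\<theta> n)" for n
    unfolding G_eq by (rule quot_induced_map[OF Z B ZM BM \<Theta> \<Theta>B])
  have \<theta>c: "?\<theta> n (B ?i n +>\<^bsub>Z ?i n\<^esub> f) = ?BM +>\<^bsub>?ZM\<^esub> \<Theta> n f" if "f \<in> carrier (Z ?i n)" for n f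
    by (rule quot_induced_coset[OF Z B ZM BM \<Theta> \<Theta>B that])
  have GE: "\<exists>f\<in>carrier (Z ?i n). x = B ?i n +>\<^bsub>Z ?i n\<^esub> f" if "x \<in> carrier (G ?i n)" for n x
    using that unfolding G_eq quot_carrier by blast
  interpret limit_cocone R "G ?i" "\<tau> ?i" "quot_mod ?ZM ?BM" ?\<theta>
  proof (rule limit_cocone.intro[of R "G ?i" "\<tau> ?i", OF G tau ZM.quot_module[OF BM] \<theta>])
    fix x n assume "x \<in> carrier (G ?i n)"
    then obtain f where f: "f \<in> carrier (Z ?i n)" "x = B ?i n +>\<^bsub>Z ?i n\<^esub> f" using GE by blast
    obtain g where g: "g \<in> carrier (Z ?i (n + 1))"
      "dl_trans (\<tau> ?i) n 1 x = B ?i (n + 1) +>\<^bsub>Z ?i (n + 1)\<^esub> g"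
      "\<forall>x\<in>carrier M. g (\<pi> (n + 1) x) = f (\<pi> n x)" using trans_coset[OF f(1), of 1] f(2) by blast
    have "\<Theta> (n + 1) g = \<Theta> n f" unfolding \<Theta>_def by (rule restrict_ext) (use g(3) in simp)
    then show "?\<theta> (Suc n) (\<tau> ?i n x) = ?\<theta> n x"
      using g(2) \<theta>c[OF f(1)] \<theta>c[OF g(1)] f(2) by simp
  next
    fix x n assume x: "x \<in> carrier (G ?i n)" "?\<theta> n x = \<zero>\<^bsub>quot_mod ?ZM ?BM\<^esub>"
    then obtain f where f: "f \<in> carrier (Z ?i n)" "x = B ?i n +>\<^bsub>Z ?i n\<^esub> f" using GE by blast
    have "\<Theta> n f \<in> ?BM" using x(2) f \<theta>c[OF f(1)] ZM.coset_zero_iff[OF BM \<Theta>Z[OF f(1)]] by simp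
    then have "coboundary R M ?I ?dI p (\<lambda>x. \<phi> p (f (\<pi> n x)))" using \<Theta>cob[OF f(1)] by simp
    moreover have "cocycle R M \<Gamma> d ?i (\<lambda>x. f (\<pi> n x))" using f(1) by (intro cocycle_pi) simp
    ultimately have "coboundary R M \<Gamma> d ?i (\<lambda>x. f (\<pi> n x))"
      using inj by (simp add: cmp.cohom_inj_def)
    then show "\<exists>k. dl_trans (\<tau> ?i) n k x = \<zero>\<^bsub>G ?i (n + k)\<^esub>"
      using coboundary_vanishes[OF f(1)] f(2) by simp
  next
    fix l assume "l \<in> carrier (quot_mod ?ZM ?BM)"
    then obtain g where g: "g \<in> carrier ?ZM" "l = ?BM +>\<^bsub>?ZM\<^esub> g" unfolding quot_carrier by blast
    obtain f where f: "cocycle R M \<Gamma> d ?i f"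
      "coboundary R M ?I ?dI p (\<lambda>x. msub R (?I p) (g x) (\<phi> p (f x)))"
      using surj g(1) by (auto simp: cmp.cohom_surj_def)
    \<comment> \<open>Any stage through which f factors will do, hence the lower bound 0.\<close>
    obtain m f' where f': "mod_map R (A m) (E ?i) f'" "\<And>x. x \<in> carrier M \<Longrightarrow> f' (\<pi> m x) = f x"
      using torsion_map_factor[of ?i f 0] f(1) by (auto simp: cocycle_def)
    let ?f = "restrict f' (carrier (A m))"
    have fx: "?f (\<pi> m x) = f x" if "x \<in> carrier M" for x using f'(2) that by (simp add: A_carrier)
    have "d ?i (f' y) = \<zero>\<^bsub>E (Suc ?i)\<^esub>" if "y \<in> carrier (A m)" for y
      using that f'(2) f(1) by (auto simp: A_carrier cocycle_def)
    then have "cocycle R (A m) E d ?i ?f"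
      using f'(1) by (subst cocycle_cong[OF A, of _ _ f']) (simp_all add: cocycle_def)
    then have fZ: "?f \<in> carrier (Z ?i m)" using restrict_mod_hom[OF A f'(1)] by simp
    have "coboundary R M ?I ?dI p (msub R ?ZM g (\<Theta> m ?f))"
    proof (rule iffD2[OF coboundary_cong f(2)])
      fix x assume x: "x \<in> carrier M"
      have "msub R ?ZM g (\<Theta> m ?f) x = msub R (Hom_mod R M (?I p)) g (\<Theta> m ?f) x"
        by (simp add: cocycle_mod_def)
      also have "\<dots> = msub R (?I p) (g x) (\<Theta> m ?f x)"
        using g(1) \<Theta>Z[OF fZ] by (intro Hom_msub[OF M cmp.I.Cmod _ _ x]) simp_all
      finally show "msub R ?ZM g (\<Theta> m ?f) x = msub R (?I p) (g x) (\<phi> p (f x))"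
        using fx[OF x] x by (simp add: \<Theta>_def)
    qed
    then have "msub R ?ZM g (\<Theta> m ?f) \<in> ?BM"
      using ZM.msub_closed[OF g(1) \<Theta>Z[OF fZ]] by (simp add: coboundary_set_def)
    then have "l = ?BM +>\<^bsub>?ZM\<^esub> \<Theta> m ?f"
      using ZM.coset_eq_iff[OF BM g(1) \<Theta>Z[OF fZ]] g(2) by simp
    then have "?\<theta> m (B ?i m +>\<^bsub>Z ?i m\<^esub> ?f) = l" using \<theta>c[OF fZ] by simp
    moreover have "(B ?i m +>\<^bsub>Z ?i m\<^esub> ?f) \<in> carrier (G ?i m)"
      unfolding G_eq quot_carrier using fZ by (rule imageI)
    ultimately show "\<exists>n x. x \<in> carrier (G ?i n) \<and> ?\<theta> n x = l" by blast
  qed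
  show ?thesis
    using limit_isomorphic by (simp add: gen_local_cohomology_eq L_eq add.commute[of p c])
qed

lemma comparison_exists:
  assumes ex: "\<And>i. i > c \<Longrightarrow> exact_at \<Gamma> d i"
  defines "H \<equiv> local_cohomology R a c Y"
  shows "module R H" and "\<exists>\<phi>. complex_comparison R \<Gamma> d (inj_obj R H) (inj_diff R H) c \<phi>"
proof -
  let ?Z = "(\<Gamma> c)\<lparr>carrier := a_kernel (\<Gamma> c) (\<Gamma> (Suc c)) (d c)\<rparr>" and ?B = "coboundaries \<Gamma> d c"
  let ?I = "inj_obj R H" and ?dI = "inj_diff R H"
  interpret \<Gamma>c: rmodule R "\<Gamma> c" by (rule \<Gamma>.Cr)
  have Z: "module R ?Z" by (rule \<Gamma>c.submodule_module[OF \<Gamma>.cycles_submodule])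
  interpret Z: rmodule R ?Z by (rule rmodule.intro) (rule Z)
  have H_eq: "H = quot_mod ?Z ?B" unfolding H_def local_cohomology_eq cohomology_def by (rule refl)
  show HM: "module R H" unfolding H_eq by (rule Z.quot_module[OF \<Gamma>.coboundaries_submodule])
  interpret H: rmodule R H by (rule rmodule.intro) (rule HM)
  obtain aug where res: "injective_resolution R H ?I ?dI aug" using inj_res_resolution[OF HM] by blast
  have I: "injective_complex R ?I ?dI" by (rule injective_resolution_complex[OF res])
  interpret I: injective_complex R ?I ?dI by (rule I)
  have aug: "mod_map R H (?I 0) aug" "inj_on aug (carrier H)"
    and im: "aug ` carrier H = a_kernel (?I 0) (?I 1) (?dI 0)"
    using res by (auto simp: injective_resolution_def dest: mod_hom_map)
  have coset: "mod_map R ?Z H (\<lambda>x. ?B +>\<^bsub>?Z\<^esub> x)"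
    unfolding H_eq by (rule Z.coset_map[OF \<Gamma>.coboundaries_submodule])
  let ?e = "\<lambda>x. aug (?B +>\<^bsub>?Z\<^esub> x)"
  have e: "mod_map R ?Z (?I 0) ?e" by (rule mod_map_comp[OF coset aug(1)])
  obtain f where f: "mod_map R (\<Gamma> c) (?I 0) f" "\<And>x. x \<in> a_kernel (\<Gamma> c) (\<Gamma> (Suc c)) (d c) \<Longrightarrow> f x = ?e x"
    using baer_extend[OF I.baer \<Gamma>.Cmod \<Gamma>.cycles_submodule e] by blast
  have ker: "x \<in> a_kernel (\<Gamma> c) (\<Gamma> (Suc c)) (d c) \<longleftrightarrow> x \<in> carrier (\<Gamma> c) \<and> d c x = \<zero>\<^bsub>\<Gamma> (Suc c)\<^esub>" for x
    by (simp add: a_kernel_eq)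
  \<comment> \<open>The augmentation is injective, so \<open>?e\<close> kills exactly the
    coboundaries. This provides both \<open>phi_kernel\<close> and
    \<open>phi_coboundary\<close>.\<close>
  have e0: "?e x = \<zero>\<^bsub>?I 0\<^esub> \<longleftrightarrow> x \<in> ?B" if x: "x \<in> carrier ?Z" for x
  proof -
    have "?e x = \<zero>\<^bsub>?I 0\<^esub> \<longleftrightarrow> ?e x = aug \<zero>\<^bsub>H\<^esub>" using H.mod_map_zero[OF I.Cmod aug(1)] by simp
    also have "\<dots> \<longleftrightarrow> ?B +>\<^bsub>?Z\<^esub> x = \<zero>\<^bsub>H\<^esub>"
      using inj_on_eq_iff[OF aug(2) mod_map_closed[OF coset x] H.M.zero_closed] .
    also have "\<dots> \<longleftrightarrow> x \<in> ?B"
      using Z.coset_zero_iff[OF \<Gamma>.coboundaries_submodule x] by (simp add: H_eq)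
    finally show ?thesis .
  qed
  have fz: "?dI 0 (f x) = \<zero>\<^bsub>?I 1\<^esub>" if "x \<in> carrier (\<Gamma> c)" "d c x = \<zero>\<^bsub>\<Gamma> (Suc c)\<^esub>" for x
  proof -
    have "x \<in> carrier ?Z" using that ker by simp
    then have "?e x \<in> aug ` carrier H" using mod_map_closed[OF coset] by blast
    then show ?thesis using f(2)[of x] that ker unfolding im by (simp add: a_kernel_eq)
  qed
  obtain \<phi> where \<phi>: "\<phi> 0 = f" "\<And>p. mod_map R (\<Gamma> (c + p)) (?I p) (\<phi> p)"
    "\<And>p x. x \<in> carrier (\<Gamma> (c + p)) \<Longrightarrow> ?dI p (\<phi> p x) = \<phi> (Suc p) (d (c + p) x)"
    using comparison_map_exists[OF torsion_complex I ex f(1) fz] by blast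
  have "complex_comparison R \<Gamma> d ?I ?dI c \<phi>"
  proof (intro complex_comparison.intro complex_comparison_axioms.intro torsion_complex I)
    show "exact_at ?I ?dI (Suc p)" for p by (rule injective_resolution_complex(2)[OF res])
    show "\<exists>z\<in>carrier (\<Gamma> c). d c z = \<zero>\<^bsub>\<Gamma> (Suc c)\<^esub> \<and> \<phi> 0 z = y"
      if "y \<in> carrier (?I 0)" "?dI 0 y = \<zero>\<^bsub>?I 1\<^esub>" for y
    proof -
      have "y \<in> aug ` carrier H" unfolding im using that by (simp add: a_kernel_eq)
      then obtain z where z: "z \<in> carrier ?Z" "y = ?e z" unfolding H_eq quot_carrier by blast
      then have "z \<in> a_kernel (\<Gamma> c) (\<Gamma> (Suc c)) (d c)" by simp
      then show ?thesis using z(2) f(2)[of z] \<phi>(1) unfolding ker by auto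
    qed
    show "z \<in> ?B" if "z \<in> carrier (\<Gamma> c)" "d c z = \<zero>\<^bsub>\<Gamma> (Suc c)\<^esub>" "\<phi> 0 z = \<zero>\<^bsub>?I 0\<^esub>" for z
    proof -
      have "z \<in> a_kernel (\<Gamma> c) (\<Gamma> (Suc c)) (d c)" using that unfolding ker by blast
      then show ?thesis using e0[of z] f(2)[of z] that(3) \<phi>(1) by simp
    qed
    show "\<phi> 0 z = \<zero>\<^bsub>?I 0\<^esub>" if "z \<in> ?B" for z
    proof -
      have z: "z \<in> carrier ?Z" using Z.submodule_subset[OF \<Gamma>.coboundaries_submodule] that by blast
      then show ?thesis using e0[OF z] f(2)[of z] that \<phi>(1) by simp
    qed
  qed (use \<phi> ex in auto)
  then show "\<exists>\<phi>. complex_comparison R \<Gamma> d (inj_obj R H) (inj_diff R H) c \<phi>" by blast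
qed

end

section \<open>Vanishing and isomorphism from the dimension hypotheses\<close>

lemma proj_dim_resolution:
  fixes M :: "('a, 'm) module"
  assumes "proj_dim R M = enat n"
  shows "\<exists>(P :: nat \<Rightarrow> ('a, ('a, 'm) large) module) D aug.
    projective_resolution R M P D aug \<and> (\<forall>k>n. zero_mod (P k))"
proof -
  let ?S = "{enat n | n. \<exists>(P :: nat \<Rightarrow> ('a, ('a, 'm) large) module) D aug.
      projective_resolution R M P D aug \<and> (\<forall>k>n. zero_mod (P k))}"
  have S: "Inf ?S = enat n" using assms by (simp add: proj_dim_def)
  have "?S \<noteq> {}"
  proof
    assume "?S = {}"
    then have "Inf ?S = \<infinity>" unfolding Inf_enat_def by simp
    then show False using S by simp
  qed
  then have "Inf ?S \<in> ?S" by (metis (no_types, lifting) all_not_in_conv wellorder_InfI)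
  then show ?thesis unfolding S by auto
qed

theorem proposition2p8:
  fixes R :: "('a, 'r) ring_scheme" and \<aa> :: "'a set"
    and M :: "('a, 'm) module" and Y :: "('a, 'x) module"
  assumes "cring R" and "noetherian_ring R" and "ideal \<aa> R"
    and "Module.module R M" and "fin_gen R M" and "proj_dim R M < \<infinity>"
    and "Module.module R Y"
  shows "(\<forall>i::nat. ereal (real i) > ereal_of_enat (proj_dim R M) + coh_dim R \<aa> Y \<longrightarrow>
            zero_mod (gen_local_cohomology R \<aa> i M Y)) \<and>
         (\<forall>p c :: nat. proj_dim R M = enat p \<and> coh_dim R \<aa> Y = ereal (real c) \<longrightarrow>
            mod_isomorphic R (gen_local_cohomology R \<aa> (p + c) M Y)
              (Ext R p M (local_cohomology R \<aa> c Y)))"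
proof -
  interpret local_cohomology_setting R \<aa> M Y
    by (rule local_cohomology_setting.intro) (use assms in auto)
  have exact: "exact_at \<Gamma> d j" if "zero_mod (local_cohomology R \<aa> j Y)" for j
    using that unfolding local_cohomology_eq by (rule \<Gamma>.zero_cohomology_exact)
  have bound: "ereal (real j) \<le> coh_dim R \<aa> Y" if "\<not> zero_mod (local_cohomology R \<aa> j Y)" for j
    unfolding coh_dim_def using that by (intro SUP_upper) simp
  obtain n where n: "proj_dim R M = enat n" using assms(6) by (cases "proj_dim R M") auto
  obtain P :: "nat \<Rightarrow> ('a, ('a, 'm) large) module" and D aug
    where P: "projective_resolution R M P D aug" "\<And>k. k > n \<Longrightarrow> zero_mod (P k)"
    using proj_dim_resolution[OF n] by blast
  have vanish: "zero_mod (gen_local_cohomology R \<aa> i M Y)"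
    if i: "ereal (real i) > ereal_of_enat (proj_dim R M) + coh_dim R \<aa> Y" for i
  proof (cases "\<forall>j. zero_mod (local_cohomology R \<aa> j Y)")
    \<comment> \<open>Here \<open>coh_dim\<close> is -\<infinity> and i may be smaller than n. The
      torsion complex is exact everywhere, and s = 0 yields every degree.\<close>
    case True
    then show ?thesis
      using \<Gamma>.Hom_exact_above[OF M P, where s = 0 and i = i] exact by (intro gen_local_cohomology_zero) simp
  next
    case False
    then obtain j where "\<not> zero_mod (local_cohomology R \<aa> j Y)" by blast
    then have c0: "coh_dim R \<aa> Y \<ge> ereal (real j)" by (rule bound)
    \<comment> \<open>A bound for each nonvanishing degree k separately shows that \<Gamma> is exact
      from i - n on. Taking s = i - n avoids having to extract a natural number from
      \<open>coh_dim\<close>.\<close>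
    have key: "i > n + k" if "\<not> zero_mod (local_cohomology R \<aa> k Y)" for k
    proof -
      have "ereal (real n) + ereal (real k) \<le> ereal (real n) + coh_dim R \<aa> Y"
        using bound[OF that] by (intro add_left_mono)
      also have "\<dots> < ereal (real i)" using i by (simp add: n)
      finally show ?thesis by simp
    qed
    \<comment> \<open>Guards the truncated subtraction: (i - n) + n = i.\<close>
    have "i \<ge> n" using key[of j] \<open>\<not> zero_mod (local_cohomology R \<aa> j Y)\<close> by simp
    moreover have "exact_at \<Gamma> d k" if "k \<ge> i - n" for k
      using key[of k] that exact[of k] by fastforce
    ultimately show ?thesis
      using \<Gamma>.Hom_exact_above[OF M P, where s = "i - n" and i = i] by (intro gen_local_cohomology_zero) simp
  qed
  have iso: "mod_isomorphic R (gen_local_cohomology R \<aa> (p + c) M Y) (Ext R p M (local_cohomology R \<aa> c Y))"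
    if p: "proj_dim R M = enat p" and c: "coh_dim R \<aa> Y = ereal (real c)" for p c
  proof -
    have pn: "p = n" using p n by simp
    have ex: "exact_at \<Gamma> d j" if "j > c" for j
      using bound[of j] exact[of j] that by (fastforce simp: c)
    obtain \<phi> where \<phi>: "complex_comparison R \<Gamma> d (inj_obj R (local_cohomology R \<aa> c Y))
        (inj_diff R (local_cohomology R \<aa> c Y)) c \<phi>"
      using comparison_exists(2)[OF ex] by blast
    show ?thesis
      using complex_comparison.cohom_bijective[OF \<phi> M P] unfolding pn
      by (intro gen_local_cohomology_Ext[OF comparison_exists(1)[OF ex] \<phi>]) auto
  qed
  show ?thesis using vanish iso by blast
qed

end
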